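(* Let $h_1,\dots,h_n$ be the linear polynomials on $\mathbb{CP}^3$ determined by a fixed LeBrun twistor space on $n\mathbb{CP}^2$, and let $q:\mathscr Z\to\mathscr Q\setminus\{\boldsymbol o\}$ and $\pi:\mathscr Q\to\mathbb C$ be as in the context. For $s\in\mathbb C$ put $Z_s:=(\pi\circ q)^{-1}(s)$. Then: (i) If $s=1$, then $Z_s$ is biholomorphic to a Zariski open subset of the projective model of the fixed LeBrun twistor space on $n\mathbb{CP}^2$. (ii) If $s\in\mathbb R\setminus\{0\}$ and $|s|\le1$, then $Z_s$ is biholomorphic to a Zariski open subset of a projective model of a LeBrun twistor space on $n\mathbb{CP}^2$. (iii) If $s=0$, then $Z_s$ is biholomorphic to a variety of Hitchin's form $$\tilde Z=\left\{(x,y,z)\in\mathscr O(n)^{\oplus2}\oplus\mathscr O(2)\mid xy=(z-p_1(u))\cdots(z-p_n(u))\right\}$$ over $\mathbb{CP}^1$, where $p_i(u)$ $(1\le i\le n)$ are $n$ distinct quadratic polynomials satisfying Hitchin's reality conditions. (iv) In (i)–(iii) the biholomorphic maps can be taken in such a way that they preserve the real structures.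
   Context: Projective models. Let $Q=\mathbb{CP}^1\times\mathbb{CP}^1$ with non-homogeneous coordinates $(u,v)$, real structure $\sigma(u,v)=(\bar v,\bar u)$, $\mathscr O(a,b)=\mathrm{pr}_1^*\mathscr O(a)\otimes\mathrm{pr}_2^*\mathscr O(b)$, $\mathscr E_n=\mathscr O(n-1,1)\oplus\mathscr O(1,n-1)\oplus\mathscr O$, $\mathbb P(\mathscr E_n)=(\mathscr E_n\setminus\{0\})/\mathbb C^*$. Let $P_i=a_iuv+b_iu+c_iv+d_i$ $(1\le i\le n)$ with $a_i,d_i\in\mathbb R$, $b_i=\bar c_i$, define distinct smooth curves $\mathscr C_i=\{P_i=0\}$ of bidegree $(1,1)$ without real ($\sigma$-fixed) points; these correspond to $n$ distinct points (monopole points) of hyperbolic space $\mathscr H^3$. The projective model of the LeBrun twistor space on $n\mathbb{CP}^2$ determined by them is $X=\{(x,y,z)\in\mathbb P(\mathscr E_n)\mid xy=P_1\cdots P_n z^2\}$, $x\in\mathscr O(n-1,1)$, $y\in\mathscr O(1,n-1)$, $z\in\mathscr O$. The family of quadrics. Let $$\mathscr Q=\{(x_0,x_1,x_2,x_3)\times s\in\mathbb{CP}^3\times\mathbb C\mid s^2x_0^2-x_1^2-x_2x_3=0\},$$ with real structure $(x_0,x_1,x_2,x_3)\times s\mapsto(\bar x_0,\bar x_1,\bar x_3,\bar x_2)\times\bar s$, let $\pi:\mathscr Q\to\mathbb C$ be the projection to $s$, and $Q_s=\pi^{-1}(s)$. $Q_0$ is a cone with vertex $\boldsymbol o=(1,0,0,0)$,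 and $\boldsymbol o$ (at $s=0$) is the unique singular point of $\mathscr Q$. For $s\ne0$, $Q_s$ is identified with $Q$ by $u=x_2/(sx_0-x_1)$, $v=x_3/(sx_0-x_1)$. Put $$\mathscr D_1=\{x_3=sx_0-x_1=0\},\qquad \mathscr D_2=\{x_2=sx_0-x_1=0\}\subset\mathscr Q,$$ and on $\mathscr Q\setminus\{\boldsymbol o\}$ let $[\mathscr D_j]$ be the associated line bundles, $\mathscr L_1=[\mathscr D_1]^{n-1}\cdot[\mathscr D_2]$, $\mathscr L_2=[\mathscr D_1]\cdot[\mathscr D_2]^{n-1}$ (tensor products). As $\mathscr D_1+\mathscr D_2$ is cut out by $sx_0-x_1=0$, the pull-back of $\mathscr O_{\mathbb{CP}^3}(1)$ is isomorphic to $[\mathscr D_1]\cdot[\mathscr D_2]$ on $\mathscr Q\setminus\{\boldsymbol o\}$. The family $\mathscr Z$. Fix a LeBrun twistor space on $n\mathbb{CP}^2$, i.e. distinct smooth curves $\mathscr C_1,\dots,\mathscr C_n\subset Q$ of bidegree $(1,1)$ without $\sigma$-fixed points, where $\mathscr C_i=\{P_i=0\}$ for a polynomial $P_i=a_iuv+b_iu+c_iv+d_i$ with $a_i,d_i\in\mathbb R$, $b_i=\bar c_i$; its projective model is the variety $X=\{xy=P_1\cdots P_nz^2\}\subset\mathbb P(\mathscr E_n)$ determined by these curves. Identifying $Q$ with $Q_1\subset\mathbb{CP}^3$, each $\mathscr C_i$ is a plane section $Q_1\cap H_i$ with $H_i=\{h_i=0\}$, $h_i=x_0-b_ix_1-c_ix_2-\bar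 c_ix_3$, for some $b_i\in\mathbb R$, $c_i\in\mathbb C$ with $b_i^2+4|c_i|^2<1$ (not the coefficients of the polynomial $P_i$ defining $\mathscr C_i$). The $h_i$ define sections of $[\mathscr D_1]\cdot[\mathscr D_2]$ on $\mathscr Q\setminus\{\boldsymbol o\}$. Put $$\mathscr Z=\{(x,y)\in\mathscr L_1\oplus\mathscr L_2\mid xy=h_1h_2\cdots h_n\},$$ with projection $q:\mathscr Z\to\mathscr Q\setminus\{\boldsymbol o\}$. Hitchin's varieties. In $\tilde Z$, $\mathscr O(d)$ is the line bundle of degree $d$ on $\mathbb{CP}^1$ with coordinate $u$, $x,y\in\mathscr O(n)$, $z\in\mathscr O(2)$, and Hitchin's reality conditions on $p_i(u)=a_iu^2+2b_iu+c_i$ are $a_i=-\bar c_i$, $b_i\in\mathbb R$. A suitable small resolution of $\tilde Z$ is the twistor space of a Gibbons–Hawking hyperkähler metric on the minimal resolution of $\mathbb C^2/\Gamma$, with $\Gamma\subset\mathrm{SU}(2)$ cyclic of order $n$. Real structures. The real structure of $\mathscr Q$ interchanges $\mathscr D_1$ and $\mathscr D_2$, giving a natural anti-holomorphic isomorphism between $\mathscr L_1$ and $\mathscr L_2$, hence an anti-holomorphic involution $(x,y)\mapsto\varepsilon(\bar y,\bar x)$ of $\mathscr L_1\oplus\mathscr L_2$ preserving $\mathscr Z$; it preserves $Z_s$ for $s\in\mathbb R$. Likewise $\sigma$ induces $(x,y,z)\mapsto(\varepsilon\bar y,\varepsilon\bar x,\bar z)$ on $\mathbb P(\mathscr E_n)$,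 preserving $X$. Here $\varepsilon\in\{1,-1\}$ is a fixed sign convention, the same throughout. On $\tilde Z$ the real structure is the corresponding lift of the antipodal map: $(u,z,x,y)\mapsto(-1/\bar u,\,-\bar z/\bar u^2,\,-\varepsilon\bar y/\bar u^n,\,(-1)^{n-1}\varepsilon\bar x/\bar u^n)$.
   Formalization: In (iv) for s=1, real structures are shown preserved only when the chosen equations have P_1⋯P_n > 0 on the real locus of Q (always achievable by rescaling the P_i by real factors); for the opposite sign the claim is false. The biholomorphism in (i) is for all choices. *)

theory Defs
  imports "HOL-Analysis.Analysis"
begin

section \<open>Holomorphic maps between reduced complex spaces\<close>

text \<open>The library has no holomorphic maps of several variables: we ask for a Frechet derivative
  that is complex linear, i.e. given by a complex Jacobian matrix.\<close>

definition holomorphic_vec_on :: "(complex^'m \<Rightarrow> complex^'k) \<Rightarrow> (complex^'m) set \<Rightarrow> bool" where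
  "holomorphic_vec_on F W \<longleftrightarrow>
     (\<forall>w\<in>W. \<exists>J :: complex^'m^'k. (F has_derivative (\<lambda>v. J *v v)) (at w))"

text \<open>The complex structure of a space is given by a family of injective local parametrisations
  \<open>\<phi> : D \<rightarrow> M\<close>. Here \<open>D\<close> need not be open: it is a locally closed analytic subset of
  \<open>\<complex>\<^sup>m\<close> (a local model of a reduced complex space).\<close>

type_synonym ('m, 'a) param = "(complex^'m) set \<times> (complex^'m \<Rightarrow> 'a)"

text \<open>A map between subsets of such spaces is holomorphic if, in suitable local parametrisations
  around each point and its image, it is the restriction of a holomorphic map between open subsets
  of the coordinate spaces. As \<open>F\<close> is continuous, this includes continuity.\<close>

definition holomorphic_map ::
  "('m::finite, 'a) param set \<Rightarrow> 'a set \<Rightarrow> ('k::finite, 'b) param set \<Rightarrow> 'b set \<Rightarrow> ('a \<Rightarrow> 'b) \<Rightarrow> bool"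
where
  "holomorphic_map A X B Y f \<longleftrightarrow> f ` X \<subseteq> Y \<and>
     (\<forall>p\<in>X. \<exists>(D, \<phi>)\<in>A. \<exists>(E, \<psi>)\<in>B. \<exists>w\<in>D. \<exists>W F.
        \<phi> w = p \<and> open W \<and> w \<in> W \<and> holomorphic_vec_on F W \<and>
        (\<forall>z\<in>D \<inter> W. \<phi> z \<in> X \<longrightarrow> F z \<in> E \<and> f (\<phi> z) = \<psi> (F z)))"

definition biholomorphic_map ::
  "('m::finite, 'a) param set \<Rightarrow> 'a set \<Rightarrow> ('k::finite, 'b) param set \<Rightarrow> 'b set \<Rightarrow> ('a \<Rightarrow> 'b) \<Rightarrow> bool"
where
  "biholomorphic_map A X B Y f \<longleftrightarrow>
     bij_betw f X Y \<and> holomorphic_map A X B Y f \<and> holomorphic_map B Y A X (inv_into X f)"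

inductive polynomial_fun :: "(complex^'m \<Rightarrow> complex) \<Rightarrow> bool" where
  const: "polynomial_fun (\<lambda>w. c)"
| coord: "polynomial_fun (\<lambda>w. w $ i)"
| add: "polynomial_fun p \<Longrightarrow> polynomial_fun q \<Longrightarrow> polynomial_fun (\<lambda>w. p w + q w)"
| mult: "polynomial_fun p \<Longrightarrow> polynomial_fun q \<Longrightarrow> polynomial_fun (\<lambda>w. p w * q w)"

text \<open>To be used with parametrisations by affine spaces only.\<close>

definition zariski_closed :: "('m::finite, 'a) param set \<Rightarrow> 'a set \<Rightarrow> bool" where
  "zariski_closed A V \<longleftrightarrow>
     (\<forall>(D, \<phi>)\<in>A. \<exists>S. (\<forall>p\<in>S. polynomial_fun p) \<and> (\<forall>w\<in>D. \<phi> w \<in> V \<longleftrightarrow> (\<forall>p\<in>S. p w = 0)))"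

definition zariski_open_in :: "('m::finite, 'a) param set \<Rightarrow> 'a set \<Rightarrow> 'a set \<Rightarrow> bool" where
  "zariski_open_in A X U \<longleftrightarrow> (\<exists>V. zariski_closed A V \<and> U = X - V)"


section \<open>Homogeneous coordinates\<close>

text \<open>All spaces below are quotients \<open>reps // rel\<close> of a set of homogeneous coordinates. A map which is
  well defined on the quotient is applied to a point (an equivalence class) by taking the image of
  the class.\<close>

type_synonym hom2 = "complex \<times> complex"
type_synonym hom4 = "complex \<times> complex \<times> complex \<times> complex"

fun scale2 :: "complex \<Rightarrow> hom2 \<Rightarrow> hom2" where
  "scale2 c (u0, u1) = (c * u0, c * u1)"

fun scale4 :: "complex \<Rightarrow> hom4 \<Rightarrow> hom4" where
  "scale4 c (x0, x1, x2, x3) = (c * x0, c * x1, c * x2, c * x3)"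

fun cnj2 :: "hom2 \<Rightarrow> hom2" where
  "cnj2 (u0, u1) = (cnj u0, cnj u1)"


section \<open>The surface Q and the projective models of LeBrun twistor spaces\<close>

text \<open>\<open>((u0, u1), (v0, v1))\<close> has non-homogeneous coordinates \<open>u = u0/u1\<close>, \<open>v = v0/v1\<close>.\<close>

definition Q_reps :: "(hom2 \<times> hom2) set" where
  "Q_reps = {(u, v). u \<noteq> (0, 0) \<and> v \<noteq> (0, 0)}"

definition Q_rel :: "((hom2 \<times> hom2) \<times> (hom2 \<times> hom2)) set" where
  "Q_rel = {((u, v), (u', v')). (u, v) \<in> Q_reps \<and>
     (\<exists>l m. l \<noteq> 0 \<and> m \<noteq> 0 \<and> u' = scale2 l u \<and> v' = scale2 m v)}"

definition Q_surf :: "(hom2 \<times> hom2) set set" where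
  "Q_surf = Q_reps // Q_rel"

definition sigma :: "(hom2 \<times> hom2) set \<Rightarrow> (hom2 \<times> hom2) set" where
  "sigma p = (\<lambda>(u, v). (cnj2 v, cnj2 u)) ` p"

text \<open>The bihomogeneous form of \<open>a u v + b u + c v + d\<close>.\<close>

fun bideg11 :: "real \<Rightarrow> complex \<Rightarrow> complex \<Rightarrow> real \<Rightarrow> hom2 \<times> hom2 \<Rightarrow> complex" where
  "bideg11 a b c d ((u0, u1), (v0, v1)) =
     of_real a * u0 * v0 + b * u0 * v1 + c * u1 * v0 + of_real d * u1 * v1"

definition curve11 :: "real \<Rightarrow> complex \<Rightarrow> complex \<Rightarrow> real \<Rightarrow> (hom2 \<times> hom2) set set" where
  "curve11 a b c d = {p \<in> Q_surf. \<forall>r\<in>p. bideg11 a b c d r = 0}"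

text \<open>Jacobian criterion in bihomogeneous coordinates.\<close>

definition smooth11 :: "real \<Rightarrow> complex \<Rightarrow> complex \<Rightarrow> real \<Rightarrow> bool" where
  "smooth11 a b c d \<longleftrightarrow>
     (\<forall>u0 u1 v0 v1. ((u0, u1), (v0, v1)) \<in> Q_reps \<and> bideg11 a b c d ((u0, u1), (v0, v1)) = 0 \<longrightarrow>
        deriv (\<lambda>t. bideg11 a b c d ((t, u1), (v0, v1))) u0 \<noteq> 0 \<or>
        deriv (\<lambda>t. bideg11 a b c d ((u0, t), (v0, v1))) u1 \<noteq> 0 \<or>
        deriv (\<lambda>t. bideg11 a b c d ((u0, u1), (t, v1))) v0 \<noteq> 0 \<or>
        deriv (\<lambda>t. bideg11 a b c d ((u0, u1), (v0, t))) v1 \<noteq> 0)"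

definition lebrun_data ::
  "nat \<Rightarrow> (nat \<Rightarrow> real) \<Rightarrow> (nat \<Rightarrow> complex) \<Rightarrow> (nat \<Rightarrow> complex) \<Rightarrow> (nat \<Rightarrow> real) \<Rightarrow> bool"
where
  "lebrun_data n a b c d \<longleftrightarrow>
     (\<forall>i\<in>{1..n}. b i = cnj (c i) \<and> smooth11 (a i) (b i) (c i) (d i) \<and>
        (\<forall>p\<in>curve11 (a i) (b i) (c i) (d i). sigma p \<noteq> p)) \<and>
     inj_on (\<lambda>i. curve11 (a i) (b i) (c i) (d i)) {1..n}"

text \<open>The total space of \<open>O(a,b)\<close> is the quotient of the triples \<open>(u, v, t)\<close> by
  \<open>(u, v, t) \<sim> (l u, m v, l\<^sup>a m\<^sup>b t)\<close>; the factor \<open>k\<close> below is the fibrewise projectivisation of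
  \<open>O(n-1,1) \<oplus> O(1,n-1) \<oplus> O\<close>.\<close>

type_synonym pe_rep = "hom2 \<times> hom2 \<times> complex \<times> complex \<times> complex"

definition PE_reps :: "pe_rep set" where
  "PE_reps = {(u, v, x, y, z). (u, v) \<in> Q_reps \<and> (x, y, z) \<noteq> (0, 0, 0)}"

definition PE_rel :: "nat \<Rightarrow> (pe_rep \<times> pe_rep) set" where
  "PE_rel n = {((u, v, x, y, z), r'). (u, v, x, y, z) \<in> PE_reps \<and>
     (\<exists>l m k. l \<noteq> 0 \<and> m \<noteq> 0 \<and> k \<noteq> 0 \<and>
        r' = (scale2 l u, scale2 m v,
              k * l ^ (n - 1) * m * x, k * l * m ^ (n - 1) * y, k * z))}"

definition PE :: "nat \<Rightarrow> pe_rep set set" where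
  "PE n = PE_reps // PE_rel n"

definition affine2 :: "bool \<Rightarrow> complex \<Rightarrow> hom2" where
  "affine2 i t = (if i then (1, t) else (t, 1))"

definition PE_param :: "bool \<Rightarrow> bool \<Rightarrow> nat \<Rightarrow> complex^4 \<Rightarrow> pe_rep" where
  "PE_param i j k w =
     (affine2 i (w$1), affine2 j (w$2),
      (if k = 0 then (1, w$3, w$4) else if k = 1 then (w$3, 1, w$4) else (w$3, w$4, 1)))"

definition PE_atlas :: "nat \<Rightarrow> (4, pe_rep set) param set" where
  "PE_atlas n = {(UNIV, \<lambda>w. PE_rel n `` {PE_param i j k w}) | i j k. k < 3}"

definition lebrun_model ::
  "nat \<Rightarrow> (nat \<Rightarrow> real) \<Rightarrow> (nat \<Rightarrow> complex) \<Rightarrow> (nat \<Rightarrow> complex) \<Rightarrow> (nat \<Rightarrow> real) \<Rightarrow> pe_rep set set"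
where
  "lebrun_model n a b c d =
     {p \<in> PE n. \<forall>(u, v, x, y, z)\<in>p.
        x * y = (\<Prod>i=1..n. bideg11 (a i) (b i) (c i) (d i) (u, v)) * z\<^sup>2}"

definition PE_real :: "real \<Rightarrow> pe_rep set \<Rightarrow> pe_rep set" where
  "PE_real e p = (\<lambda>(u, v, x, y, z).
     (cnj2 v, cnj2 u, of_real e * cnj y, of_real e * cnj x, cnj z)) ` p"

text \<open>A real curve without real points determines its equation only up to a nonzero real factor, and
  changing the sign of their product amounts to replacing \<open>e\<close> by \<open>-e\<close> in the real structure of the model.
  The product is real on the real locus \<open>v = cnj u\<close> and has no zeros there; the following fixes
  its sign.\<close>

definition sign_normalised ::
  "nat \<Rightarrow> (nat \<Rightarrow> real) \<Rightarrow> (nat \<Rightarrow> complex) \<Rightarrow> (nat \<Rightarrow> complex) \<Rightarrow> (nat \<Rightarrow> real) \<Rightarrow> bool"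
where
  "sign_normalised n a b c d \<longleftrightarrow>
     (\<forall>u. u \<noteq> (0, 0) \<longrightarrow> 0 < Re (\<Prod>i=1..n. bideg11 (a i) (b i) (c i) (d i) (u, cnj2 u)))"


section \<open>The family of quadrics\<close>

fun quadric_form :: "hom4 \<Rightarrow> complex \<Rightarrow> complex" where
  "quadric_form (x0, x1, x2, x3) s = s\<^sup>2 * x0\<^sup>2 - x1\<^sup>2 - x2 * x3"

definition quad_reps :: "(hom4 \<times> complex) set" where
  "quad_reps = {(x, s). x \<noteq> (0, 0, 0, 0) \<and> quadric_form x s = 0}"

definition quad_rel :: "((hom4 \<times> complex) \<times> (hom4 \<times> complex)) set" where
  "quad_rel = {((x, s), (x', s')). (x, s) \<in> quad_reps \<and> s' = s \<and> (\<exists>l. l \<noteq> 0 \<and> x' = scale4 l x)}"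

definition quad_fam :: "(hom4 \<times> complex) set set" where
  "quad_fam = quad_reps // quad_rel"

definition quad_proj :: "(hom4 \<times> complex) set \<Rightarrow> complex" where
  "quad_proj p = the_elem (snd ` p)"

definition quad_fibre :: "complex \<Rightarrow> (hom4 \<times> complex) set set" where
  "quad_fibre s = {p \<in> quad_fam. quad_proj p = s}"

definition vertex :: "(hom4 \<times> complex) set" where
  "vertex = quad_rel `` {((1, 0, 0, 0), 0)}"

text \<open>The identification of \<open>Q\<close> with the fibre over \<open>s \<noteq> 0\<close>. It is the inverse of
  \<open>u = x2/(s x0 - x1)\<close>, \<open>v = x3/(s x0 - x1)\<close> (see \<open>segre_inverse\<close>), in the form
  \<open>s x0 + x1 = u0 v0\<close>, \<open>s x0 - x1 = u1 v1\<close>, \<open>x2 = u0 v1\<close>, \<open>x3 = u1 v0\<close> valid everywhere.\<close>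

fun segre :: "complex \<Rightarrow> hom2 \<times> hom2 \<Rightarrow> hom4" where
  "segre s ((u0, u1), (v0, v1)) =
     ((u0 * v0 + u1 * v1) / (2 * s), (u0 * v0 - u1 * v1) / 2, u0 * v1, u1 * v0)"

definition quad_ident :: "complex \<Rightarrow> (hom2 \<times> hom2) set \<Rightarrow> (hom4 \<times> complex) set" where
  "quad_ident s p = quad_rel `` ((\<lambda>r. (segre s r, s)) ` p)"

lemma segre_inverse:
  assumes "s \<noteq> 0" "u1 \<noteq> 0" "v1 \<noteq> 0" "segre s ((u0, u1), (v0, v1)) = (x0, x1, x2, x3)"
  shows "quadric_form (x0, x1, x2, x3) s = 0"
    and "u0 / u1 = x2 / (s * x0 - x1)" and "v0 / v1 = x3 / (s * x0 - x1)"
proof -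
  have *: "s * x0 = (u0 * v0 + u1 * v1) / 2" "x1 = (u0 * v0 - u1 * v1) / 2"
    "x2 = u0 * v1" "x3 = u1 * v0"
    using assms by auto
  have **: "s * x0 - x1 = u1 * v1" unfolding *(1,2) by (simp add: field_simps)
  show "u0 / u1 = x2 / (s * x0 - x1)" "v0 / v1 = x3 / (s * x0 - x1)"
    unfolding ** *(3,4) using assms(2,3) by auto
  have "quadric_form (x0, x1, x2, x3) s = (s * x0)\<^sup>2 - x1\<^sup>2 - x2 * x3"
    by (simp add: power_mult_distrib)
  also have "\<dots> = 0"
    unfolding * by (simp add: power2_eq_square field_simps)
  finally show "quadric_form (x0, x1, x2, x3) s = 0" .
qed

fun hplane :: "real \<Rightarrow> complex \<Rightarrow> hom4 \<Rightarrow> complex" where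
  "hplane \<beta> \<gamma> (x0, x1, x2, x3) = x0 - of_real \<beta> * x1 - \<gamma> * x2 - cnj \<gamma> * x3"

definition plane_section :: "real \<Rightarrow> complex \<Rightarrow> complex \<Rightarrow> (hom4 \<times> complex) set set" where
  "plane_section \<beta> \<gamma> s = {p \<in> quad_fibre s. \<forall>(x, _)\<in>p. hplane \<beta> \<gamma> x = 0}"


section \<open>The line bundles on the punctured family\<close>

definition quad0_reps :: "(hom4 \<times> complex) set" where
  "quad0_reps = {r \<in> quad_reps. quad_rel `` {r} \<noteq> vertex}"

text \<open>Local equations of \<open>D1 = {x3 = s x0 - x1 = 0}\<close> and \<open>D2 = {x2 = s x0 - x1 = 0}\<close> on a cover
  of the punctured family by two open sets each. They come from
  \<open>(s x0 - x1) (s x0 + x1) = x2 x3\<close>; the two expressions for an equation agree where both are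
  defined, by the same identity.\<close>

fun D1_dom :: "bool \<Rightarrow> hom4 \<Rightarrow> complex \<Rightarrow> bool" where
  "D1_dom i (x0, x1, x2, x3) s \<longleftrightarrow>
     (if i then x2 \<noteq> 0 \<or> s * x0 + x1 \<noteq> 0 else x3 \<noteq> 0 \<or> s * x0 - x1 \<noteq> 0)"

fun D1_eq :: "bool \<Rightarrow> hom4 \<Rightarrow> complex \<Rightarrow> complex" where
  "D1_eq i (x0, x1, x2, x3) s =
     (if i then (if x2 \<noteq> 0 then (s * x0 - x1) / x2 else x3 / (s * x0 + x1)) else 1)"

fun D2_dom :: "bool \<Rightarrow> hom4 \<Rightarrow> complex \<Rightarrow> bool" where
  "D2_dom j (x0, x1, x2, x3) s \<longleftrightarrow>
     (if j then x3 \<noteq> 0 \<or> s * x0 + x1 \<noteq> 0 else x2 \<noteq> 0 \<or> s * x0 - x1 \<noteq> 0)"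

fun D2_eq :: "bool \<Rightarrow> hom4 \<Rightarrow> complex \<Rightarrow> complex" where
  "D2_eq j (x0, x1, x2, x3) s =
     (if j then (if x3 \<noteq> 0 then (s * x0 - x1) / x3 else x2 / (s * x0 + x1)) else 1)"

text \<open>The transition functions \<open>f\<^sub>i / f\<^sub>j\<close> of the associated line bundles; the case \<open>i = j\<close>
  is separate because the quotient is then \<open>0/0\<close> along the divisor.\<close>

definition D1_trans :: "bool \<Rightarrow> bool \<Rightarrow> hom4 \<Rightarrow> complex \<Rightarrow> complex" where
  "D1_trans i i' x s = (if i = i' then 1 else D1_eq i x s / D1_eq i' x s)"

definition D2_trans :: "bool \<Rightarrow> bool \<Rightarrow> hom4 \<Rightarrow> complex \<Rightarrow> complex" where
  "D2_trans j j' x s = (if j = j' then 1 else D2_eq j x s / D2_eq j' x s)"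

text \<open>A point of the total space of \<open>L1 \<oplus> L2\<close>, with \<open>L1 = [D1]\<^sup>n\<^sup>-\<^sup>1 [D2]\<close> and
  \<open>L2 = [D1] [D2]\<^sup>n\<^sup>-\<^sup>1\<close>, is represented by a point \<open>(x, s)\<close>, the index \<open>(i, j)\<close> of a
  trivialisation over it, and the two fibre coordinates in this trivialisation.\<close>

type_synonym lb_rep = "hom4 \<times> complex \<times> bool \<times> bool \<times> complex \<times> complex"

definition LB_reps :: "lb_rep set" where
  "LB_reps = {(x, s, i, j, \<xi>, \<eta>). (x, s) \<in> quad0_reps \<and> D1_dom i x s \<and> D2_dom j x s}"

definition LB_rel :: "nat \<Rightarrow> (lb_rep \<times> lb_rep) set" where
  "LB_rel n = {((x, s, i, j, \<xi>, \<eta>), (x', s', i', j', \<xi>', \<eta>')).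
     (x, s, i, j, \<xi>, \<eta>) \<in> LB_reps \<and> (x', s', i', j', \<xi>', \<eta>') \<in> LB_reps \<and>
     ((x, s), (x', s')) \<in> quad_rel \<and>
     \<xi>' = D1_trans i' i x s ^ (n - 1) * D2_trans j' j x s * \<xi> \<and>
     \<eta>' = D1_trans i' i x s * D2_trans j' j x s ^ (n - 1) * \<eta>}"

definition LB :: "nat \<Rightarrow> lb_rep set set" where
  "LB n = LB_reps // LB_rel n"

definition LB_proj :: "lb_rep set \<Rightarrow> (hom4 \<times> complex) set" where
  "LB_proj p = (\<lambda>(x, s, _). (x, s)) ` p"

fun affine4 :: "nat \<Rightarrow> hom2 \<times> complex \<Rightarrow> hom4" where
  "affine4 k ((a, b), c) =
     (if k = 0 then (1, a, b, c) else if k = 1 then (a, 1, b, c)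
      else if k = 2 then (a, b, 1, c) else (a, b, c, 1))"

definition LB_param :: "nat \<Rightarrow> bool \<Rightarrow> bool \<Rightarrow> complex^6 \<Rightarrow> lb_rep" where
  "LB_param k i j w = (affine4 k ((w$1, w$2), w$3), w$4, i, j, w$5, w$6)"

definition LB_atlas :: "nat \<Rightarrow> (6, lb_rep set) param set" where
  "LB_atlas n =
     {({w. LB_param k i j w \<in> LB_reps}, \<lambda>w. LB_rel n `` {LB_param k i j w}) | k i j. k < 4}"

text \<open>A linear form \<open>h\<close> is the section \<open>h / (s x0 - x1) \<cdot> t\<close> of \<open>[D1] [D2]\<close>, where \<open>t\<close> is the
  canonical section, vanishing on \<open>D1 + D2\<close>. In the trivialisation \<open>(i, j)\<close> it is \<open>h\<close> divided by
  the following unit (see \<open>lin_unit_eq\<close>).\<close>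

fun lin_unit :: "bool \<Rightarrow> bool \<Rightarrow> hom4 \<Rightarrow> complex \<Rightarrow> complex" where
  "lin_unit i j (x0, x1, x2, x3) s =
     (if i then (if j then s * x0 + x1 else x2) else (if j then x3 else s * x0 - x1))"

lemma quadric_form_factor:
  assumes "(x, s) \<in> quad_reps" "x = (x0, x1, x2, x3)"
  shows "(s * x0 - x1) * (s * x0 + x1) = x2 * x3"
  using assms by (auto simp: quad_reps_def power2_eq_square algebra_simps)

lemma D1_eq_zero_iff:
  assumes "((x0, x1, x2, x3), s) \<in> quad_reps" "D1_dom i (x0, x1, x2, x3) s"
  shows "D1_eq i (x0, x1, x2, x3) s = 0 \<longleftrightarrow> x3 = 0 \<and> s * x0 - x1 = 0"
  using quadric_form_factor[OF assms(1) refl] assms(2)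
  by (simp del: eq_iff_diff_eq_0 right_minus_eq) (metis divide_eq_0_iff mult_eq_0_iff)

lemma D2_eq_zero_iff:
  assumes "((x0, x1, x2, x3), s) \<in> quad_reps" "D2_dom j (x0, x1, x2, x3) s"
  shows "D2_eq j (x0, x1, x2, x3) s = 0 \<longleftrightarrow> x2 = 0 \<and> s * x0 - x1 = 0"
  using quadric_form_factor[OF assms(1) refl] assms(2)
  by (simp del: right_minus_eq) (metis divide_eq_0_iff mult_eq_0_iff)

lemma lin_unit_nonzero:
  assumes "(x, s) \<in> quad_reps" "D1_dom i x s" "D2_dom j x s"
  shows "lin_unit i j x s \<noteq> 0"
proof -
  obtain x0 x1 x2 x3 where x: "x = (x0, x1, x2, x3)" by (cases x)
  define p q where "p = s * x0 - x1" and "q = s * x0 + x1"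
  have "p * q = x2 * x3" using quadric_form_factor[OF assms(1) x] by (simp add: p_def q_def)
  then show ?thesis
    using assms(2,3) unfolding x D1_dom.simps D2_dom.simps lin_unit.simps p_def[symmetric] q_def[symmetric]
    by (cases i; cases j) auto
qed

lemma lin_unit_eq:
  assumes "((x0, x1, x2, x3), s) \<in> quad_reps"
    "D1_dom i (x0, x1, x2, x3) s" "D2_dom j (x0, x1, x2, x3) s"
  shows "lin_unit i j (x0, x1, x2, x3) s * (D1_eq i (x0, x1, x2, x3) s * D2_eq j (x0, x1, x2, x3) s)
    = s * x0 - x1"
proof -
  define p q where "p = s * x0 - x1" and "q = s * x0 + x1"
  have pq: "p * q = x2 * x3" using quadric_form_factor[OF assms(1) refl] by (simp add: p_def q_def)
  then have *: "q \<noteq> 0 \<Longrightarrow> p = x2 * x3 / q" by (simp add: field_simps)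
  show ?thesis
    using assms(2,3) pq *
    unfolding D1_dom.simps D2_dom.simps lin_unit.simps D1_eq.simps D2_eq.simps
      p_def[symmetric] q_def[symmetric]
    by (cases i; cases j; cases "x2 = 0"; cases "x3 = 0"; cases "q = 0"; auto simp: field_simps)
qed

definition Z_fam :: "nat \<Rightarrow> (nat \<Rightarrow> hom4 \<Rightarrow> complex) \<Rightarrow> lb_rep set set" where
  "Z_fam n h = {p \<in> LB n. \<forall>(x, s, i, j, \<xi>, \<eta>)\<in>p. \<xi> * \<eta> = (\<Prod>m=1..n. h m x / lin_unit i j x s)}"

definition Z_fibre :: "nat \<Rightarrow> (nat \<Rightarrow> hom4 \<Rightarrow> complex) \<Rightarrow> complex \<Rightarrow> lb_rep set set" where
  "Z_fibre n h s = {p \<in> Z_fam n h. quad_proj (LB_proj p) = s}"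

text \<open>The real structure of the quadrics sends the local equation \<open>D1_eq i\<close> to the complex conjugate
  of \<open>D2_eq i\<close>, hence exchanges the indices \<open>i\<close> and \<open>j\<close> of the trivialisations.\<close>

fun quad_real_rep :: "hom4 \<Rightarrow> hom4" where
  "quad_real_rep (x0, x1, x2, x3) = (cnj x0, cnj x1, cnj x3, cnj x2)"

lemma D2_eq_real: "D2_eq i (quad_real_rep x) (cnj s) = cnj (D1_eq i x s)"
  by (cases x) simp

definition LB_real :: "real \<Rightarrow> lb_rep set \<Rightarrow> lb_rep set" where
  "LB_real e p = (\<lambda>(x, s, i, j, \<xi>, \<eta>).
     (quad_real_rep x, cnj s, j, i, of_real e * cnj \<eta>, of_real e * cnj \<xi>)) ` p"


section \<open>Hitchin's varieties\<close>

text \<open>The total space of \<open>O(n) \<oplus> O(n) \<oplus> O(2)\<close> over the projective line with coordinate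
  \<open>u = u0/u1\<close>; the fibre coordinate of \<open>O(d)\<close> over \<open>u1 \<noteq> 0\<close> is \<open>t / u1\<^sup>d\<close>.\<close>

type_synonym hit_rep = "hom2 \<times> complex \<times> complex \<times> complex"

definition Hit_reps :: "hit_rep set" where
  "Hit_reps = {(u, x, y, z). u \<noteq> (0, 0)}"

definition Hit_rel :: "nat \<Rightarrow> (hit_rep \<times> hit_rep) set" where
  "Hit_rel n = {((u, x, y, z), r'). (u, x, y, z) \<in> Hit_reps \<and>
     (\<exists>l. l \<noteq> 0 \<and> r' = (scale2 l u, l ^ n * x, l ^ n * y, l\<^sup>2 * z))}"

definition Hit :: "nat \<Rightarrow> hit_rep set set" where
  "Hit n = Hit_reps // Hit_rel n"

definition Hit_atlas :: "nat \<Rightarrow> (4, hit_rep set) param set" where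
  "Hit_atlas n = {(UNIV, \<lambda>w. Hit_rel n `` {(affine2 i (w$1), w$2, w$3, w$4)}) | i. True}"

text \<open>The homogeneous form of \<open>a u\<^sup>2 + 2 b u + c\<close>.\<close>

fun quadratic2 :: "complex \<Rightarrow> real \<Rightarrow> complex \<Rightarrow> hom2 \<Rightarrow> complex" where
  "quadratic2 a b c (u0, u1) = a * u0\<^sup>2 + 2 * of_real b * u0 * u1 + c * u1\<^sup>2"

definition hitchin_data ::
  "nat \<Rightarrow> (nat \<Rightarrow> complex) \<Rightarrow> (nat \<Rightarrow> real) \<Rightarrow> (nat \<Rightarrow> complex) \<Rightarrow> bool"
where
  "hitchin_data n a b c \<longleftrightarrow>
     (\<forall>i\<in>{1..n}. a i = - cnj (c i)) \<and> inj_on (\<lambda>i. quadratic2 (a i) (b i) (c i)) {1..n}"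

definition hitchin_variety ::
  "nat \<Rightarrow> (nat \<Rightarrow> complex) \<Rightarrow> (nat \<Rightarrow> real) \<Rightarrow> (nat \<Rightarrow> complex) \<Rightarrow> hit_rep set set"
where
  "hitchin_variety n a b c =
     {p \<in> Hit n. \<forall>(u, x, y, z)\<in>p. x * y = (\<Prod>i=1..n. z - quadratic2 (a i) (b i) (c i) u)}"

text \<open>The lift of the antipodal map which in the coordinates over \<open>u1 \<noteq> 0\<close> is
  \<open>(u, z, x, y) \<mapsto> (-1/cnj u, - cnj z/cnj u\<^sup>2, - e cnj y/cnj u\<^sup>n, (-1)\<^sup>n\<^sup>-\<^sup>1 e cnj x/cnj u\<^sup>n)\<close>.\<close>

definition Hit_real :: "nat \<Rightarrow> real \<Rightarrow> hit_rep set \<Rightarrow> hit_rep set" where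
  "Hit_real n e p = (\<lambda>((u0, u1), x, y, z).
     ((- cnj u1, cnj u0), - of_real e * cnj y, (- 1) ^ (n - 1) * of_real e * cnj x, - cnj z)) ` p"

end

theory Submission
  imports Defs
begin

text \<open>The key is a remark on the four linear forms \<open>lin_unit a b\<close> that trivialise
\<open>[D1] [D2]\<close>. Arranged as a \<open>2 \<times> 2\<close> matrix with index \<open>(a, b)\<close>, they have determinant
\<open>s\<^sup>2 x0\<^sup>2 - x1\<^sup>2 - x2 x3\<close>, so on a quadric the matrix is singular, and it is nonzero away from the vertex.
Hence it has rank one: up to a factor it is \<open>u\<^sub>a v\<^sub>b\<close> for two pairs \<open>u\<close>, \<open>v\<close> of homogeneous coordinates,
unique up to separate scalings (\<open>quad_coords\<close>). In these coordinates the divisors are \<open>u1 = 0\<close> and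
\<open>v1 = 0\<close>, and the transition functions of \<open>[D1]\<close> and \<open>[D2]\<close> are quotients \<open>u\<^sub>i / u\<^sub>i'\<close> and
\<open>v\<^sub>j / v\<^sub>j'\<close>. Therefore \<open>\<xi> u\<^sub>i\<^sup>n\<^sup>-\<^sup>1 v\<^sub>j\<close> and \<open>\<eta> u\<^sub>i v\<^sub>j\<^sup>n\<^sup>-\<^sup>1\<close> do not depend on the trivialisation
\<open>(i, j)\<close> (\<open>LB_rel_coords\<close>); they are the homogeneous fibre coordinates \<open>x\<close> and \<open>y\<close>, and the equation
of the family becomes \<open>x y = \<Prod> h\<^sub>m\<close>.

For \<open>s \<noteq> 0\<close> the pair \<open>(u, v)\<close> determines the point of the quadric by the Segre map, so the fibre is
the part \<open>z \<noteq> 0\<close> of \<open>x y = \<Prod> h\<^sub>m(segre(u, v)) z\<^sup>2\<close> in the projective bundle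
(\<open>nonzero_fibre_biholomorphic\<close>). At \<open>s = 1\<close> a given equation \<open>P\<^sub>m\<close> and \<open>h\<^sub>m \<circ> segre\<close>
vanish on the same irreducible curve, so they differ by a real factor \<open>\<kappa>\<^sub>m\<close>
(\<open>plane_section_equation\<close>), which is absorbed by multiplying \<open>x\<close> and \<open>y\<close> with a square root of
\<open>\<Prod> \<kappa>\<^sub>m\<close>. The sign normalisation says exactly that this root is real, as compatibility with the real
structures demands. For other real \<open>s\<close> the forms \<open>h\<^sub>m \<circ> segre\<close> are themselves hermitian matrices, and
\<open>\<bar>s\<bar> \<le> 1\<close> together with the ball condition makes them definite: the curves are smooth and have no real points.

At \<open>s = 0\<close> the matrix of the forms is moreover trace-free, which forces \<open>v\<close> to be \<open>u\<close> turned by a right angle.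
Now \<open>u\<close> determines only \<open>x1, x2, x3\<close>, as quadratic forms in \<open>u\<close>, and the free coordinate \<open>x0\<close>
becomes the fibre coordinate \<open>z\<close> of \<open>O(2)\<close>. Both line bundles turn into \<open>O(n)\<close>, and \<open>h\<^sub>m\<close> into
\<open>z - p\<^sub>m(u)\<close>. The real structure exchanges \<open>u\<close> and \<open>v\<close> up to conjugation, which for these \<open>v\<close> is the antipodal
map (\<open>zero_fibre_biholomorphic\<close>).

All spaces are quotients, and the maps between them are given by the relation that two representatives have the
same homogeneous coordinates; applying the relation to an equivalence class yields a class
(locale \<open>correspondence\<close>).\<close>

section \<open>Maps of quotients given by correspondences\<close>

lemma holomorphic_map_cong:
  fixes A :: "('m::finite, 'a) param set" and B :: "('k::finite, 'b) param set"
  assumes "\<And>p. p \<in> X \<Longrightarrow> f p = g p" and g: "holomorphic_map A X B Y g"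
  shows "holomorphic_map A X B Y f"
  unfolding holomorphic_map_def
proof (intro conjI ballI)
  have "g ` X \<subseteq> Y" using g unfolding holomorphic_map_def by (rule conjunct1)
  then show "f ` X \<subseteq> Y" using assms(1) by auto
  fix p assume "p \<in> X"
  then obtain D \<phi> E \<psi> w W F where *: "(D, \<phi>) \<in> A" "(E, \<psi>) \<in> B" "w \<in> D"
      "\<phi> w = p" "open W" "w \<in> W" "holomorphic_vec_on F W" and
    **: "\<forall>z\<in>D \<inter> W. \<phi> z \<in> X \<longrightarrow> F z \<in> E \<and> g (\<phi> z) = \<psi> (F z)"
    using bspec[OF conjunct2[OF g[unfolded holomorphic_map_def]] \<open>p \<in> X\<close>] by blast
  have ***: "\<forall>z\<in>D \<inter> W. \<phi> z \<in> X \<longrightarrow> F z \<in> E \<and> f (\<phi> z) = \<psi> (F z)"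
    using ** assms(1) by simp
  show "\<exists>(D, \<phi>)\<in>A. \<exists>(E, \<psi>)\<in>B. \<exists>w\<in>D. \<exists>W F. \<phi> w = p \<and> open W \<and> w \<in> W \<and>
      holomorphic_vec_on F W \<and> (\<forall>z\<in>D \<inter> W. \<phi> z \<in> X \<longrightarrow> F z \<in> E \<and> f (\<phi> z) = \<psi> (F z))"
    apply (rule bexI[OF _ *(1)], simp only: prod.case)
    apply (rule bexI[OF _ *(2)], simp only: prod.case)
    apply (rule bexI[OF _ *(3)])
    apply (intro exI[of _ W] exI[of _ F])
    using *(4-7) *** by blast
qed

text \<open>The hypotheses \<open>left\<close> and \<open>right\<close> say that the representatives related to a fixed one form a single class.
They imply that \<open>R\<close> and \<open>S\<close> behave as equivalence relations wherever \<open>C\<close> is defined, and that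
\<open>C\<close> maps classes bijectively to classes. The predicates \<open>P\<close> and \<open>Q\<close> stand for the equations
of the two subvarieties.\<close>

locale correspondence =
  fixes R :: "('r \<times> 'r) set" and S :: "('t \<times> 't) set"
    and C :: "('r \<times> 't) set" and P :: "'r \<Rightarrow> bool" and Q :: "'t \<Rightarrow> bool"
    and X :: "'r set set" and Y :: "'t set set"
  assumes left: "(r, t) \<in> C \<Longrightarrow> (r', t) \<in> C \<longleftrightarrow> (r, r') \<in> R"
    and right: "(r, t) \<in> C \<Longrightarrow> (r, t') \<in> C \<longleftrightarrow> (t, t') \<in> S"
    and X_eq: "X = {R `` {r} | r. r \<in> Domain C \<and> P r}"
    and Y_eq: "Y = {S `` {t} | t. t \<in> Range C \<and> Q t}"
    and PQ: "(r, t) \<in> C \<Longrightarrow> P r \<longleftrightarrow> Q t"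
begin

lemma flip: "correspondence S R (C\<inverse>) Q P Y X"
proof
  show "Y = {S `` {t} | t. t \<in> Domain (C\<inverse>) \<and> Q t}" "X = {R `` {r} | r. r \<in> Range (C\<inverse>) \<and> P r}"
    unfolding X_eq Y_eq by simp_all
  show "(t, r) \<in> C\<inverse> \<Longrightarrow> (t', r) \<in> C\<inverse> \<longleftrightarrow> (t, t') \<in> S" for t r t' using right[of r t t'] by simp
  show "(t, r) \<in> C\<inverse> \<Longrightarrow> (t, r') \<in> C\<inverse> \<longleftrightarrow> (r, r') \<in> R" for t r r' using left[of r t r'] by simp
  show "(t, r) \<in> C\<inverse> \<Longrightarrow> Q t \<longleftrightarrow> P r" for t r using PQ[of r t] by simp
qed

lemma image_class:
  assumes "(r, t) \<in> C" shows "C `` (R `` {r}) = S `` {t}"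
proof -
  have "R `` {r} = {r'. (r', t) \<in> C}" using left[OF assms] by auto
  moreover have "(r', t') \<in> C \<longleftrightarrow> (t, t') \<in> S" if "(r', t) \<in> C" for r' t'
    using right[OF that] .
  ultimately show ?thesis using assms by auto
qed

lemma image_image_class: "(r, t) \<in> C \<Longrightarrow> C\<inverse> `` (C `` (R `` {r})) = R `` {r}"
  using image_class[of r t] correspondence.image_class[OF flip, of t r] by simp

lemma image_in:
  assumes "p \<in> X" shows "C `` p \<in> Y"
proof -
  obtain r t where rt: "(r, t) \<in> C" "P r" "p = R `` {r}" using assms unfolding X_eq by blast
  have "C `` p = S `` {t}" unfolding rt(3) by (rule image_class[OF rt(1)])
  moreover have "Q t" using PQ[OF rt(1)] rt(2) by simp
  ultimately show ?thesis unfolding Y_eq using rt(1) by blast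
qed

lemma image_image:
  assumes "p \<in> X" shows "C\<inverse> `` (C `` p) = p"
proof -
  obtain r t where rt: "(r, t) \<in> C" "p = R `` {r}" using assms unfolding X_eq by blast
  show ?thesis unfolding rt(2) by (rule image_image_class[OF rt(1)])
qed

lemma bij: "bij_betw (\<lambda>p. C `` p) X Y"
proof (rule bij_betw_byWitness[where f' = "\<lambda>q. C\<inverse> `` q"])
  show "\<forall>p\<in>X. C\<inverse> `` (C `` p) = p" using image_image by blast
  show "\<forall>q\<in>Y. C `` (C\<inverse> `` q) = q" using correspondence.image_image[OF flip] by simp
  show "(\<lambda>p. C `` p) ` X \<subseteq> Y" using image_in by (rule image_subsetI)
  show "(\<lambda>q. C\<inverse> `` q) ` Y \<subseteq> X" using correspondence.image_in[OF flip] by (rule image_subsetI)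
qed

lemma inv: "q \<in> Y \<Longrightarrow> inv_into X (\<lambda>p. C `` p) q = C\<inverse> `` q"
  using inv_into_f_eq[OF bij_betw_imp_inj_on[OF bij], of "C\<inverse> `` q" q]
    correspondence.image_in[OF flip, of q] correspondence.image_image[OF flip, of q] by simp

text \<open>The real structures of the quotients are defined as images of classes; this identifies such an image with the class
of the image of a representative.\<close>

lemma image_class_equivariant:
  assumes surj: "surj \<rho>" and C: "\<And>r t. (\<rho> r, \<tau> t) \<in> C \<longleftrightarrow> (r, t) \<in> C" and "(r, t) \<in> C"
  shows "\<rho> ` (R `` {r}) = R `` {\<rho> r}"
proof -
  have "\<rho> r' \<in> R `` {\<rho> r} \<longleftrightarrow> r' \<in> R `` {r}" for r'
    using left[of "\<rho> r" "\<tau> t" "\<rho> r'"] left[of r t r'] C assms(3) by simp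
  then have "R `` {r} = \<rho> -` (R `` {\<rho> r})" by blast
  then show ?thesis using surj_image_vimage_eq[OF surj] by metis
qed

lemma equivariant:
  assumes "surj \<rho>" "surj \<tau>" and C: "\<And>r t. (\<rho> r, \<tau> t) \<in> C \<longleftrightarrow> (r, t) \<in> C" and "p \<in> X"
  shows "C `` (\<rho> ` p) = \<tau> ` (C `` p)"
proof -
  obtain r t where rt: "(r, t) \<in> C" "p = R `` {r}" using \<open>p \<in> X\<close> unfolding X_eq by blast
  have "\<rho> ` p = R `` {\<rho> r}"
    unfolding rt(2) by (rule image_class_equivariant[OF assms(1) C rt(1)])
  moreover have "\<tau> ` (S `` {t}) = S `` {\<tau> t}"
    by (rule correspondence.image_class_equivariant[OF flip assms(2), where \<tau> = \<rho> and t = r])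
      (use C rt(1) in auto)
  ultimately show ?thesis
    using image_class[of "\<rho> r" "\<tau> t"] image_class[OF rt(1)] rt C by simp
qed

text \<open>Holomorphy in charts has to be checked on representatives only: it is enough that \<open>F\<close> carries the chart
representative of a point to a representative of its image.\<close>

lemma holomorphic:
  assumes "\<And>r t. (r, t) \<in> C \<Longrightarrow> P r \<Longrightarrow> \<exists>(D, \<phi>)\<in>AX. \<exists>(E, \<psi>)\<in>AY. \<exists>w\<in>D. \<exists>W F.
      \<phi> w = R `` {r} \<and> open W \<and> w \<in> W \<and> holomorphic_vec_on F W \<and>
      (\<forall>z\<in>D \<inter> W. \<phi> z \<in> X \<longrightarrow> F z \<in> E \<and> (\<exists>r t. (r, t) \<in> C \<and> \<phi> z = R `` {r} \<and> \<psi> (F z) = S `` {t}))"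
  shows "holomorphic_map AX X AY Y (\<lambda>p. C `` p)"
  unfolding holomorphic_map_def
proof (intro conjI ballI)
  show "(\<lambda>p. C `` p) ` X \<subseteq> Y" using image_in by auto
  fix p assume "p \<in> X"
  then obtain r t where rt: "(r, t) \<in> C" "P r" "p = R `` {r}" unfolding X_eq by blast
  obtain D \<phi> E \<psi> w W F where *: "(D, \<phi>) \<in> AX" "(E, \<psi>) \<in> AY" "w \<in> D"
      "\<phi> w = R `` {r}" "open W" "w \<in> W" "holomorphic_vec_on F W" and
    **: "\<And>z. z \<in> D \<inter> W \<Longrightarrow> \<phi> z \<in> X \<Longrightarrow>
      F z \<in> E \<and> (\<exists>r t. (r, t) \<in> C \<and> \<phi> z = R `` {r} \<and> \<psi> (F z) = S `` {t})"
    using assms[OF rt(1,2)] by blast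
  have ***: "F z \<in> E \<and> C `` \<phi> z = \<psi> (F z)" if "z \<in> D \<inter> W" "\<phi> z \<in> X" for z
    using **[OF that] image_class by metis
  show "\<exists>(D, \<phi>)\<in>AX. \<exists>(E, \<psi>)\<in>AY. \<exists>w\<in>D. \<exists>W F. \<phi> w = p \<and> open W \<and> w \<in> W \<and>
      holomorphic_vec_on F W \<and> (\<forall>z\<in>D \<inter> W. \<phi> z \<in> X \<longrightarrow> F z \<in> E \<and> C `` \<phi> z = \<psi> (F z))"
    apply (rule bexI[OF _ *(1)], simp only: prod.case)
    apply (rule bexI[OF _ *(2)], simp only: prod.case)
    apply (rule bexI[OF _ *(3)])
    apply (intro exI[of _ W] exI[of _ F])
    using *(4-7) rt(3) *** by simp
qed

lemma biholomorphic:
  assumes "holomorphic_map AX X AY Y (\<lambda>p. C `` p)" "holomorphic_map AY Y AX X (\<lambda>q. C\<inverse> `` q)"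
  shows "biholomorphic_map AX X AY Y (\<lambda>p. C `` p)"
proof -
  have "holomorphic_map AY Y AX X (inv_into X (\<lambda>p. C `` p))"
    by (rule holomorphic_map_cong[OF _ assms(2)]) (simp add: inv)
  then show ?thesis unfolding biholomorphic_map_def using bij assms(1) by blast
qed

end

section \<open>Holomorphic functions of several variables\<close>

text \<open>A complex-linear functional is a single Jacobian row \<open>J\<close>; scalar functions are easier to
combine than vector-valued ones.\<close>

definition holo_at :: "(complex^'m \<Rightarrow> complex) \<Rightarrow> complex^'m \<Rightarrow> bool" where
  "holo_at f w \<longleftrightarrow> (\<exists>J :: complex^'m. (f has_derivative (\<lambda>v. \<Sum>i\<in>UNIV. J$i * v$i)) (at w))"

named_theorems holo

lemma holo_at_const [holo]: "holo_at (\<lambda>w. c) w"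
  unfolding holo_at_def by (rule exI[of _ 0]) simp

lemma holo_at_coord [holo]: "holo_at (\<lambda>w. w $ i) w"
proof -
  have "((\<lambda>w. w $ i) has_derivative (\<lambda>v. v $ i)) (at w)"
    by (rule bounded_linear_imp_has_derivative[OF bounded_linear_vec_nth])
  moreover have "(\<Sum>k\<in>UNIV. axis i 1 $ k * v $ k) = v $ i" for v :: "complex^'a"
    by (simp add: axis_def if_distrib[of "\<lambda>x. x * _"] sum.delta cong: if_cong)
  ultimately show ?thesis unfolding holo_at_def by (intro exI[of _ "axis i 1"]) simp
qed

lemma holo_at_add [holo]:
  assumes "holo_at f w" "holo_at g w" shows "holo_at (\<lambda>w. f w + g w) w"
proof -
  obtain J K where "(f has_derivative (\<lambda>v. \<Sum>i\<in>UNIV. J$i * v$i)) (at w)"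
    "(g has_derivative (\<lambda>v. \<Sum>i\<in>UNIV. K$i * v$i)) (at w)"
    using assms unfolding holo_at_def by blast
  from has_derivative_add[OF this] show ?thesis unfolding holo_at_def
    by (intro exI[of _ "J + K"]) (simp add: distrib_right sum.distrib)
qed

lemma holo_at_mult [holo]:
  assumes "holo_at f w" "holo_at g w" shows "holo_at (\<lambda>w. f w * g w) w"
proof -
  obtain J K where "(f has_derivative (\<lambda>v. \<Sum>i\<in>UNIV. J$i * v$i)) (at w)"
    "(g has_derivative (\<lambda>v. \<Sum>i\<in>UNIV. K$i * v$i)) (at w)"
    using assms unfolding holo_at_def by blast
  from has_derivative_mult[OF this] show ?thesis unfolding holo_at_def
    by (intro exI[of _ "\<chi> i. f w * K$i + J$i * g w"])
      (simp add: sum_distrib_left sum_distrib_right sum.distrib algebra_simps)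
qed

lemma holo_at_inverse:
  assumes "holo_at f w" "f w \<noteq> 0" shows "holo_at (\<lambda>w. inverse (f w)) w"
proof -
  obtain J where "(f has_derivative (\<lambda>v. \<Sum>i\<in>UNIV. J$i * v$i)) (at w)"
    using assms unfolding holo_at_def by blast
  from Deriv.has_derivative_inverse[OF assms(2) this] show ?thesis unfolding holo_at_def
    by (intro exI[of _ "\<chi> i. - (inverse (f w) * J$i * inverse (f w))"])
      (simp add: sum_distrib_left sum_distrib_right sum_negf algebra_simps)
qed

lemma holo_at_uminus [holo]: "holo_at f w \<Longrightarrow> holo_at (\<lambda>w. - f w) w"
  using holo_at_mult[OF holo_at_const[of "-1"]] by simp

lemma holo_at_diff [holo]: "holo_at f w \<Longrightarrow> holo_at g w \<Longrightarrow> holo_at (\<lambda>w. f w - g w) w"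
  using holo_at_add[OF _ holo_at_uminus] by simp

lemma holo_at_divide [holo]:
  "holo_at f w \<Longrightarrow> holo_at g w \<Longrightarrow> g w \<noteq> 0 \<Longrightarrow> holo_at (\<lambda>w. f w / g w) w"
  using holo_at_mult[OF _ holo_at_inverse] by (simp add: divide_inverse)

lemma holo_at_power [holo]: "holo_at f w \<Longrightarrow> holo_at (\<lambda>w. f w ^ k) w"
  by (induction k) (auto intro: holo)

lemma holo_at_isCont: "holo_at f w \<Longrightarrow> isCont f w"
  unfolding holo_at_def by (auto intro: has_derivative_continuous)

lemma open_holo_at_nonzero: "(\<And>w. holo_at f w) \<Longrightarrow> open {w. f w \<noteq> 0}"
  by (intro open_Collect_neq continuous_at_imp_continuous_on ballI holo_at_isCont) (auto intro: holo_at_const)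

lemma holomorphic_vec_onI:
  fixes F :: "complex^'m \<Rightarrow> complex^'k"
  assumes "\<And>w k. w \<in> W \<Longrightarrow> holo_at (\<lambda>w. F w $ k) w"
  shows "holomorphic_vec_on F W"
  unfolding holomorphic_vec_on_def
proof
  fix w assume "w \<in> W"
  then have "\<forall>k. \<exists>J :: complex^'m. ((\<lambda>w. F w $ k) has_derivative (\<lambda>v. \<Sum>i\<in>UNIV. J$i * v$i)) (at w)"
    using assms unfolding holo_at_def by blast
  then obtain J :: "'k \<Rightarrow> complex^'m" where
    J: "\<And>k. ((\<lambda>w. F w $ k) has_derivative (\<lambda>v. \<Sum>i\<in>UNIV. J k $ i * v $ i)) (at w)" by metis
  have lin: "bounded_linear (axis k :: complex \<Rightarrow> complex^'k)" for k
    by (rule linear_conv_bounded_linear[THEN iffD1])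
      (auto intro!: linearI simp: axis_def vec_eq_iff)
  have "((\<lambda>w. \<Sum>k\<in>UNIV. axis k (F w $ k)) has_derivative
      (\<lambda>v. \<Sum>k\<in>UNIV. axis k (\<Sum>i\<in>UNIV. J k $ i * v $ i))) (at w)"
    by (intro has_derivative_sum bounded_linear.has_derivative[OF lin] J)
  moreover have "(\<Sum>k\<in>UNIV. axis k (x $ k)) = x" for x :: "complex^'k"
    by (simp add: vec_eq_iff axis_def sum.delta)
  moreover have "(\<Sum>k\<in>UNIV. axis k (\<Sum>i\<in>UNIV. J k $ i * v $ i)) = (\<chi> k. J k) *v v" for v
    by (simp add: vec_eq_iff axis_def sum.delta matrix_vector_mult_def)
  ultimately show "\<exists>J :: complex^'m^'k. (F has_derivative (\<lambda>v. J *v v)) (at w)" by auto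
qed

lemma holo_at_if [holo]:
  "holo_at f w \<Longrightarrow> holo_at g w \<Longrightarrow> holo_at (\<lambda>w. if B then f w else g w) w"
  by (cases B) simp_all

definition vec6 :: "complex \<Rightarrow> complex \<Rightarrow> complex \<Rightarrow> complex \<Rightarrow> complex \<Rightarrow> complex \<Rightarrow> complex^6" where
  "vec6 a b c d e f = (\<chi> i. if i = 1 then a else if i = 2 then b else if i = 3 then c
     else if i = 4 then d else if i = 5 then e else f)"

lemma vec6_nth [simp]:
  "vec6 a b c d e f $ 1 = a" "vec6 a b c d e f $ 2 = b" "vec6 a b c d e f $ 3 = c"
  "vec6 a b c d e f $ 4 = d" "vec6 a b c d e f $ 5 = e" "vec6 a b c d e f $ 6 = f"
  by (simp_all add: vec6_def)

lemma holo_at_vec6: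
  assumes "holo_at a w" "holo_at b w" "holo_at c w" "holo_at d w" "holo_at e w" "holo_at f w"
  shows "holo_at (\<lambda>w. vec6 (a w) (b w) (c w) (d w) (e w) (f w) $ k) w"
  unfolding vec6_def vec_lambda_beta by (intro holo_at_if assms)

definition vec4 :: "complex \<Rightarrow> complex \<Rightarrow> complex \<Rightarrow> complex \<Rightarrow> complex^4" where
  "vec4 a b c d = (\<chi> i. if i = 1 then a else if i = 2 then b else if i = 3 then c else d)"

lemma vec4_nth [simp]:
  "vec4 a b c d $ 1 = a" "vec4 a b c d $ 2 = b" "vec4 a b c d $ 3 = c" "vec4 a b c d $ 4 = d"
  by (simp_all add: vec4_def)

lemma holo_at_vec4:
  assumes "holo_at a w" "holo_at b w" "holo_at c w" "holo_at d w"
  shows "holo_at (\<lambda>w. vec4 (a w) (b w) (c w) (d w) $ k) w"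
  unfolding vec4_def vec_lambda_beta by (intro holo_at_if assms)

section \<open>Homogeneous coordinates on the punctured quadrics\<close>

lemma scale2_1 [simp]: "scale2 1 u = u"
  by (cases u) simp

lemma scale2_scale2 [simp]: "scale2 a (scale2 b u) = scale2 (a * b) u"
  by (cases u) (simp add: mult.assoc)

lemma scale2_eq_0: "l \<noteq> 0 \<Longrightarrow> scale2 l u = (0, 0) \<longleftrightarrow> u = (0, 0)"
  by (cases u) simp

lemma scale4_1 [simp]: "scale4 1 x = x"
  by (cases x) simp

lemma scale4_scale4 [simp]: "scale4 a (scale4 b x) = scale4 (a * b) x"
  by (cases x) (simp add: mult.assoc)

lemma cnj2_cnj2 [simp]: "cnj2 (cnj2 u) = u"
  by (cases u) simp

lemma cnj2_eq_0 [simp]: "cnj2 u = (0, 0) \<longleftrightarrow> u = (0, 0)"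
  by (cases u) simp

text \<open>Trivialisations are indexed by truth values, so homogeneous coordinates are addressed in the same way:
\<open>True\<close> selects the first coordinate.\<close>

definition sel :: "bool \<Rightarrow> hom2 \<Rightarrow> complex" where
  "sel a u = (if a then fst u else snd u)"

lemma sel_simps [simp]: "sel True (u0, u1) = u0" "sel False (u0, u1) = u1"
  by (simp_all add: sel_def)

lemma sel_scale2 [simp]: "sel a (scale2 l u) = l * sel a u"
  by (cases u) (simp add: sel_def)

lemma sel_cnj2 [simp]: "sel a (cnj2 u) = cnj (sel a u)"
  by (cases u) (simp add: sel_def)

lemma nonzero_sel: "u \<noteq> (0, 0) \<longleftrightarrow> (\<exists>a. sel a u \<noteq> 0)"
  by (cases u) (auto simp: sel_def)

lemma hom2_eqI: "(\<And>a. sel a u = sel a v) \<Longrightarrow> u = v"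
  by (metis (full_types) prod.collapse sel_def)

lemma sel_affine2 [simp]: "sel i (affine2 i t) = 1" "sel (\<not> i) (affine2 i t) = t"
  by (simp_all add: sel_def affine2_def)

text \<open>The rank-one factorisation of the matrix of the forms \<open>lin_unit\<close>. The factor \<open>c\<close> leaves \<open>x\<close>, \<open>u\<close> and \<open>v\<close> free to be
rescaled independently. The definition applies to all \<open>s\<close>, including \<open>0\<close>.\<close>

definition quad_coords :: "hom4 \<Rightarrow> complex \<Rightarrow> complex \<Rightarrow> hom2 \<Rightarrow> hom2 \<Rightarrow> bool" where
  "quad_coords x s c u v \<longleftrightarrow> c \<noteq> 0 \<and> u \<noteq> (0, 0) \<and> v \<noteq> (0, 0) \<and>
     (\<forall>a b. sel a u * sel b v = c * lin_unit a b x s)"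

lemma quad_coordsD:
  assumes "quad_coords x s c u v"
  shows "sel a u * sel b v = c * lin_unit a b x s" "c \<noteq> 0" "u \<noteq> (0, 0)" "v \<noteq> (0, 0)"
  using assms unfolding quad_coords_def by auto

lemma quad_coords_expand:
  "quad_coords (x0, x1, x2, x3) s c (u0, u1) (v0, v1) \<longleftrightarrow>
     c \<noteq> 0 \<and> (u0, u1) \<noteq> (0, 0) \<and> (v0, v1) \<noteq> (0, 0) \<and>
     u0 * v0 = c * (s * x0 + x1) \<and> u0 * v1 = c * x2 \<and>
     u1 * v0 = c * x3 \<and> u1 * v1 = c * (s * x0 - x1)"
  unfolding quad_coords_def all_bool_eq by (simp del: Pair_inject prod.inject) 

lemma lin_unit_scale4 [simp]: "lin_unit a b (scale4 l x) s = l * lin_unit a b x s"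
  by (cases x) (simp add: algebra_simps)

lemma quad_coords_scale4:
  "quad_coords x s c u v \<Longrightarrow> l \<noteq> 0 \<Longrightarrow> quad_coords (scale4 l x) s (c / l) u v"
  unfolding quad_coords_def by simp

lemma quad_coords_scale2:
  "quad_coords x s c u v \<Longrightarrow> l \<noteq> 0 \<Longrightarrow> m \<noteq> 0 \<Longrightarrow> quad_coords x s (l * m * c) (scale2 l u) (scale2 m v)"
  unfolding quad_coords_def by (simp add: scale2_eq_0)

text \<open>A nonzero matrix of rank one determines its column and its row up to scalars: the factors of proportionality are read off
at an entry that does not vanish.\<close>

lemma quad_coords_same_uv:
  assumes q: "quad_coords x s c u v"
  shows "(\<exists>c'. quad_coords x s c' u' v') \<longleftrightarrow>
    (\<exists>l m. l \<noteq> 0 \<and> m \<noteq> 0 \<and> u' = scale2 l u \<and> v' = scale2 m v)"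
proof
  assume "\<exists>c'. quad_coords x s c' u' v'"
  then obtain c' where q': "quad_coords x s c' u' v'" by blast
  have eq: "c' * (sel a u * sel b v) = c * (sel a u' * sel b v')" for a b
    using quad_coordsD(1)[OF q] quad_coordsD(1)[OF q'] by simp
  obtain i j where ij: "sel i u \<noteq> 0" "sel j v \<noteq> 0"
    using quad_coordsD(3,4)[OF q] unfolding nonzero_sel by blast
  then have ij': "sel i u' \<noteq> 0" "sel j v' \<noteq> 0"
    using eq[of i j] quad_coordsD(2)[OF q] quad_coordsD(2)[OF q'] by auto
  have "u' = scale2 (c' * sel j v / (c * sel j v')) u"
    using eq[of _ j] ij' quad_coordsD(2)[OF q] by (intro hom2_eqI) (simp add: field_simps)
  moreover have "v' = scale2 (c' * sel i u / (c * sel i u')) v"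
    using eq[of i] ij' quad_coordsD(2)[OF q] by (intro hom2_eqI) (simp add: field_simps)
  ultimately show "\<exists>l m. l \<noteq> 0 \<and> m \<noteq> 0 \<and> u' = scale2 l u \<and> v' = scale2 m v"
    using ij ij' quad_coordsD(2)[OF q] quad_coordsD(2)[OF q']
    by (intro exI[of _ "c' * sel j v / (c * sel j v')"] exI[of _ "c' * sel i u / (c * sel i u')"]) simp
qed (use quad_coords_scale2[OF q] in blast)

lemma D1_dom_iff: "D1_dom a x s \<longleftrightarrow> lin_unit a True x s \<noteq> 0 \<or> lin_unit a False x s \<noteq> 0"
  by (cases x; cases a) auto

lemma D2_dom_iff: "D2_dom b x s \<longleftrightarrow> lin_unit True b x s \<noteq> 0 \<or> lin_unit False b x s \<noteq> 0"
  by (cases x; cases b) auto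

lemma quad_coords_lin_unit:
  assumes "quad_coords x s c u v"
  shows "lin_unit a b x s = sel a u * sel b v / c"
  using quad_coordsD[OF assms] by (simp add: field_simps)

lemma D_dom_coords:
  assumes "quad_coords x s c u v"
  shows "D1_dom a x s \<longleftrightarrow> sel a u \<noteq> 0" "D2_dom b x s \<longleftrightarrow> sel b v \<noteq> 0"
  unfolding D1_dom_iff D2_dom_iff quad_coords_lin_unit[OF assms]
  using quad_coordsD(2-4)[OF assms] unfolding nonzero_sel by (auto, (metis (full_types))+)

text \<open>Both expressions for the local equation of \<open>D1\<close>, \<open>(s x0 - x1) / x2\<close> and \<open>x3 / (s x0 + x1)\<close>, reduce to
\<open>u1 / u0\<close>.\<close>

lemma D1_trans_coords:
  assumes q: "quad_coords x s c u v" and "sel i u \<noteq> 0" "sel i' u \<noteq> 0"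
  shows "D1_trans i' i x s = sel i u / sel i' u"
proof (cases "i = i'")
  case True then show ?thesis using assms by (simp add: D1_trans_def)
next
  case False
  obtain x0 x1 x2 x3 where x: "x = (x0, x1, x2, x3)" by (cases x)
  obtain u0 u1 where u: "u = (u0, u1)" by (cases u)
  obtain v0 v1 where v: "v = (v0, v1)" by (cases v)
  have u01: "u0 \<noteq> 0" "u1 \<noteq> 0" using assms(2,3) False unfolding u by (auto simp: sel_def split: if_splits)
  have *: "c \<noteq> 0" "v0 \<noteq> 0 \<or> v1 \<noteq> 0" "s * x0 + x1 = u0 * v0 / c" "x2 = u0 * v1 / c"
    "x3 = u1 * v0 / c" "s * x0 - x1 = u1 * v1 / c"
    using q unfolding x u v quad_coords_expand by auto
  have "D1_eq True x s = u1 / u0"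
    using *(1,2) u01 unfolding x D1_eq.simps *(3-6) by (auto simp: field_simps)
  moreover have "D1_eq False x s = 1" unfolding x by simp
  ultimately show ?thesis using False unfolding D1_trans_def u by (cases i; cases i'; simp)
qed

lemma D2_trans_coords:
  assumes q: "quad_coords x s c u v" and "sel j v \<noteq> 0" "sel j' v \<noteq> 0"
  shows "D2_trans j' j x s = sel j v / sel j' v"
proof (cases "j = j'")
  case True then show ?thesis using assms by (simp add: D2_trans_def)
next
  case False
  obtain x0 x1 x2 x3 where x: "x = (x0, x1, x2, x3)" by (cases x)
  obtain u0 u1 where u: "u = (u0, u1)" by (cases u)
  obtain v0 v1 where v: "v = (v0, v1)" by (cases v)
  have v01: "v0 \<noteq> 0" "v1 \<noteq> 0" using assms(2,3) False unfolding v by (auto simp: sel_def split: if_splits)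
  have *: "c \<noteq> 0" "u0 \<noteq> 0 \<or> u1 \<noteq> 0" "s * x0 + x1 = u0 * v0 / c" "x2 = u0 * v1 / c"
    "x3 = u1 * v0 / c" "s * x0 - x1 = u1 * v1 / c"
    using q unfolding x u v quad_coords_expand by auto
  have "D2_eq True x s = v1 / v0"
    using *(1,2) v01 unfolding x D2_eq.simps *(3-6) by (auto simp: field_simps)
  moreover have "D2_eq False x s = 1" unfolding x by simp
  ultimately show ?thesis using False unfolding D2_trans_def v by (cases j; cases j'; simp)
qed

text \<open>Conversely a matrix of rank one satisfies the equation of the quadric, and at the vertex the matrix would be zero.\<close>

lemma quad_coords_imp_quad0_reps:
  assumes q: "quad_coords x s c u v"
  shows "(x, s) \<in> quad0_reps"
proof -
  obtain x0 x1 x2 x3 where x: "x = (x0, x1, x2, x3)" by (cases x)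
  obtain u0 u1 where u: "u = (u0, u1)" by (cases u)
  obtain v0 v1 where v: "v = (v0, v1)" by (cases v)
  have c: "c \<noteq> 0" using quad_coordsD(2)[OF q] .
  have *: "u0 \<noteq> 0 \<or> u1 \<noteq> 0" "v0 \<noteq> 0 \<or> v1 \<noteq> 0"
    "c * (s * x0 + x1) = u0 * v0" "c * x2 = u0 * v1" "c * x3 = u1 * v0" "c * (s * x0 - x1) = u1 * v1"
    using q unfolding x u v quad_coords_expand by auto
  have nz: "\<not> (s * x0 + x1 = 0 \<and> x2 = 0 \<and> x3 = 0 \<and> s * x0 - x1 = 0)"
    using *(1,2) *(3-6)[symmetric] by auto
  have "c\<^sup>2 * quadric_form x s = (c * (s * x0 + x1)) * (c * (s * x0 - x1)) - (c * x2) * (c * x3)"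
    unfolding x by (simp add: power2_eq_square algebra_simps)
  also have "\<dots> = 0" unfolding *(3-6) by simp
  finally have "quadric_form x s = 0" using c by simp
  then have reps: "(x, s) \<in> quad_reps" using nz unfolding quad_reps_def x by auto
  then have "(x, s) \<in> quad_rel `` {(x, s)}"
    unfolding quad_rel_def x by (auto intro!: exI[of _ 1])
  moreover have "(x, s) \<notin> vertex" using nz unfolding vertex_def quad_rel_def x by auto
  ultimately show ?thesis using reps unfolding quad0_reps_def by auto
qed

lemma LB_reps_coords:
  assumes "quad_coords x s c u v"
  shows "(x, s, i, j, \<xi>, \<eta>) \<in> LB_reps \<longleftrightarrow> sel i u \<noteq> 0 \<and> sel j v \<noteq> 0"
  unfolding LB_reps_def using quad_coords_imp_quad0_reps[OF assms] D_dom_coords[OF assms] by simp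

lemma LB_reps_quad_reps: "(x, s, i, j, \<xi>, \<eta>) \<in> LB_reps \<Longrightarrow> (x, s) \<in> quad_reps"
  unfolding LB_reps_def quad0_reps_def by simp

lemma LB_reps_lin_unit: "(x, s, i, j, \<xi>, \<eta>) \<in> LB_reps \<Longrightarrow> lin_unit i j x s \<noteq> 0"
  using lin_unit_nonzero[of x s i j] LB_reps_quad_reps[of x s i j \<xi> \<eta>] unfolding LB_reps_def
  by (simp del: lin_unit.simps D1_dom.simps D2_dom.simps)

lemma lin_unit_rank_one:
  assumes "(x, s) \<in> quad_reps"
  shows "lin_unit a j x s * lin_unit i b x s = lin_unit i j x s * lin_unit a b x s"
proof -
  obtain x0 x1 x2 x3 where x: "x = (x0, x1, x2, x3)" by (cases x)
  show ?thesis using quadric_form_factor[OF assms x] unfolding x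
    by (cases a; cases j; cases i; cases b; simp add: algebra_simps)
qed

text \<open>A nonzero entry \<open>(i, j)\<close> of a singular matrix exhibits a factorisation: its \<open>j\<close>-th column times its \<open>i\<close>-th row.
This gives coordinates that are polynomial in \<open>x\<close> and \<open>s\<close>.\<close>

definition unit_col :: "hom4 \<Rightarrow> complex \<Rightarrow> bool \<Rightarrow> hom2" where
  "unit_col x s j = (lin_unit True j x s, lin_unit False j x s)"

definition unit_row :: "hom4 \<Rightarrow> complex \<Rightarrow> bool \<Rightarrow> hom2" where
  "unit_row x s i = (lin_unit i True x s, lin_unit i False x s)"

lemma sel_unit_col_row [simp]: "sel a (unit_col x s j) = lin_unit a j x s" "sel b (unit_row x s i) = lin_unit i b x s"
  by (simp_all add: sel_def unit_col_def unit_row_def)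

lemma quad_coords_unit_col_row:
  assumes "(x, s, i, j, \<xi>, \<eta>) \<in> LB_reps"
  shows "quad_coords x s (lin_unit i j x s) (unit_col x s j) (unit_row x s i)"
  unfolding quad_coords_def nonzero_sel
  using LB_reps_lin_unit[OF assms] lin_unit_rank_one[OF LB_reps_quad_reps[OF assms]] by auto

text \<open>The gluing of \<open>L1 \<oplus> L2\<close> in homogeneous coordinates: the numbers \<open>\<xi> u\<^sub>i\<^sup>n\<^sup>-\<^sup>1 v\<^sub>j\<close> and
\<open>\<eta> u\<^sub>i v\<^sub>j\<^sup>n\<^sup>-\<^sup>1\<close> do not change when the trivialisation does. All later statements about equivalent
representatives go back to this one.\<close>

lemma LB_rel_coords:
  assumes q: "quad_coords x s c u v"
    and r: "(x, s, i, j, \<xi>, \<eta>) \<in> LB_reps" and r': "(x', s', i', j', \<xi>', \<eta>') \<in> LB_reps"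
  shows "((x, s, i, j, \<xi>, \<eta>), (x', s', i', j', \<xi>', \<eta>')) \<in> LB_rel n \<longleftrightarrow>
    s' = s \<and> (\<exists>l. l \<noteq> 0 \<and> x' = scale4 l x) \<and>
    \<xi>' * (sel i' u ^ (n - 1) * sel j' v) = \<xi> * (sel i u ^ (n - 1) * sel j v) \<and>
    \<eta>' * (sel i' u * sel j' v ^ (n - 1)) = \<eta> * (sel i u * sel j v ^ (n - 1))"
proof (cases "s' = s \<and> (\<exists>l. l \<noteq> 0 \<and> x' = scale4 l x)")
  case True
  then obtain l where l: "l \<noteq> 0" "x' = scale4 l x" and s: "s' = s" by blast
  have nz: "sel i u \<noteq> 0" "sel j v \<noteq> 0" using r LB_reps_coords[OF q] by auto
  have nz': "sel i' u \<noteq> 0" "sel j' v \<noteq> 0"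
    using r' LB_reps_coords[OF quad_coords_scale4[OF q l(1)]] unfolding l s by auto
  have rel: "((x, s), (x', s')) \<in> quad_rel"
    using True LB_reps_quad_reps[OF r] unfolding quad_rel_def by auto
  have "((x, s, i, j, \<xi>, \<eta>), (x', s', i', j', \<xi>', \<eta>')) \<in> LB_rel n \<longleftrightarrow>
     \<xi>' = (sel i u / sel i' u) ^ (n - 1) * (sel j v / sel j' v) * \<xi> \<and>
     \<eta>' = (sel i u / sel i' u) * (sel j v / sel j' v) ^ (n - 1) * \<eta>"
    unfolding LB_rel_def
    using r r' rel D1_trans_coords[OF q nz(1) nz'(1)] D2_trans_coords[OF q nz(2) nz'(2)] by simp
  then show ?thesis using True nz nz' by (simp add: field_simps power_divide)
next
  case False
  then show ?thesis unfolding LB_rel_def quad_rel_def by auto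
qed

lemma LB_rel_imp_reps: "(r, r') \<in> LB_rel n \<Longrightarrow> r \<in> LB_reps \<and> r' \<in> LB_reps"
  unfolding LB_rel_def by auto

lemma LB_rel_scale:
  assumes r: "(x, s, i, j, \<xi>, \<eta>) \<in> LB_reps" and l: "l \<noteq> 0"
  shows "(scale4 l x, s, i, j, \<xi>, \<eta>) \<in> LB_reps"
    "((x, s, i, j, \<xi>, \<eta>), (scale4 l x, s, i, j, \<xi>, \<eta>)) \<in> LB_rel n"
proof -
  note q = quad_coords_unit_col_row[OF r]
  show *: "(scale4 l x, s, i, j, \<xi>, \<eta>) \<in> LB_reps"
    unfolding LB_reps_coords[OF quad_coords_scale4[OF q l]] using r LB_reps_coords[OF q] by simp
  show "((x, s, i, j, \<xi>, \<eta>), (scale4 l x, s, i, j, \<xi>, \<eta>)) \<in> LB_rel n"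
    unfolding LB_rel_coords[OF q r *] using l by blast
qed

lemma LB_rel_refl: "r \<in> LB_reps \<Longrightarrow> (r, r) \<in> LB_rel n"
  using LB_rel_scale(2)[of _ _ _ _ _ _ 1] by (cases r) simp

text \<open>The equation of the family with the denominators \<open>lin_unit i j\<close> cleared.\<close>

definition Z_eq :: "nat \<Rightarrow> (nat \<Rightarrow> hom4 \<Rightarrow> complex) \<Rightarrow> lb_rep \<Rightarrow> bool" where
  "Z_eq n h = (\<lambda>(x, s, i, j, \<xi>, \<eta>). \<xi> * \<eta> * lin_unit i j x s ^ n = (\<Prod>m=1..n. h m x))"

text \<open>Multiplying the two invariants of \<open>LB_rel_coords\<close> gives \<open>\<xi> \<eta> (u\<^sub>i v\<^sub>j)\<^sup>n\<close>, which up to a constant is the left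
side of the equation.\<close>

lemma Z_eq_class:
  assumes n: "n \<ge> 1" and h: "\<And>m l x. h m (scale4 l x) = l * h m x" and rel: "(r, r') \<in> LB_rel n"
  shows "Z_eq n h r' \<longleftrightarrow> Z_eq n h r"
proof -
  obtain x s i j \<xi> \<eta> where r: "r = (x, s, i, j, \<xi>, \<eta>)" by (cases r)
  obtain x' s' i' j' \<xi>' \<eta>' where r': "r' = (x', s', i', j', \<xi>', \<eta>')" by (cases r')
  obtain N where N: "n = Suc N" using n by (cases n) auto
  have reps: "(x, s, i, j, \<xi>, \<eta>) \<in> LB_reps" "(x', s', i', j', \<xi>', \<eta>') \<in> LB_reps"
    using LB_rel_imp_reps[OF rel] r r' by auto
  define c u v where "c = lin_unit i j x s" and "u = unit_col x s j" and "v = unit_row x s i"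
  have q: "quad_coords x s c u v" unfolding c_def u_def v_def by (rule quad_coords_unit_col_row[OF reps(1)])
  obtain l where l: "l \<noteq> 0" "x' = scale4 l x" and s: "s' = s" and
    \<xi>: "\<xi>' * (sel i' u ^ N * sel j' v) = \<xi> * (sel i u ^ N * sel j v)" and
    \<eta>: "\<eta>' * (sel i' u * sel j' v ^ N) = \<eta> * (sel i u * sel j v ^ N)"
    using rel unfolding r r' LB_rel_coords[OF q reps] N by auto
  have "\<xi>' * \<eta>' * (c * lin_unit i' j' x s) ^ n =
      (\<xi>' * (sel i' u ^ N * sel j' v)) * (\<eta>' * (sel i' u * sel j' v ^ N))"
    unfolding quad_coordsD(1)[OF q, symmetric] N by (simp add: power_mult_distrib)
  also have "\<dots> = \<xi> * \<eta> * (c * lin_unit i j x s) ^ n"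
    unfolding \<xi> \<eta> quad_coordsD(1)[OF q, symmetric] N by (simp add: power_mult_distrib)
  finally have *: "\<xi>' * \<eta>' * lin_unit i' j' x s ^ n = \<xi> * \<eta> * lin_unit i j x s ^ n"
    using quad_coordsD(2)[OF q] by (simp add: power_mult_distrib mult.assoc)
  have "\<xi>' * \<eta>' * (l * lin_unit i' j' x s) ^ n = l ^ n * (\<xi>' * \<eta>' * lin_unit i' j' x s ^ n)"
    by (simp add: power_mult_distrib)
  then show ?thesis
    unfolding Z_eq_def r r' l s h lin_unit_scale4 prod.case prod.distrib * using l(1)
    by simp
qed

lemma Z_fibre_classes:
  assumes n: "n \<ge> 1" and h: "\<And>m l x. h m (scale4 l x) = l * h m x"
  shows "Z_fibre n h s = {LB_rel n `` {r} | r. r \<in> LB_reps \<and> fst (snd r) = s \<and> Z_eq n h r}"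
proof -
  have eq: "(\<forall>(x, s, i, j, \<xi>, \<eta>)\<in>LB_rel n `` {r}. \<xi> * \<eta> = (\<Prod>m=1..n. h m x / lin_unit i j x s)) \<longleftrightarrow>
      Z_eq n h r" if r: "r \<in> LB_reps" for r
  proof -
    have "(case r' of (x, s, i, j, \<xi>, \<eta>) \<Rightarrow> \<xi> * \<eta> = (\<Prod>m=1..n. h m x / lin_unit i j x s)) \<longleftrightarrow>
      Z_eq n h r" if "(r, r') \<in> LB_rel n" for r'
    proof -
      have "r' \<in> LB_reps" using LB_rel_imp_reps[OF that] by simp
      then have "(case r' of (x, s, i, j, \<xi>, \<eta>) \<Rightarrow> \<xi> * \<eta> = (\<Prod>m=1..n. h m x / lin_unit i j x s)) \<longleftrightarrow>
        Z_eq n h r'"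
        using LB_reps_lin_unit unfolding Z_eq_def
        by (cases r') (auto simp: prod_dividef field_simps)
      then show ?thesis using Z_eq_class[OF n _ that, of h] h by simp
    qed
    then show ?thesis using LB_rel_refl[OF r, of n] by blast
  qed
  have base: "quad_proj (LB_proj (LB_rel n `` {r})) = fst (snd r)" if r: "r \<in> LB_reps" for r
  proof -
    have "snd ` LB_proj (LB_rel n `` {r}) = {fst (snd r)}"
    proof
      show "snd ` LB_proj (LB_rel n `` {r}) \<subseteq> {fst (snd r)}"
        unfolding LB_proj_def LB_rel_def quad_rel_def by auto
      show "{fst (snd r)} \<subseteq> snd ` LB_proj (LB_rel n `` {r})"
        using LB_rel_refl[OF r, of n] unfolding LB_proj_def by (cases r) force
    qed
    then show ?thesis unfolding quad_proj_def by simp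
  qed
  have mem: "LB_rel n `` {r} \<in> Z_fibre n h s \<longleftrightarrow> fst (snd r) = s \<and> Z_eq n h r" if r: "r \<in> LB_reps" for r
  proof -
    have "LB_rel n `` {r} \<in> LB n" unfolding LB_def using r by (rule quotientI)
    then show ?thesis
      unfolding Z_fibre_def Z_fam_def mem_Collect_eq eq[OF r] base[OF r] by (simp only: simp_thms conj_commute)
  qed
  have "\<exists>r\<in>LB_reps. p = LB_rel n `` {r}" if "p \<in> Z_fibre n h s" for p
    using that unfolding Z_fibre_def Z_fam_def LB_def quotient_def by blast
  then show ?thesis using mem by blast
qed

section \<open>Charts and the real structure of the line bundles\<close>

fun coord :: "nat \<Rightarrow> hom4 \<Rightarrow> complex" where
  "coord k (x0, x1, x2, x3) = (if k = 0 then x0 else if k = 1 then x1 else if k = 2 then x2 else x3)"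

text \<open>Inverse of the parametrisation \<open>LB_param k\<close>: the three quotients by the \<open>k\<close>-th coordinate, in the
order in which \<open>affine4 k\<close> lists the remaining coordinates.\<close>

fun LB_chart :: "nat \<Rightarrow> hom4 \<Rightarrow> complex \<Rightarrow> complex \<Rightarrow> complex \<Rightarrow> complex^6" where
  "LB_chart k (x0, x1, x2, x3) s \<xi> \<eta> =
     (let t = coord k (x0, x1, x2, x3) in
      vec6 ((if k = 0 then x1 else x0) / t) ((if k = 0 \<or> k = 1 then x2 else x1) / t)
        ((if k = 3 then x2 else x3) / t) s \<xi> \<eta>)"

lemma LB_param_chart:
  assumes "coord k x \<noteq> 0" "k < 4"
  shows "LB_param k i j (LB_chart k x s \<xi> \<eta>) = (scale4 (1 / coord k x) x, s, i, j, \<xi>, \<eta>)"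
proof -
  obtain x0 x1 x2 x3 where x: "x = (x0, x1, x2, x3)" by (cases x)
  have "k = 0 \<or> k = 1 \<or> k = 2 \<or> k = 3" using assms(2) by auto
  then show ?thesis using assms(1) unfolding x LB_param_def by (elim disjE) (simp_all add: Let_def)
qed

lemma coord_nonzero: "x \<noteq> (0, 0, 0, 0) \<Longrightarrow> \<exists>k<4. coord k x \<noteq> 0"
proof -
  assume "x \<noteq> (0, 0, 0, 0)"
  then have "coord 0 x \<noteq> 0 \<or> coord 1 x \<noteq> 0 \<or> coord 2 x \<noteq> 0 \<or> coord 3 x \<noteq> 0" by (cases x) auto
  then show ?thesis by (elim disjE; intro exI conjI; assumption?) simp_all
qed

lemma LB_reps_nonzero: "(x, s, i, j, \<xi>, \<eta>) \<in> LB_reps \<Longrightarrow> x \<noteq> (0, 0, 0, 0)"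
  using LB_reps_quad_reps[of x s i j \<xi> \<eta>] unfolding quad_reps_def by auto

lemma Z_fibre_classD:
  assumes n: "n \<ge> 1" and h: "\<And>m l x. h m (scale4 l x) = l * h m x"
    and r: "r \<in> LB_reps" and mem: "LB_rel n `` {r} \<in> Z_fibre n h s"
  shows "fst (snd r) = s" "Z_eq n h r"
proof -
  obtain r' where r': "LB_rel n `` {r} = LB_rel n `` {r'}" "fst (snd r') = s" "Z_eq n h r'"
    using mem unfolding Z_fibre_classes[of n h, OF n h] by blast
  then have rel: "(r', r) \<in> LB_rel n" using LB_rel_refl[OF r, of n] by blast
  show "Z_eq n h r" using Z_eq_class[of n h, OF n h rel] r'(3) by simp
  show "fst (snd r) = s" using rel r'(2) unfolding LB_rel_def quad_rel_def by auto
qed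

lemma LB_chart_at:
  assumes r: "(x, s, i, j, \<xi>, \<eta>) \<in> LB_reps" and k: "k < 4" "coord k x \<noteq> 0"
  shows "LB_param k i j (LB_chart k x s \<xi> \<eta>) \<in> LB_reps"
    "((x, s, i, j, \<xi>, \<eta>), LB_param k i j (LB_chart k x s \<xi> \<eta>)) \<in> LB_rel n"
  unfolding LB_param_chart[OF k(2,1)] using LB_rel_scale[OF r, of "1 / coord k x"] k(2) by auto

text \<open>A family of representatives with holomorphic coordinates is a holomorphic map into \<open>L1 \<oplus> L2\<close>:
near a given point one divides by a coordinate of \<open>x\<close> that is nonzero there.\<close>

lemma holomorphic_into_LB:
  assumes holo: "\<And>w. holo_at x0 w" "\<And>w. holo_at x1 w" "\<And>w. holo_at x2 w" "\<And>w. holo_at x3 w"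
      "\<And>w. holo_at \<xi> w" "\<And>w. holo_at \<eta> w"
    and x_def: "x = (\<lambda>w. (x0 w, x1 w, x2 w, x3 w))" and nz: "x w \<noteq> (0, 0, 0, 0)"
  shows "\<exists>(E, \<psi>)\<in>LB_atlas n. \<exists>W F. open W \<and> w \<in> W \<and> holomorphic_vec_on F W \<and>
    (\<forall>z\<in>W. (x z, s, i, j, \<xi> z, \<eta> z) \<in> LB_reps \<longrightarrow>
       F z \<in> E \<and> (\<exists>r. ((x z, s, i, j, \<xi> z, \<eta> z), r) \<in> LB_rel n \<and> \<psi> (F z) = LB_rel n `` {r}))"
proof -
  obtain k where k: "k < 4" "coord k (x w) \<noteq> 0" using coord_nonzero[OF nz] by blast
  define F where "F = (\<lambda>z. LB_chart k (x z) s (\<xi> z) (\<eta> z))"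
  define W where "W = {z. coord k (x z) \<noteq> 0}"
  have coord: "holo_at (\<lambda>z. coord k (x z)) z" for z
    unfolding x_def coord.simps by (intro holo_at_if holo)
  have "open W" unfolding W_def by (rule open_holo_at_nonzero[OF coord])
  moreover have "holomorphic_vec_on F W"
  proof (rule holomorphic_vec_onI)
    fix z m assume "z \<in> W"
    then have nz: "coord k (x z) \<noteq> 0" unfolding W_def by simp
    have F: "F = (\<lambda>z. vec6 ((if k = 0 then x1 z else x0 z) / coord k (x z))
        ((if k = 0 \<or> k = 1 then x2 z else x1 z) / coord k (x z))
        ((if k = 3 then x2 z else x3 z) / coord k (x z)) s (\<xi> z) (\<eta> z))"
      unfolding F_def x_def by (simp add: Let_def)
    show "holo_at (\<lambda>z. F z $ m) z"
      unfolding F by (rule holo_at_vec6; (rule holo_at_divide[OF _ coord nz])?) (intro holo_at_if holo holo_at_const)+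
  qed
  moreover have "F z \<in> {w. LB_param k i j w \<in> LB_reps} \<and>
      (\<exists>r. ((x z, s, i, j, \<xi> z, \<eta> z), r) \<in> LB_rel n \<and> LB_rel n `` {LB_param k i j (F z)} = LB_rel n `` {r})"
    if "z \<in> W" "(x z, s, i, j, \<xi> z, \<eta> z) \<in> LB_reps" for z
    using LB_chart_at[OF that(2) k(1)] that(1) unfolding W_def F_def by blast
  moreover have "w \<in> W" using k unfolding W_def by simp
  moreover have "({w. LB_param k i j w \<in> LB_reps}, \<lambda>w. LB_rel n `` {LB_param k i j w}) \<in> LB_atlas n"
    unfolding LB_atlas_def using k(1) by blast
  ultimately show ?thesis
    by (intro bexI[of _ "({w. LB_param k i j w \<in> LB_reps}, \<lambda>w. LB_rel n `` {LB_param k i j w})"])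
      (simp only: prod.case, blast)
qed

lemma holo_at_affine4:
  "holo_at (\<lambda>w::complex^6. lin_unit a b (affine4 k ((w $ 1, w $ 2), w $ 3)) (w $ 4)) w"
  "holo_at (\<lambda>w::complex^6. coord m (affine4 k ((w $ 1, w $ 2), w $ 3))) w"
  by (simp_all only: affine4.simps lin_unit.simps coord.simps if_distrib[of "coord m"]
      if_distrib[of "\<lambda>x. lin_unit a b x _"]) (intro holo)+

lemma lin_unit_real: "lin_unit a b (quad_real_rep x) (cnj s) = cnj (lin_unit b a x s)"
  by (cases x; cases a; cases b) simp_all

text \<open>The real structure transposes and conjugates the matrix of the forms, so it exchanges the factors \<open>u\<close> and \<open>v\<close>.\<close>

lemma quad_coords_real:
  "quad_coords x s c u v \<Longrightarrow> quad_coords (quad_real_rep x) (cnj s) (cnj c) (cnj2 v) (cnj2 u)"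
  unfolding quad_coords_def lin_unit_real
  by (auto simp: nonzero_sel) (metis complex_cnj_mult mult.commute)

lemma quad_real_rep_twice [simp]: "quad_real_rep (quad_real_rep x) = x"
  by (cases x) simp

definition LB_real_rep :: "real \<Rightarrow> lb_rep \<Rightarrow> lb_rep" where
  "LB_real_rep e = (\<lambda>(x, s, i, j, \<xi>, \<eta>).
     (quad_real_rep x, cnj s, j, i, of_real e * cnj \<eta>, of_real e * cnj \<xi>))"

lemma LB_real_rep_twice:
  assumes "e \<in> {1, -1}" shows "LB_real_rep e (LB_real_rep e r) = r"
  using assms by (cases r) (auto simp: LB_real_rep_def)

lemma LB_real_rep_in_reps:
  assumes "e \<in> {1, -1}"
  shows "LB_real_rep e r \<in> LB_reps \<longleftrightarrow> r \<in> LB_reps"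
proof -
  have "LB_real_rep e r \<in> LB_reps" if r: "r \<in> LB_reps" for r
  proof -
    obtain x s i j \<xi> \<eta> where r': "r = (x, s, i, j, \<xi>, \<eta>)" by (cases r)
    note q = quad_coords_unit_col_row[OF r[unfolded r']]
    show ?thesis
      using LB_reps_coords[OF q, of i j \<xi> \<eta>] r
      unfolding r' LB_real_rep_def by (simp add: LB_reps_coords[OF quad_coords_real[OF q]])
  qed
  then show ?thesis using LB_real_rep_twice[OF assms] by metis
qed

section \<open>The fibres over nonzero parameters: LeBrun models\<close>

text \<open>For \<open>s \<noteq> 0\<close> the four forms span all linear forms in \<open>x0, x1, x2, x3\<close>, so the matrix determines \<open>x\<close>.\<close>

lemma quad_coords_iff_segre:
  assumes "s \<noteq> 0"
  shows "quad_coords x s c u v \<longleftrightarrow>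
    c \<noteq> 0 \<and> u \<noteq> (0, 0) \<and> v \<noteq> (0, 0) \<and> scale4 c x = segre s (u, v)"
proof -
  obtain x0 x1 x2 x3 where x: "x = (x0, x1, x2, x3)" by (cases x)
  obtain u0 u1 where u: "u = (u0, u1)" by (cases u)
  obtain v0 v1 where v: "v = (v0, v1)" by (cases v)
  have "u0 * v0 = c * (s * x0 + x1) \<and> u1 * v1 = c * (s * x0 - x1) \<longleftrightarrow>
      2 * (c * (s * x0)) = u0 * v0 + u1 * v1 \<and> 2 * (c * x1) = u0 * v0 - u1 * v1"
    by (auto simp: algebra_simps) (algebra+)
  also have "\<dots> \<longleftrightarrow> c * x0 = (u0 * v0 + u1 * v1) / (2 * s) \<and> c * x1 = (u0 * v0 - u1 * v1) / 2"
    using assms by (auto simp: field_simps)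
  finally show ?thesis unfolding x u v quad_coords_expand segre.simps scale4.simps prod.inject by auto
qed

lemma quad_coords_same_point:
  assumes s: "s \<noteq> 0" and q: "quad_coords x s c u v"
  shows "(\<exists>c'. quad_coords x' s c' u v) \<longleftrightarrow> (\<exists>l. l \<noteq> 0 \<and> x' = scale4 l x)"
proof
  assume "\<exists>c'. quad_coords x' s c' u v"
  then obtain c' where c': "c' \<noteq> 0" "scale4 c' x' = scale4 c x"
    using q unfolding quad_coords_iff_segre[OF s] by auto
  have "x' = scale4 (inverse c') (scale4 c' x')" using c'(1) by simp
  also have "\<dots> = scale4 (c / c') x" unfolding c'(2) using c'(1) by (simp add: field_simps)
  finally show "\<exists>l. l \<noteq> 0 \<and> x' = scale4 l x"
    using c'(1) quad_coordsD(2)[OF q] by (intro exI[of _ "c / c'"]) simp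
qed (use quad_coords_scale4[OF q] in blast)

text \<open>The factor \<open>Z\<close> accounts for the fibrewise projectivisation. The constant \<open>\<mu>\<close> absorbs the difference between the
product of the given equations of the curves and the product of the linear forms.\<close>

definition PE_corr :: "nat \<Rightarrow> complex \<Rightarrow> complex \<Rightarrow> (lb_rep \<times> pe_rep) set" where
  "PE_corr n s \<mu> = {((x, s', i, j, \<xi>, \<eta>), (u, v, X, Y, Z)).
     (x, s', i, j, \<xi>, \<eta>) \<in> LB_reps \<and> s' = s \<and> Z \<noteq> 0 \<and> (\<exists>c. quad_coords x s c u v) \<and>
     X = Z * \<mu> * (\<xi> * (sel i u ^ (n - 1) * sel j v)) \<and>
     Y = Z * \<mu> * (\<eta> * (sel i u * sel j v ^ (n - 1)))}"

lemma PE_corr_iff: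
  "((x, s', i, j, \<xi>, \<eta>), (u, v, X, Y, Z)) \<in> PE_corr n s \<mu> \<longleftrightarrow>
     (x, s', i, j, \<xi>, \<eta>) \<in> LB_reps \<and> s' = s \<and> Z \<noteq> 0 \<and> (\<exists>c. quad_coords x s c u v) \<and>
     X = Z * \<mu> * (\<xi> * (sel i u ^ (n - 1) * sel j v)) \<and>
     Y = Z * \<mu> * (\<eta> * (sel i u * sel j v ^ (n - 1)))"
  unfolding PE_corr_def by simp

lemma PE_corr_left:
  assumes s: "s \<noteq> 0" and \<mu>: "\<mu> \<noteq> 0" and rt: "(r, t) \<in> PE_corr n s \<mu>"
  shows "(r', t) \<in> PE_corr n s \<mu> \<longleftrightarrow> (r, r') \<in> LB_rel n"
proof (cases "r' \<in> LB_reps")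
  case True
  obtain x s1 i j \<xi> \<eta> where r: "r = (x, s1, i, j, \<xi>, \<eta>)" by (cases r)
  obtain x' s' i' j' \<xi>' \<eta>' where r': "r' = (x', s', i', j', \<xi>', \<eta>')" by (cases r')
  obtain u v X Y Z where t: "t = (u, v, X, Y, Z)" by (cases t)
  obtain c where q: "quad_coords x s c u v" and s1: "s1 = s" and Z: "Z \<noteq> 0"
    and reps: "(x, s, i, j, \<xi>, \<eta>) \<in> LB_reps"
    and X: "X = Z * \<mu> * (\<xi> * (sel i u ^ (n - 1) * sel j v))"
    and Y: "Y = Z * \<mu> * (\<eta> * (sel i u * sel j v ^ (n - 1)))"
    using rt unfolding r t PE_corr_iff by auto
  have cancel: "Z * \<mu> * A = Z * \<mu> * B \<longleftrightarrow> B = A" for A B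
    using Z \<mu> by auto
  show ?thesis
    using True
    unfolding r r' t s1 PE_corr_iff LB_rel_coords[OF q reps True[unfolded r']] X Y cancel
      quad_coords_same_point[OF s q, symmetric]
    using Z by blast
next
  case False
  then have "(r, r') \<notin> LB_rel n" using LB_rel_imp_reps by blast
  moreover have "(r', t) \<notin> PE_corr n s \<mu>" using False unfolding PE_corr_def by auto
  ultimately show ?thesis by simp
qed

lemma PE_rel_iff:
  "((u, v, X, Y, Z), (u', v', X', Y', Z')) \<in> PE_rel n \<longleftrightarrow>
     (u, v, X, Y, Z) \<in> PE_reps \<and> (\<exists>l m k. l \<noteq> 0 \<and> m \<noteq> 0 \<and> k \<noteq> 0 \<and> u' = scale2 l u \<and> v' = scale2 m v \<and>
       X' = k * l ^ (n - 1) * m * X \<and> Y' = k * l * m ^ (n - 1) * Y \<and> Z' = k * Z)"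
  unfolding PE_rel_def by simp

lemma PE_corr_right:
  assumes rt: "(r, t) \<in> PE_corr n s \<mu>"
  shows "(r, t') \<in> PE_corr n s \<mu> \<longleftrightarrow> (t, t') \<in> PE_rel n"
proof -
  obtain x s1 i j \<xi> \<eta> where r: "r = (x, s1, i, j, \<xi>, \<eta>)" by (cases r)
  obtain u v X Y Z where t: "t = (u, v, X, Y, Z)" by (cases t)
  obtain u' v' X' Y' Z' where t': "t' = (u', v', X', Y', Z')" by (cases t')
  obtain c where q: "quad_coords x s c u v" and s1: "s1 = s" and Z: "Z \<noteq> 0"
    and reps: "(x, s, i, j, \<xi>, \<eta>) \<in> LB_reps"
    and X: "X = Z * \<mu> * (\<xi> * (sel i u ^ (n - 1) * sel j v))"
    and Y: "Y = Z * \<mu> * (\<eta> * (sel i u * sel j v ^ (n - 1)))"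
    using rt unfolding r t PE_corr_iff by auto
  have t_reps: "(u, v, X, Y, Z) \<in> PE_reps"
    using quad_coordsD(3,4)[OF q] Z unfolding PE_reps_def Q_reps_def by simp
  show ?thesis
  proof
    assume "(r, t') \<in> PE_corr n s \<mu>"
    then have Z': "Z' \<noteq> 0" and q': "\<exists>c. quad_coords x s c u' v'"
      and X': "X' = Z' * \<mu> * (\<xi> * (sel i u' ^ (n - 1) * sel j v'))"
      and Y': "Y' = Z' * \<mu> * (\<eta> * (sel i u' * sel j v' ^ (n - 1)))"
      unfolding r t' PE_corr_iff by auto
    obtain l m where lm: "l \<noteq> 0" "m \<noteq> 0" "u' = scale2 l u" "v' = scale2 m v"
      using q' unfolding quad_coords_same_uv[OF q] by blast
    show "(t, t') \<in> PE_rel n"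
      unfolding t t' PE_rel_iff
    proof (intro conjI exI)
      show "X' = (Z' / Z) * l ^ (n - 1) * m * X" "Y' = (Z' / Z) * l * m ^ (n - 1) * Y" "Z' = (Z' / Z) * Z"
        unfolding X X' Y Y' lm(3,4) sel_scale2 using Z by (simp_all add: power_mult_distrib)
    qed (use lm Z Z' t_reps in auto)
  next
    assume "(t, t') \<in> PE_rel n"
    then obtain l m k where lmk: "l \<noteq> 0" "m \<noteq> 0" "k \<noteq> 0" "u' = scale2 l u" "v' = scale2 m v"
      "X' = k * l ^ (n - 1) * m * X" "Y' = k * l * m ^ (n - 1) * Y" "Z' = k * Z"
      unfolding t t' PE_rel_iff by blast
    then have "\<exists>c. quad_coords x s c u' v'" unfolding quad_coords_same_uv[OF q] by blast
    then show "(r, t') \<in> PE_corr n s \<mu>"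
      unfolding r t' PE_corr_iff s1 using reps Z lmk(1-3) unfolding lmk(4-8) X Y sel_scale2
      by (simp add: power_mult_distrib)
  qed
qed

lemma Domain_PE_corr: "Domain (PE_corr n s \<mu>) = {r \<in> LB_reps. fst (snd r) = s}"
proof (intro set_eqI iffI)
  fix r :: lb_rep assume r: "r \<in> {r \<in> LB_reps. fst (snd r) = s}"
  obtain x s' i j \<xi> \<eta> where r': "r = (x, s', i, j, \<xi>, \<eta>)" by (cases r)
  have reps: "(x, s, i, j, \<xi>, \<eta>) \<in> LB_reps" and s: "s' = s" using r r' by auto
  show "r \<in> Domain (PE_corr n s \<mu>)"
    unfolding Domain_iff r' s
    using quad_coords_unit_col_row[OF reps] reps
    by (intro exI[of _ "(unit_col x s j, unit_row x s i, 1 * \<mu> * (\<xi> * (sel i (unit_col x s j) ^ (n - 1) * sel j (unit_row x s i))),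
          1 * \<mu> * (\<eta> * (sel i (unit_col x s j) * sel j (unit_row x s i) ^ (n - 1))), 1)"])
      (auto simp: PE_corr_iff)
qed (auto simp: PE_corr_def)

lemma quad_coords_segre:
  "s \<noteq> 0 \<Longrightarrow> u \<noteq> (0, 0) \<Longrightarrow> v \<noteq> (0, 0) \<Longrightarrow> quad_coords (segre s (u, v)) s 1 u v"
  by (simp add: quad_coords_iff_segre)

lemma PE_corr_segre:
  assumes s: "s \<noteq> 0" and \<mu>: "\<mu> \<noteq> 0" and "Z \<noteq> 0" and ij: "sel i u \<noteq> 0" "sel j v \<noteq> 0"
  shows "((segre s (u, v), s, i, j, X / (Z * \<mu> * (sel i u ^ (n - 1) * sel j v)),
      Y / (Z * \<mu> * (sel i u * sel j v ^ (n - 1)))), (u, v, X, Y, Z)) \<in> PE_corr n s \<mu>"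
proof -
  have "quad_coords (segre s (u, v)) s 1 u v"
    using ij by (intro quad_coords_segre[OF s]) (auto simp: nonzero_sel)
  then show ?thesis
    unfolding PE_corr_iff using assms by (auto simp: LB_reps_coords)
qed

lemma Range_PE_corr:
  assumes "s \<noteq> 0" "\<mu> \<noteq> 0"
  shows "Range (PE_corr n s \<mu>) = {(u, v, X, Y, Z). (u, v) \<in> Q_reps \<and> Z \<noteq> 0}"
proof (intro set_eqI iffI)
  fix t :: pe_rep assume "t \<in> {(u, v, X, Y, Z). (u, v) \<in> Q_reps \<and> Z \<noteq> 0}"
  then obtain u v X Y Z where t: "t = (u, v, X, Y, Z)" "(u, v) \<in> Q_reps" "Z \<noteq> 0" by blast
  then obtain i j where "sel i u \<noteq> 0" "sel j v \<noteq> 0" unfolding Q_reps_def nonzero_sel by auto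
  then show "t \<in> Range (PE_corr n s \<mu>)" unfolding t(1) using PE_corr_segre assms t(3) by blast
next
  fix t assume "t \<in> Range (PE_corr n s \<mu>)"
  then obtain r where "(r, t) \<in> PE_corr n s \<mu>" by blast
  then show "t \<in> {(u, v, X, Y, Z). (u, v) \<in> Q_reps \<and> Z \<noteq> 0}"
    by (cases r; cases t) (auto simp: PE_corr_iff Q_reps_def dest: quad_coordsD(3,4))
qed

definition PE_real_rep :: "real \<Rightarrow> pe_rep \<Rightarrow> pe_rep" where
  "PE_real_rep e = (\<lambda>(u, v, x, y, z).
     (cnj2 v, cnj2 u, of_real e * cnj y, of_real e * cnj x, cnj z))"

lemma PE_real_rep_twice:
  assumes "e \<in> {1, -1}" shows "PE_real_rep e (PE_real_rep e t) = t"
  using assms by (cases t) (auto simp: PE_real_rep_def)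

lemma PE_corr_real:
  assumes e: "e \<in> {1, -1}" and s: "cnj s = s" and \<mu>: "cnj \<mu> = \<mu>"
  shows "(LB_real_rep e r, PE_real_rep e t) \<in> PE_corr n s \<mu> \<longleftrightarrow> (r, t) \<in> PE_corr n s \<mu>"
proof -
  have *: "(LB_real_rep e r, PE_real_rep e t) \<in> PE_corr n s \<mu>" if rt: "(r, t) \<in> PE_corr n s \<mu>" for r t
  proof -
    obtain x s1 i j \<xi> \<eta> where r: "r = (x, s1, i, j, \<xi>, \<eta>)" by (cases r)
    obtain u v X Y Z where t: "t = (u, v, X, Y, Z)" by (cases t)
    have "(LB_real_rep e r) \<in> LB_reps" using rt LB_real_rep_in_reps[OF e] by (auto simp: PE_corr_def)
    moreover have "\<exists>c. quad_coords (quad_real_rep x) s c (cnj2 v) (cnj2 u)"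
      using quad_coords_real[of x s _ u v] rt s unfolding r t PE_corr_iff by metis
    ultimately show ?thesis
      using rt \<mu> s unfolding r t PE_corr_iff LB_real_rep_def PE_real_rep_def
      by (auto simp: PE_corr_iff mult_ac)
  qed
  show ?thesis
    using *[of r t] *[of "LB_real_rep e r" "PE_real_rep e t"] LB_real_rep_twice[OF e] PE_real_rep_twice[OF e]
    by auto
qed

text \<open>Holomorphic coordinates of the image point in the chart where \<open>u\<^sub>i = v\<^sub>j = 1\<close>.\<close>

lemma quad_coords_affine:
  assumes "(x, s, i, j, \<xi>, \<eta>) \<in> LB_reps"
  shows "quad_coords x s (1 / lin_unit i j x s) (affine2 i (lin_unit (\<not> i) j x s / lin_unit i j x s))
    (affine2 j (lin_unit i (\<not> j) x s / lin_unit i j x s))"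
proof -
  define L where "L = lin_unit i j x s"
  have L: "L \<noteq> 0" unfolding L_def using LB_reps_lin_unit[OF assms] .
  have "affine2 i (lin_unit (\<not> i) j x s / L) = scale2 (1 / L) (unit_col x s j)"
    "affine2 j (lin_unit i (\<not> j) x s / L) = scale2 (1 / L) (unit_row x s i)"
    using L by (cases i; cases j; simp add: affine2_def unit_col_def unit_row_def L_def)+
  then show ?thesis
    using quad_coords_scale2[OF quad_coords_unit_col_row[OF assms], of "1 / L" "1 / L"] L
    unfolding L_def by simp
qed

lemma affine2_ratio: "sel i u \<noteq> 0 \<Longrightarrow> affine2 i (sel (\<not> i) u / sel i u) = scale2 (1 / sel i u) u"
  by (cases u; cases i) (simp_all add: affine2_def)

lemma PE_param_2: "PE_param i j 2 w = (affine2 i (w $ 1), affine2 j (w $ 2), w $ 3, w $ 4, 1)"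
  by (simp add: PE_param_def)

text \<open>In the charts with the same indices \<open>(i, j)\<close> the map is \<open>(u, v, x, y) = (lin_unit (\<not> i) j / lin_unit i j,
lin_unit i (\<not> j) / lin_unit i j, \<mu> \<xi>, \<mu> \<eta>)\<close>, a rational map without poles on the domain of the
trivialisation.\<close>

lemma LB_PE_holomorphic:
  assumes s: "s \<noteq> 0" and corr: "correspondence (LB_rel n) (PE_rel n) (PE_corr n s \<mu>) (Z_eq n h) Q (Z_fibre n h s) U"
    and n: "n \<ge> 1" and h: "\<And>m l x. h m (scale4 l x) = l * h m x"
  shows "holomorphic_map (LB_atlas n) (Z_fibre n h s) (PE_atlas n) U (\<lambda>p. PE_corr n s \<mu> `` p)"
proof (rule correspondence.holomorphic[OF corr])
  fix r t assume rt: "(r, t) \<in> PE_corr n s \<mu>" and "Z_eq n h r"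
  obtain x s' i j \<xi> \<eta> where r: "r = (x, s', i, j, \<xi>, \<eta>)" by (cases r)
  have reps: "(x, s', i, j, \<xi>, \<eta>) \<in> LB_reps" using rt unfolding r PE_corr_def by auto
  obtain k where k: "k < 4" "coord k x \<noteq> 0" using coord_nonzero[OF LB_reps_nonzero[OF reps]] by blast
  define D where "D = {w. LB_param k i j w \<in> LB_reps}"
  define \<phi> where "\<phi> = (\<lambda>w. LB_rel n `` {LB_param k i j w})"
  define E where "E = (UNIV :: (complex^4) set)"
  define \<psi> where "\<psi> = (\<lambda>w. PE_rel n `` {PE_param i j 2 w})"
  define w where "w = LB_chart k x s' \<xi> \<eta>"
  define L where "L = (\<lambda>a b (w::complex^6). lin_unit a b (affine4 k ((w $ 1, w $ 2), w $ 3)) (w $ 4))"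
  define W where "W = {w. L i j w \<noteq> 0}"
  define F where "F = (\<lambda>w. vec4 (L (\<not> i) j w / L i j w) (L i (\<not> j) w / L i j w) (\<mu> * w $ 5) (\<mu> * w $ 6))"
  have holo_L: "holo_at (L a b) w" for a b w unfolding L_def by (rule holo_at_affine4)
  have LB: "(D, \<phi>) \<in> LB_atlas n" unfolding D_def \<phi>_def LB_atlas_def using k(1) by blast
  have PE: "(E, \<psi>) \<in> PE_atlas n" unfolding E_def \<psi>_def PE_atlas_def by force
  have w: "w \<in> D" unfolding D_def w_def using LB_chart_at(1)[OF reps k] by simp
  have "(r, LB_param k i j w) \<in> LB_rel n" unfolding r w_def by (rule LB_chart_at(2)[OF reps k])
  then have "(LB_param k i j w, t) \<in> PE_corr n s \<mu>" using correspondence.left[OF corr rt] by blast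
  then have \<phi>w: "\<phi> w = LB_rel n `` {r}"
    unfolding \<phi>_def using correspondence.image_image_class[OF corr] correspondence.image_class[OF corr] rt
    by metis
  have LD: "L i j z \<noteq> 0" if "z \<in> D" for z
    using that LB_reps_lin_unit unfolding D_def L_def LB_param_def by simp
  have "open W" unfolding W_def by (rule open_holo_at_nonzero[OF holo_L])
  moreover have "w \<in> W" unfolding W_def using LD[OF w] by simp
  moreover have "holomorphic_vec_on F W"
    unfolding F_def W_def
    by (intro holomorphic_vec_onI holo_at_vec4 holo_at_divide holo_L holo_at_mult holo_at_const holo_at_coord) simp_all
  moreover have "F z \<in> E \<and> (\<exists>r t. (r, t) \<in> PE_corr n s \<mu> \<and> \<phi> z = LB_rel n `` {r} \<and> \<psi> (F z) = PE_rel n `` {t})"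
    if z: "z \<in> D \<inter> W" and \<phi>: "\<phi> z \<in> Z_fibre n h s" for z
  proof -
    have reps: "LB_param k i j z \<in> LB_reps" using z unfolding D_def by blast
    have "fst (snd (LB_param k i j z)) = s"
      using Z_fibre_classD(1)[of n h, OF n h reps] \<phi> unfolding \<phi>_def by blast
    then have z4: "z $ 4 = s" unfolding LB_param_def by simp
    have reps': "(affine4 k ((z $ 1, z $ 2), z $ 3), s, i, j, z $ 5, z $ 6) \<in> LB_reps"
      using reps unfolding LB_param_def z4 .
    have "PE_param i j 2 (F z) =
        (affine2 i (L (\<not> i) j z / L i j z), affine2 j (L i (\<not> j) z / L i j z), \<mu> * z $ 5, \<mu> * z $ 6, 1)"
      unfolding PE_param_def F_def by simp
    then have "(LB_param k i j z, PE_param i j 2 (F z)) \<in> PE_corr n s \<mu>"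
      using quad_coords_affine[OF reps'] reps'
      unfolding LB_param_def L_def z4 by (auto simp only: PE_corr_iff sel_affine2 power_one mult_1_left mult_1_right one_neq_zero)
    then show ?thesis unfolding E_def \<phi>_def \<psi>_def by blast
  qed
  ultimately show "\<exists>(D, \<phi>)\<in>LB_atlas n. \<exists>(E, \<psi>)\<in>PE_atlas n. \<exists>w\<in>D. \<exists>W F.
      \<phi> w = LB_rel n `` {r} \<and> open W \<and> w \<in> W \<and> holomorphic_vec_on F W \<and>
      (\<forall>z\<in>D \<inter> W. \<phi> z \<in> Z_fibre n h s \<longrightarrow> F z \<in> E \<and>
        (\<exists>r t. (r, t) \<in> PE_corr n s \<mu> \<and> \<phi> z = LB_rel n `` {r} \<and> \<psi> (F z) = PE_rel n `` {t}))"
    apply (intro bexI[OF _ LB], unfold prod.case)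
    apply (intro bexI[OF _ PE], unfold prod.case)
    apply (rule bexI[OF _ w])
    using \<phi>w by blast
qed

text \<open>The inverse map is polynomial in the affine coordinates, by the Segre map; as \<open>u\<^sub>i = v\<^sub>j = 1\<close> there, the
fibre coordinates are just divided by \<open>\<mu>\<close>.\<close>

lemma PE_LB_holomorphic:
  assumes s: "s \<noteq> 0" and \<mu>: "\<mu> \<noteq> 0" and corr: "correspondence (LB_rel n) (PE_rel n) (PE_corr n s \<mu>) P Q X U"
  shows "holomorphic_map (PE_atlas n) U (LB_atlas n) X (\<lambda>q. (PE_corr n s \<mu>)\<inverse> `` q)"
proof (rule correspondence.holomorphic[OF correspondence.flip[OF corr]])
  fix t r assume "(t, r) \<in> (PE_corr n s \<mu>)\<inverse>" and "Q t"
  then have rt: "(r, t) \<in> PE_corr n s \<mu>" by simp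
  obtain u v X' Y Z where t: "t = (u, v, X', Y, Z)" by (cases t)
  have "t \<in> Range (PE_corr n s \<mu>)" using rt by blast
  then have uv: "u \<noteq> (0, 0)" "v \<noteq> (0, 0)" and Z: "Z \<noteq> 0"
    unfolding t Range_PE_corr[OF s \<mu>] Q_reps_def by simp_all
  obtain i j where ij: "sel i u \<noteq> 0" "sel j v \<noteq> 0" using uv unfolding nonzero_sel by blast
  define D where "D = (UNIV :: (complex^4) set)"
  define \<phi> where "\<phi> = (\<lambda>w. PE_rel n `` {PE_param i j 2 w})"
  define w where "w = vec4 (sel (\<not> i) u / sel i u) (sel (\<not> j) v / sel j v)
      (X' / (Z * (sel i u ^ (n - 1) * sel j v))) (Y / (Z * (sel i u * sel j v ^ (n - 1))))"
  define u' v' where "u' = (\<lambda>w::complex^4. affine2 i (w $ 1))" and "v' = (\<lambda>w::complex^4. affine2 j (w $ 2))"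
  define x0 x1 x2 x3 where
    "x0 = (\<lambda>w. (sel True (u' w) * sel True (v' w) + sel False (u' w) * sel False (v' w)) / (2 * s))"
    and "x1 = (\<lambda>w. (sel True (u' w) * sel True (v' w) - sel False (u' w) * sel False (v' w)) / 2)"
    and "x2 = (\<lambda>w. sel True (u' w) * sel False (v' w))"
    and "x3 = (\<lambda>w. sel False (u' w) * sel True (v' w))"
  define x where "x = (\<lambda>w. (x0 w, x1 w, x2 w, x3 w))"
  have x: "x w = segre s (u' w, v' w)" for w
    by (cases "u' w"; cases "v' w") (simp add: x_def x0_def x1_def x2_def x3_def)
  have uv': "u' w \<noteq> (0, 0)" "v' w \<noteq> (0, 0)" for w
    unfolding u'_def v'_def affine2_def by simp_all
  have q: "quad_coords (x w) s 1 (u' w) (v' w)" for w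
    unfolding x by (rule quad_coords_segre[OF s uv'])
  have holo_sel: "holo_at (\<lambda>w. sel a (u' w)) w" "holo_at (\<lambda>w. sel a (v' w)) w" for a w
    unfolding u'_def v'_def affine2_def sel_def
    by (cases a; cases i; cases j; simp add: holo)+
  have holo_x: "holo_at x0 w" "holo_at x1 w" "holo_at x2 w" "holo_at x3 w" for w
    unfolding x0_def x1_def x2_def x3_def using s by (auto intro!: holo holo_sel)
  define \<xi> \<eta> where "\<xi> = (\<lambda>w::complex^4. w $ 3 / \<mu>)" and "\<eta> = (\<lambda>w::complex^4. w $ 4 / \<mu>)"
  have holo_xi: "holo_at \<xi> w" "holo_at \<eta> w" for w
    unfolding \<xi>_def \<eta>_def using \<mu> by (auto intro!: holo)
  have reps: "(x z, s, i, j, \<xi> z, \<eta> z) \<in> LB_reps" for z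
    unfolding LB_reps_coords[OF q] u'_def v'_def by simp
  have C: "((x z, s, i, j, \<xi> z, \<eta> z), PE_param i j 2 z) \<in> PE_corr n s \<mu>" for z
    using reps[of z] q[of z] \<mu> unfolding PE_param_def u'_def v'_def \<xi>_def \<eta>_def by (auto simp: PE_corr_iff)
  have "\<exists>(E, \<psi>)\<in>LB_atlas n. \<exists>W F. open W \<and> w \<in> W \<and> holomorphic_vec_on F W \<and>
    (\<forall>z\<in>W. (x z, s, i, j, \<xi> z, \<eta> z) \<in> LB_reps \<longrightarrow>
       F z \<in> E \<and> (\<exists>r. ((x z, s, i, j, \<xi> z, \<eta> z), r) \<in> LB_rel n \<and> \<psi> (F z) = LB_rel n `` {r}))"
    by (rule holomorphic_into_LB[OF holo_x holo_xi x_def LB_reps_nonzero[OF reps]])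
  then obtain E \<psi> W F where LB: "(E, \<psi>) \<in> LB_atlas n" and W: "open W" "w \<in> W" "holomorphic_vec_on F W" and
    F: "\<And>z. z \<in> W \<Longrightarrow> F z \<in> E \<and> (\<exists>r. ((x z, s, i, j, \<xi> z, \<eta> z), r) \<in> LB_rel n \<and> \<psi> (F z) = LB_rel n `` {r})"
    using reps by blast
  have PE: "(D, \<phi>) \<in> PE_atlas n" unfolding D_def \<phi>_def PE_atlas_def by force
  have "(t, PE_param i j 2 w) \<in> PE_rel n"
    unfolding t PE_param_2 w_def vec4_nth affine2_ratio[OF ij(1)] affine2_ratio[OF ij(2)] PE_rel_iff
  proof (intro conjI, goal_cases)
    case 1 show ?case using uv Z by (simp add: PE_reps_def Q_reps_def)
  next
    case 2 show ?case
      by (rule exI[of _ "1 / sel i u"], rule exI[of _ "1 / sel j v"], rule exI[of _ "1 / Z"])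
        (use ij Z in \<open>simp add: PE_rel_iff power_divide\<close>)
  qed
  then have "(r, PE_param i j 2 w) \<in> PE_corr n s \<mu>" using correspondence.right[OF corr rt] by blast
  then have \<phi>w: "\<phi> w = PE_rel n `` {t}"
    unfolding \<phi>_def using correspondence.image_class[OF corr] rt by metis
  have "F z \<in> E \<and> (\<exists>t r. (t, r) \<in> (PE_corr n s \<mu>)\<inverse> \<and> \<phi> z = PE_rel n `` {t} \<and> \<psi> (F z) = LB_rel n `` {r})"
    if "z \<in> W" for z
  proof -
    obtain r where r: "((x z, s, i, j, \<xi> z, \<eta> z), r) \<in> LB_rel n" "\<psi> (F z) = LB_rel n `` {r}" "F z \<in> E"
      using F[OF \<open>z \<in> W\<close>] by blast
    have "(r, PE_param i j 2 z) \<in> PE_corr n s \<mu>" using correspondence.left[OF corr C] r(1) by blast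
    then show ?thesis using r(2,3) unfolding \<phi>_def by blast
  qed
  moreover have "w \<in> D" unfolding D_def by simp
  ultimately show "\<exists>(D, \<phi>)\<in>PE_atlas n. \<exists>(E, \<psi>)\<in>LB_atlas n. \<exists>w\<in>D. \<exists>W F.
      \<phi> w = PE_rel n `` {t} \<and> open W \<and> w \<in> W \<and> holomorphic_vec_on F W \<and>
      (\<forall>z\<in>D \<inter> W. \<phi> z \<in> U \<longrightarrow> F z \<in> E \<and>
        (\<exists>t r. (t, r) \<in> (PE_corr n s \<mu>)\<inverse> \<and> \<phi> z = PE_rel n `` {t} \<and> \<psi> (F z) = LB_rel n `` {r}))"
    apply (intro bexI[OF _ PE], unfold prod.case)
    apply (intro bexI[OF _ LB], unfold prod.case)
    apply (rule bexI[where x = w])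
    using \<phi>w W by blast+
qed

definition PE_infinity :: "nat \<Rightarrow> pe_rep set set" where
  "PE_infinity n = {p \<in> PE n. \<forall>(u, v, x, y, z)\<in>p. z = 0}"

lemma PE_rel_refl:
  assumes "t \<in> PE_reps" shows "(t, t) \<in> PE_rel n"
proof -
  obtain u v x y z where t: "t = (u, v, x, y, z)" by (cases t)
  show ?thesis
    using assms unfolding t PE_rel_iff by (intro conjI exI[of _ 1]) simp_all
qed

lemma PE_class_in_infinity:
  assumes t: "(u, v, x, y, z) \<in> PE_reps"
  shows "PE_rel n `` {(u, v, x, y, z)} \<in> PE_infinity n \<longleftrightarrow> z = 0"
proof -
  have "PE_rel n `` {(u, v, x, y, z)} \<in> PE n" unfolding PE_def using t by (rule quotientI)
  moreover have "(\<forall>(u', v', x', y', z')\<in>PE_rel n `` {(u, v, x, y, z)}. z' = 0) \<longleftrightarrow> z = 0"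
  proof
    assume "\<forall>(u', v', x', y', z')\<in>PE_rel n `` {(u, v, x, y, z)}. z' = 0"
    from bspec[OF this, of "(u, v, x, y, z)"] show "z = 0" using PE_rel_refl[OF t, of n] by simp
  qed (auto simp: PE_rel_iff)
  ultimately show ?thesis unfolding PE_infinity_def by blast
qed

lemma zariski_closed_PE_infinity: "zariski_closed (PE_atlas n) (PE_infinity n)"
proof -
  have "\<exists>S. (\<forall>p\<in>S. polynomial_fun p) \<and>
      (\<forall>w. PE_rel n `` {PE_param i j k w} \<in> PE_infinity n \<longleftrightarrow> (\<forall>p\<in>S. p w = 0))" for i j k
  proof -
    define p where "p = (if k < 2 then (\<lambda>w::complex^4. w $ 4) else (\<lambda>w. 1))"
    have "polynomial_fun p" unfolding p_def by (cases "k < 2") (simp_all add: polynomial_fun.coord polynomial_fun.const)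
    moreover have "PE_rel n `` {PE_param i j k w} \<in> PE_infinity n \<longleftrightarrow> p w = 0" for w
      unfolding PE_param_def p_def
      by (subst prod.collapse[symmetric], unfold fst_conv snd_conv,
          auto simp: PE_class_in_infinity PE_reps_def Q_reps_def affine2_def)
    ultimately show ?thesis by (intro exI[of _ "{p}"]) simp
  qed
  then show ?thesis unfolding zariski_closed_def PE_atlas_def by fastforce
qed

definition PE_eq :: "nat \<Rightarrow> (nat \<Rightarrow> real) \<Rightarrow> (nat \<Rightarrow> complex) \<Rightarrow> (nat \<Rightarrow> complex) \<Rightarrow> (nat \<Rightarrow> real) \<Rightarrow> pe_rep \<Rightarrow> bool"
  where "PE_eq n a b c d = (\<lambda>(u, v, x, y, z).
    x * y = (\<Prod>i=1..n. bideg11 (a i) (b i) (c i) (d i) (u, v)) * z\<^sup>2)"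

text \<open>Both sides of one equation are those of the other times \<open>Z\<^sup>2 \<mu>\<^sup>2 c\<^sup>n\<close>, where \<open>c\<close> is the factor between
\<open>segre s (u, v)\<close> and \<open>x\<close>.\<close>

lemma PE_eq_corr:
  assumes s: "s \<noteq> 0" and \<mu>: "\<mu> \<noteq> 0" and n: "n \<ge> 1" and h: "\<And>m l x. h m (scale4 l x) = l * h m x"
    and P: "\<And>m u v. m \<in> {1..n} \<Longrightarrow> bideg11 (a m) (b m) (c m) (d m) (u, v) = \<kappa> m * h m (segre s (u, v))"
    and \<kappa>: "\<mu>\<^sup>2 = (\<Prod>m=1..n. \<kappa> m)"
    and rt: "(r, t) \<in> PE_corr n s \<mu>"
  shows "Z_eq n h r \<longleftrightarrow> PE_eq n a b c d t"
proof -
  obtain x s1 i j \<xi> \<eta> where r: "r = (x, s1, i, j, \<xi>, \<eta>)" by (cases r)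
  obtain u v X Y Z where t: "t = (u, v, X, Y, Z)" by (cases t)
  obtain N where N: "n = Suc N" using n by (cases n) auto
  obtain k where q: "quad_coords x s k u v" and s1: "s1 = s" and Z: "Z \<noteq> 0"
    and X: "X = Z * \<mu> * (\<xi> * (sel i u ^ N * sel j v))"
    and Y: "Y = Z * \<mu> * (\<eta> * (sel i u * sel j v ^ N))"
    using rt unfolding r t PE_corr_iff N by auto
  have "X * Y = Z\<^sup>2 * \<mu>\<^sup>2 * (\<xi> * \<eta> * (sel i u * sel j v) ^ n)"
    unfolding X Y N by (simp add: power2_eq_square power_mult_distrib)
  also have "\<dots> = (Z\<^sup>2 * \<mu>\<^sup>2 * k ^ n) * (\<xi> * \<eta> * lin_unit i j x s ^ n)"
    unfolding quad_coordsD(1)[OF q] by (simp add: power_mult_distrib)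
  finally have XY: "X * Y = (Z\<^sup>2 * \<mu>\<^sup>2 * k ^ n) * (\<xi> * \<eta> * lin_unit i j x s ^ n)" .
  have "segre s (u, v) = scale4 k x" using q unfolding quad_coords_iff_segre[OF s] by simp
  then have "(\<Prod>m=1..n. bideg11 (a m) (b m) (c m) (d m) (u, v)) = (\<Prod>m=1..n. \<kappa> m * (k * h m x))"
    using P h by (intro prod.cong) auto
  also have "\<dots> = \<mu>\<^sup>2 * k ^ n * (\<Prod>m=1..n. h m x)" unfolding \<kappa> by (simp add: prod.distrib)
  finally have "(\<Prod>m=1..n. bideg11 (a m) (b m) (c m) (d m) (u, v)) * Z\<^sup>2 =
      (Z\<^sup>2 * \<mu>\<^sup>2 * k ^ n) * (\<Prod>m=1..n. h m x)" by simp
  then show ?thesis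
    unfolding r t PE_eq_def Z_eq_def prod.case s1 XY using Z \<mu> quad_coordsD(2)[OF q]
    by (simp add: mult.assoc)
qed

text \<open>The image is the complement of the divisor \<open>z = 0\<close>. The real structures correspond when
conjugation fixes both \<open>s\<close> and the rescaling constant \<open>\<mu>\<close>.\<close>

theorem nonzero_fibre_biholomorphic:
  assumes s: "s \<noteq> 0" and \<mu>: "\<mu> \<noteq> 0" and n: "n \<ge> 1" and h: "\<And>m l x. h m (scale4 l x) = l * h m x"
    and P: "\<And>m u v. m \<in> {1..n} \<Longrightarrow> bideg11 (a m) (b m) (c m) (d m) (u, v) = \<kappa> m * h m (segre s (u, v))"
    and \<kappa>: "\<mu>\<^sup>2 = (\<Prod>m=1..n. \<kappa> m)"
  shows "\<exists>U f. zariski_open_in (PE_atlas n) (lebrun_model n a b c d) U \<and>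
    biholomorphic_map (LB_atlas n) (Z_fibre n h s) (PE_atlas n) U f \<and>
    (cnj s = s \<longrightarrow> cnj \<mu> = \<mu> \<longrightarrow>
      (\<forall>e\<in>{1, -1}. \<forall>p\<in>Z_fibre n h s. f (LB_real e p) = PE_real e (f p)))"
proof -
  define U where "U = {PE_rel n `` {t} | t. t \<in> Range (PE_corr n s \<mu>) \<and> PE_eq n a b c d t}"
  have PQ: "Z_eq n h r \<longleftrightarrow> PE_eq n a b c d t" if "(r, t) \<in> PE_corr n s \<mu>" for r t
    by (rule PE_eq_corr[of s \<mu> n h a b c d \<kappa>, OF s \<mu> n h P \<kappa> that])
  interpret correspondence "LB_rel n" "PE_rel n" "PE_corr n s \<mu>" "Z_eq n h" "PE_eq n a b c d" "Z_fibre n h s" U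
  proof
    show "Z_fibre n h s = {LB_rel n `` {r} | r. r \<in> Domain (PE_corr n s \<mu>) \<and> Z_eq n h r}"
      unfolding Domain_PE_corr Z_fibre_classes[of n h, OF n h] by blast
  qed (rule PE_corr_left[OF s \<mu>] PE_corr_right U_def PQ; assumption)+
  have range: "Range (PE_corr n s \<mu>) = {(u, v, X, Y, Z). (u, v) \<in> Q_reps \<and> Z \<noteq> 0}"
    by (rule Range_PE_corr[OF s \<mu>])
  have "U = lebrun_model n a b c d - PE_infinity n"
  proof (intro set_eqI iffI)
    fix p assume "p \<in> U"
    then obtain t where t: "t \<in> Range (PE_corr n s \<mu>)" "PE_eq n a b c d t" "p = PE_rel n `` {t}"
      unfolding U_def by blast
    obtain r where r: "(r, t) \<in> PE_corr n s \<mu>" using t(1) by blast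
    have reps: "t \<in> PE_reps" using t(1) unfolding range PE_reps_def by auto
    have "PE_eq n a b c d t'" if "(t, t') \<in> PE_rel n" for t'
      using right[OF r, of t'] that PQ[OF r] PQ[of r t'] t(2) by blast
    then have "p \<in> lebrun_model n a b c d"
      unfolding lebrun_model_def t(3) PE_def using quotientI[OF reps, of "PE_rel n"] by (auto simp: PE_eq_def)
    moreover have "p \<notin> PE_infinity n"
      using t(1) reps PE_class_in_infinity[of _ _ _ _ _ n] unfolding t(3) range by auto
    ultimately show "p \<in> lebrun_model n a b c d - PE_infinity n" by blast
  next
    fix p assume p: "p \<in> lebrun_model n a b c d - PE_infinity n"
    then obtain t where t: "t \<in> PE_reps" "p = PE_rel n `` {t}"
      unfolding lebrun_model_def PE_def quotient_def by blast
    have "PE_eq n a b c d t"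
      using p PE_rel_refl[OF t(1), of n] unfolding t(2) lebrun_model_def PE_eq_def by blast
    moreover have "t \<in> Range (PE_corr n s \<mu>)"
      using t p PE_class_in_infinity[of _ _ _ _ _ n] unfolding range by (cases t) (auto simp: PE_reps_def)
    ultimately show "p \<in> U" unfolding U_def t(2) by blast
  qed
  then have "zariski_open_in (PE_atlas n) (lebrun_model n a b c d) U"
    unfolding zariski_open_in_def using zariski_closed_PE_infinity by blast
  moreover have "biholomorphic_map (LB_atlas n) (Z_fibre n h s) (PE_atlas n) U (\<lambda>p. PE_corr n s \<mu> `` p)"
    by (rule biholomorphic[OF LB_PE_holomorphic[of s n \<mu> h, OF s correspondence_axioms n h]
        PE_LB_holomorphic[OF s \<mu> correspondence_axioms]])
  moreover have "PE_corr n s \<mu> `` LB_real e p = PE_real e (PE_corr n s \<mu> `` p)"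
    if e: "e \<in> {1, -1}" and "cnj s = s" "cnj \<mu> = \<mu>" "p \<in> Z_fibre n h s" for e p
  proof -
    have "surj (LB_real_rep e)" "surj (PE_real_rep e)"
      using LB_real_rep_twice[OF e] PE_real_rep_twice[OF e] by (metis surjI)+
    from equivariant[OF this PE_corr_real[OF e that(2,3)] that(4)] show ?thesis
      unfolding LB_real_def PE_real_def LB_real_rep_def PE_real_rep_def .
  qed
  ultimately show ?thesis by blast
qed

section \<open>The fibre over zero: Hitchin varieties\<close>

text \<open>On the cone, \<open>lin_unit True True = x1 = - lin_unit False False\<close>, so \<open>u0 v0 + u1 v1 = 0\<close> and \<open>v\<close> is a multiple of
this vector; \<open>v\<close> can be normalised to equal it.\<close>

definition perp :: "hom2 \<Rightarrow> hom2" where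
  "perp u = (- snd u, fst u)"

lemma sel_perp: "sel a (perp u) = (if a then - sel False u else sel True u)"
  by (simp add: perp_def sel_def)

lemma sel_perp_Not: "sel (\<not> a) (perp u) = (if a then sel a u else - sel a u)"
  by (simp add: sel_perp)

lemma perp_scale2: "perp (scale2 l u) = scale2 l (perp u)"
  by (cases u) (simp add: perp_def)

text \<open>Scaling \<open>u\<close> by \<open>l\<close> scales \<open>c\<close> by \<open>l\<^sup>2\<close>, so \<open>c x0\<close> is a coordinate of \<open>O(2)\<close>; the other two
coordinates are the invariants of \<open>LB_rel_coords\<close> for \<open>v = perp u\<close>, of degree \<open>n\<close> in \<open>u\<close>.\<close>

definition Hit_corr :: "nat \<Rightarrow> (lb_rep \<times> hit_rep) set" where
  "Hit_corr n = {((x, s, i, j, \<xi>, \<eta>), (u, X, Y, Z)).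
     (x, s, i, j, \<xi>, \<eta>) \<in> LB_reps \<and> s = 0 \<and>
     (\<exists>c. quad_coords x 0 c u (perp u) \<and> Z = c * fst x) \<and>
     X = \<xi> * (sel i u ^ (n - 1) * sel j (perp u)) \<and>
     Y = \<eta> * (sel i u * sel j (perp u) ^ (n - 1))}"

lemma Hit_corr_iff:
  "((x, s, i, j, \<xi>, \<eta>), (u, X, Y, Z)) \<in> Hit_corr n \<longleftrightarrow>
     (x, s, i, j, \<xi>, \<eta>) \<in> LB_reps \<and> s = 0 \<and>
     (\<exists>c. quad_coords x 0 c u (perp u) \<and> Z = c * fst x) \<and>
     X = \<xi> * (sel i u ^ (n - 1) * sel j (perp u)) \<and>
     Y = \<eta> * (sel i u * sel j (perp u) ^ (n - 1))"
  unfolding Hit_corr_def by simp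

text \<open>The parametrisation of the cone \<open>x1\<^sup>2 + x2 x3 = 0\<close> by its rulings \<open>u\<close>, with \<open>z\<close> the coordinate along a ruling.\<close>

definition cone_point :: "hom2 \<Rightarrow> complex \<Rightarrow> hom4" where
  "cone_point u z = (z, - sel True u * sel False u, (sel True u)\<^sup>2, - (sel False u)\<^sup>2)"

lemma quad_coords_cone:
  "quad_coords x 0 c u (perp u) \<and> z = c * fst x \<longleftrightarrow> c \<noteq> 0 \<and> u \<noteq> (0, 0) \<and> scale4 c x = cone_point u z"
  by (cases x; cases u)
    (auto simp: quad_coords_expand perp_def cone_point_def power2_eq_square algebra_simps)

lemma quad_coords_cone_same_point:
  assumes q: "quad_coords x 0 c u (perp u)"
  shows "(\<exists>c'. quad_coords x' 0 c' u (perp u) \<and> c * fst x = c' * fst x') \<longleftrightarrow>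
    (\<exists>l. l \<noteq> 0 \<and> x' = scale4 l x)"
proof
  assume "\<exists>c'. quad_coords x' 0 c' u (perp u) \<and> c * fst x = c' * fst x'"
  then obtain c' where c': "c' \<noteq> 0" "scale4 c' x' = scale4 c x"
    using q quad_coords_cone by metis
  have "x' = scale4 (inverse c') (scale4 c' x')" using c'(1) by simp
  also have "\<dots> = scale4 (c / c') x" unfolding c'(2) using c'(1) by (simp add: field_simps)
  finally show "\<exists>l. l \<noteq> 0 \<and> x' = scale4 l x"
    using c'(1) quad_coordsD(2)[OF q] by (intro exI[of _ "c / c'"]) simp
next
  assume "\<exists>l. l \<noteq> 0 \<and> x' = scale4 l x"
  then obtain l where l: "l \<noteq> 0" "x' = scale4 l x" by blast
  then show "\<exists>c'. quad_coords x' 0 c' u (perp u) \<and> c * fst x = c' * fst x'"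
    using quad_coords_scale4[OF q l(1)] by (intro exI[of _ "c / l"]) (cases x; simp)
qed

lemma quad_coords_cone_same_u:
  assumes q: "quad_coords x 0 c u (perp u)" and q': "quad_coords x 0 c' u' (perp u')"
  obtains l where "l \<noteq> 0" "u' = scale2 l u" "c' = l\<^sup>2 * c"
proof -
  obtain l m where l: "l \<noteq> 0" "u' = scale2 l u"
    using quad_coords_same_uv[OF q] q' by blast
  obtain i j where "lin_unit i j x 0 \<noteq> 0"
    using quad_coordsD[OF q] unfolding nonzero_sel by (metis mult_eq_0_iff)
  moreover have "c' * lin_unit i j x 0 = l\<^sup>2 * c * lin_unit i j x 0"
    unfolding quad_coordsD(1)[OF q', symmetric] unfolding l(2) perp_scale2 sel_scale2
    using quad_coordsD(1)[OF q, of i j] by (simp add: power2_eq_square)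
  ultimately show thesis using that l by simp
qed

lemma Hit_corr_left:
  assumes rt: "(r, t) \<in> Hit_corr n"
  shows "(r', t) \<in> Hit_corr n \<longleftrightarrow> (r, r') \<in> LB_rel n"
proof (cases "r' \<in> LB_reps")
  case True
  obtain x s1 i j \<xi> \<eta> where r: "r = (x, s1, i, j, \<xi>, \<eta>)" by (cases r)
  obtain x' s' i' j' \<xi>' \<eta>' where r': "r' = (x', s', i', j', \<xi>', \<eta>')" by (cases r')
  obtain u X Y Z where t: "t = (u, X, Y, Z)" by (cases t)
  obtain c where q: "quad_coords x 0 c u (perp u)" and s1: "s1 = 0" and Z: "Z = c * fst x"
    and reps: "(x, 0, i, j, \<xi>, \<eta>) \<in> LB_reps"
    and X: "X = \<xi> * (sel i u ^ (n - 1) * sel j (perp u))"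
    and Y: "Y = \<eta> * (sel i u * sel j (perp u) ^ (n - 1))"
    using rt unfolding r t Hit_corr_iff by auto
  show ?thesis
    using True
    unfolding r r' t s1 Hit_corr_iff LB_rel_coords[OF q reps True[unfolded r']] X Y Z
      quad_coords_cone_same_point[OF q, symmetric]
    by metis
next
  case False
  then have "(r, r') \<notin> LB_rel n" using LB_rel_imp_reps by blast
  moreover have "(r', t) \<notin> Hit_corr n" using False unfolding Hit_corr_def by auto
  ultimately show ?thesis by simp
qed

lemma Hit_rel_iff:
  "((u, X, Y, Z), (u', X', Y', Z')) \<in> Hit_rel n \<longleftrightarrow> u \<noteq> (0, 0) \<and>
     (\<exists>l. l \<noteq> 0 \<and> u' = scale2 l u \<and> X' = l ^ n * X \<and> Y' = l ^ n * Y \<and> Z' = l\<^sup>2 * Z)"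
  unfolding Hit_rel_def Hit_reps_def by simp

lemma Hit_corr_right:
  assumes n: "n \<ge> 1" and rt: "(r, t) \<in> Hit_corr n"
  shows "(r, t') \<in> Hit_corr n \<longleftrightarrow> (t, t') \<in> Hit_rel n"
proof -
  obtain x s1 i j \<xi> \<eta> where r: "r = (x, s1, i, j, \<xi>, \<eta>)" by (cases r)
  obtain u X Y Z where t: "t = (u, X, Y, Z)" by (cases t)
  obtain u' X' Y' Z' where t': "t' = (u', X', Y', Z')" by (cases t')
  obtain N where N: "n = Suc N" using n by (cases n) auto
  obtain c where q: "quad_coords x 0 c u (perp u)" and s1: "s1 = 0" and Z: "Z = c * fst x"
    and reps: "(x, 0, i, j, \<xi>, \<eta>) \<in> LB_reps"
    and X: "X = \<xi> * (sel i u ^ N * sel j (perp u))"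
    and Y: "Y = \<eta> * (sel i u * sel j (perp u) ^ N)"
    using rt unfolding r t Hit_corr_iff N by auto
  show ?thesis
  proof
    assume "(r, t') \<in> Hit_corr n"
    then obtain c' where q': "quad_coords x 0 c' u' (perp u')" and Z': "Z' = c' * fst x"
      and X': "X' = \<xi> * (sel i u' ^ N * sel j (perp u'))"
      and Y': "Y' = \<eta> * (sel i u' * sel j (perp u') ^ N)"
      unfolding r t' Hit_corr_iff N by auto
    obtain l where l: "l \<noteq> 0" "u' = scale2 l u" "c' = l\<^sup>2 * c"
      by (rule quad_coords_cone_same_u[OF q q'])
    show "(t, t') \<in> Hit_rel n"
      unfolding t t' Hit_rel_iff
    proof (intro conjI exI)
      show "X' = l ^ n * X" "Y' = l ^ n * Y" "Z' = l\<^sup>2 * Z"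
        unfolding X X' Y Y' Z Z' l(2,3) perp_scale2 sel_scale2 N by (simp_all add: power_mult_distrib)
    qed (use l quad_coordsD(3)[OF q] in auto)
  next
    assume "(t, t') \<in> Hit_rel n"
    then obtain l where l: "l \<noteq> 0" "u' = scale2 l u"
      "X' = l ^ n * X" "Y' = l ^ n * Y" "Z' = l\<^sup>2 * Z"
      unfolding t t' Hit_rel_iff by blast
    have "quad_coords x 0 (l\<^sup>2 * c) u' (perp u')"
      using quad_coords_scale2[OF q l(1) l(1)] unfolding l(2) perp_scale2 by (simp add: power2_eq_square)
    then show "(r, t') \<in> Hit_corr n"
      unfolding r t' Hit_corr_iff s1 using reps unfolding l(2-5) X Y Z perp_scale2 sel_scale2 N
      by (auto simp add: power_mult_distrib)
  qed
qed

text \<open>For \<open>u\<close> the \<open>j\<close>-th column of the matrix, the factor \<open>c\<close> is the square of \<open>v\<^sub>j\<close> in the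
coordinates where \<open>x2 = u0\<^sup>2\<close> and \<open>x3 = - u1\<^sup>2\<close>.\<close>

lemma quad_coords_cone_unit_col:
  assumes reps: "(x, 0, i, j, \<xi>, \<eta>) \<in> LB_reps"
  shows "quad_coords x 0 (if j then - lin_unit False True x 0 else lin_unit True False x 0)
    (unit_col x 0 j) (perp (unit_col x 0 j))"
proof -
  obtain x0 x1 x2 x3 where x: "x = (x0, x1, x2, x3)" by (cases x)
  have "- (x1 * x1) = x2 * x3"
    using quadric_form_factor[OF LB_reps_quad_reps[OF reps] x] by simp
  then have "x1 * x1 = - (x2 * x3)" by (metis minus_minus)
  moreover have "D2_dom j x 0" using reps unfolding LB_reps_def by blast
  ultimately show ?thesis unfolding x
    by (cases j) (auto simp: quad_coords_expand unit_col_def perp_def)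
qed

lemma Domain_Hit_corr: "Domain (Hit_corr n) = {r \<in> LB_reps. fst (snd r) = 0}"
proof (intro set_eqI iffI)
  fix r :: lb_rep assume r: "r \<in> {r \<in> LB_reps. fst (snd r) = 0}"
  obtain x s' i j \<xi> \<eta> where r': "r = (x, s', i, j, \<xi>, \<eta>)" by (cases r)
  have reps: "(x, 0, i, j, \<xi>, \<eta>) \<in> LB_reps" and s: "s' = 0" using r r' by auto
  obtain c u where "quad_coords x 0 c u (perp u)" using quad_coords_cone_unit_col[OF reps] by blast
  then have "((x, 0, i, j, \<xi>, \<eta>), (u, \<xi> * (sel i u ^ (n - 1) * sel j (perp u)),
      \<eta> * (sel i u * sel j (perp u) ^ (n - 1)), c * fst x)) \<in> Hit_corr n"
    unfolding Hit_corr_iff using reps by blast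
  then show "r \<in> Domain (Hit_corr n)" unfolding r' s by blast
qed (auto simp: Hit_corr_def)

lemma quad_coords_cone_point: "u \<noteq> (0, 0) \<Longrightarrow> quad_coords (cone_point u z) 0 1 u (perp u)"
  using quad_coords_cone[of "cone_point u z" 1 u z] by simp

lemma Hit_corr_cone_point:
  assumes "sel i u \<noteq> 0" "sel j (perp u) \<noteq> 0"
  shows "((cone_point u Z, 0, i, j, X / (sel i u ^ (n - 1) * sel j (perp u)),
      Y / (sel i u * sel j (perp u) ^ (n - 1))), (u, X, Y, Z)) \<in> Hit_corr n"
proof -
  have "quad_coords (cone_point u Z) 0 1 u (perp u)"
    using assms by (intro quad_coords_cone_point) (auto simp: nonzero_sel)
  moreover have "Z = 1 * fst (cone_point u Z)" by (simp add: cone_point_def)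
  ultimately show ?thesis
    unfolding Hit_corr_iff using assms by (auto simp: LB_reps_coords)
qed

lemma Range_Hit_corr: "Range (Hit_corr n) = Hit_reps"
proof (intro set_eqI iffI)
  fix t :: hit_rep assume "t \<in> Hit_reps"
  then obtain u X Y Z where t: "t = (u, X, Y, Z)" "u \<noteq> (0, 0)" unfolding Hit_reps_def by blast
  then obtain i where "sel i u \<noteq> 0" unfolding nonzero_sel by auto
  then have "sel (\<not> i) (perp u) \<noteq> 0" by (cases i) (simp_all add: sel_perp)
  then show "t \<in> Range (Hit_corr n)"
    unfolding t(1) using Hit_corr_cone_point[OF \<open>sel i u \<noteq> 0\<close>] by blast
next
  fix t assume "t \<in> Range (Hit_corr n)"
  then obtain r where "(r, t) \<in> Hit_corr n" by blast
  then show "t \<in> Hit_reps"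
    by (cases r; cases t) (auto simp: Hit_corr_iff Hit_reps_def dest: quad_coordsD(3))
qed

definition Hit_eq :: "nat \<Rightarrow> (nat \<Rightarrow> complex) \<Rightarrow> (nat \<Rightarrow> real) \<Rightarrow> (nat \<Rightarrow> complex) \<Rightarrow> hit_rep \<Rightarrow> bool" where
  "Hit_eq n a b c = (\<lambda>(u, x, y, z). x * y = (\<Prod>i=1..n. z - quadratic2 (a i) (b i) (c i) u))"

lemma Hit_eq_corr:
  assumes n: "n \<ge> 1" and h: "\<And>m l x. h m (scale4 l x) = l * h m x"
    and P: "\<And>m u z. m \<in> {1..n} \<Longrightarrow> h m (cone_point u z) = z - quadratic2 (a m) (b m) (c m) u"
    and rt: "(r, t) \<in> Hit_corr n"
  shows "Z_eq n h r \<longleftrightarrow> Hit_eq n a b c t"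
proof -
  obtain x s1 i j \<xi> \<eta> where r: "r = (x, s1, i, j, \<xi>, \<eta>)" by (cases r)
  obtain u X Y Z where t: "t = (u, X, Y, Z)" by (cases t)
  obtain N where N: "n = Suc N" using n by (cases n) auto
  obtain k where q: "quad_coords x 0 k u (perp u)" and s1: "s1 = 0" and Z: "Z = k * fst x"
    and X: "X = \<xi> * (sel i u ^ N * sel j (perp u))"
    and Y: "Y = \<eta> * (sel i u * sel j (perp u) ^ N)"
    using rt unfolding r t Hit_corr_iff N by auto
  have "X * Y = \<xi> * \<eta> * (sel i u * sel j (perp u)) ^ n"
    unfolding X Y N by (simp add: power_mult_distrib)
  also have "\<dots> = k ^ n * (\<xi> * \<eta> * lin_unit i j x 0 ^ n)"
    unfolding quad_coordsD(1)[OF q] by (simp add: power_mult_distrib)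
  finally have XY: "X * Y = k ^ n * (\<xi> * \<eta> * lin_unit i j x 0 ^ n)" .
  have "cone_point u Z = scale4 k x" using q Z quad_coords_cone by metis
  then have "(\<Prod>m=1..n. Z - quadratic2 (a m) (b m) (c m) u) = (\<Prod>m=1..n. k * h m x)"
    using P h by (intro prod.cong) metis+
  also have "\<dots> = k ^ n * (\<Prod>m=1..n. h m x)" by (simp add: prod.distrib)
  finally show ?thesis
    unfolding r t Hit_eq_def Z_eq_def prod.case s1 XY using quad_coordsD(2)[OF q]
    by simp
qed

lemma Hit_rel_refl: "t \<in> Hit_reps \<Longrightarrow> (t, t) \<in> Hit_rel n"
proof -
  assume "t \<in> Hit_reps"
  moreover obtain u x y z where t: "t = (u, x, y, z)" by (cases t)
  ultimately show ?thesis unfolding t Hit_rel_iff by (intro conjI exI[of _ 1]) (simp_all add: Hit_reps_def)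
qed

lemma Hit_corr_correspondence:
  assumes n: "n \<ge> 1" and h: "\<And>m l x. h m (scale4 l x) = l * h m x"
    and P: "\<And>m u z. m \<in> {1..n} \<Longrightarrow> h m (cone_point u z) = z - quadratic2 (a m) (b m) (c m) u"
  shows "correspondence (LB_rel n) (Hit_rel n) (Hit_corr n) (Z_eq n h) (Hit_eq n a b c)
    (Z_fibre n h 0) (hitchin_variety n a b c)"
proof
  have PQ: "Z_eq n h r \<longleftrightarrow> Hit_eq n a b c t" if "(r, t) \<in> Hit_corr n" for r t
    by (rule Hit_eq_corr[of n h a b c, OF n h P that])
  show "Z_fibre n h 0 = {LB_rel n `` {r} | r. r \<in> Domain (Hit_corr n) \<and> Z_eq n h r}"
    unfolding Domain_Hit_corr Z_fibre_classes[of n h, OF n h] by blast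
  have class_eq: "Hit_eq n a b c t'" if tt': "(t, t') \<in> Hit_rel n" "Hit_eq n a b c t" "t \<in> Hit_reps" for t t'
  proof -
    obtain r where r: "(r, t) \<in> Hit_corr n" using tt'(3) Range_Hit_corr by blast
    show ?thesis using Hit_corr_right[OF n r, of t'] tt' PQ[OF r] PQ[of r t'] by blast
  qed
  have mem: "Hit_rel n `` {t} \<in> hitchin_variety n a b c \<longleftrightarrow> Hit_eq n a b c t" if t: "t \<in> Hit_reps" for t
  proof -
    have "Hit_rel n `` {t} \<in> Hit n" unfolding Hit_def using t by (rule quotientI)
    moreover have "(\<forall>t'\<in>Hit_rel n `` {t}. Hit_eq n a b c t') \<longleftrightarrow> Hit_eq n a b c t"
      using class_eq[OF _ _ t] Hit_rel_refl[OF t, of n] by blast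
    ultimately show ?thesis unfolding hitchin_variety_def mem_Collect_eq Hit_eq_def by simp
  qed
  have "\<exists>t\<in>Hit_reps. p = Hit_rel n `` {t}" if "p \<in> hitchin_variety n a b c" for p
    using that unfolding hitchin_variety_def Hit_def quotient_def by blast
  then show "hitchin_variety n a b c = {Hit_rel n `` {t} | t. t \<in> Range (Hit_corr n) \<and> Hit_eq n a b c t}"
    unfolding Range_Hit_corr using mem by blast
  show "(r, t) \<in> Hit_corr n \<Longrightarrow> Z_eq n h r \<longleftrightarrow> Hit_eq n a b c t" for r t by (rule PQ)
qed (rule Hit_corr_left Hit_corr_right[OF n]; assumption)+

definition Hit_real_rep :: "nat \<Rightarrow> real \<Rightarrow> hit_rep \<Rightarrow> hit_rep" where
  "Hit_real_rep n e = (\<lambda>((u0, u1), x, y, z).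
     ((- cnj u1, cnj u0), - of_real e * cnj y, (- 1) ^ (n - 1) * of_real e * cnj x, - cnj z))"

text \<open>On representatives the square is the scaling of \<open>u\<close> by \<open>-1\<close>, which is trivial on classes.\<close>

lemma Hit_real_rep_twice:
  assumes n: "n \<ge> 1" and e: "e \<in> {1, -1}"
  shows "Hit_real_rep n e (Hit_real_rep n e (u, x, y, z)) = (scale2 (-1) u, (-1) ^ n * x, (-1) ^ n * y, z)"
proof -
  obtain N where N: "n = Suc N" using n by (cases n) auto
  show ?thesis using e unfolding N Hit_real_rep_def by (cases u) auto
qed

lemma cone_point_real:
  "cone_point (- cnj u1, cnj u0) (- cnj z) = scale4 (-1) (quad_real_rep (cone_point (u0, u1) z))"
  by (simp add: cone_point_def)

lemma quad_real_rep_scale4: "quad_real_rep (scale4 l x) = scale4 (cnj l) (quad_real_rep x)"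
  by (cases x) simp

text \<open>Conjugation and exchange of \<open>u\<close> and \<open>v = perp u\<close> replace \<open>u\<close> by the conjugate of \<open>perp u\<close>, which is the
antipodal map; the new \<open>perp\<close> is minus the conjugate of \<open>u\<close>, whence the signs of \<open>Hit_real\<close>.\<close>

lemma Hit_corr_real:
  assumes n: "n \<ge> 1" and e: "e \<in> {1, -1}"
  shows "(LB_real_rep e r, Hit_real_rep n e t) \<in> Hit_corr n \<longleftrightarrow> (r, t) \<in> Hit_corr n"
proof -
  obtain N where N: "n = Suc N" using n by (cases n) auto
  have *: "(LB_real_rep e r, Hit_real_rep n e t) \<in> Hit_corr n" if rt: "(r, t) \<in> Hit_corr n" for r t
  proof -
    obtain x s1 i j \<xi> \<eta> where r: "r = (x, s1, i, j, \<xi>, \<eta>)" by (cases r)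
    obtain u0 u1 X Y Z where t: "t = ((u0, u1), X, Y, Z)" by (metis prod.collapse)
    define u where "u = (u0, u1)"
    define u' where "u' = (- cnj u1, cnj u0)"
    obtain c where q: "quad_coords x 0 c u (perp u)" and s1: "s1 = 0" and Z: "Z = c * fst x"
      and X: "X = \<xi> * (sel i u ^ N * sel j (perp u))"
      and Y: "Y = \<eta> * (sel i u * sel j (perp u) ^ N)"
      using rt unfolding r t Hit_corr_iff N u_def by auto
    have "(LB_real_rep e r) \<in> LB_reps" using rt LB_real_rep_in_reps[OF e] by (auto simp: Hit_corr_def)
    moreover have "quad_coords (quad_real_rep x) 0 (- cnj c) u' (perp u') \<and> - cnj Z = - cnj c * fst (quad_real_rep x)"
    proof -
      have cone: "c \<noteq> 0" "u \<noteq> (0, 0)" "scale4 c x = cone_point u Z"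
        using q Z quad_coords_cone[of x c u Z] by auto
      have "scale4 (- cnj c) (quad_real_rep x) = scale4 (-1) (quad_real_rep (scale4 c x))"
        by (simp add: quad_real_rep_scale4)
      also have "\<dots> = cone_point u' (- cnj Z)"
        unfolding cone(3) u_def u'_def cone_point_real ..
      finally show ?thesis unfolding quad_coords_cone using cone(1,2) by (auto simp: u_def u'_def)
    qed
    moreover have "sel a u' = cnj (sel a (perp u))" "sel a (perp u') = - cnj (sel a u)" for a
      by (simp_all add: u_def u'_def perp_def sel_def)
    ultimately show ?thesis
      unfolding r t s1 LB_real_rep_def Hit_real_rep_def prod.case Hit_corr_iff N u'_def[symmetric] X Y
      by (auto simp: power_minus[of "cnj _"] mult_ac)
  qed
  have "(r, t) \<in> Hit_corr n" if rt: "(LB_real_rep e r, Hit_real_rep n e t) \<in> Hit_corr n"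
  proof -
    have 1: "(r, Hit_real_rep n e (Hit_real_rep n e t)) \<in> Hit_corr n"
      using *[OF rt] unfolding LB_real_rep_twice[OF e] .
    obtain u x y z where t: "t = (u, x, y, z)" by (cases t)
    have "Hit_real_rep n e (Hit_real_rep n e t) \<in> Hit_reps" using 1 Range_Hit_corr by blast
    then have "(Hit_real_rep n e (Hit_real_rep n e t), t) \<in> Hit_rel n"
      unfolding t Hit_real_rep_twice[OF n e] Hit_rel_iff Hit_reps_def
      by (cases u) (auto intro!: exI[of _ "-1"] simp flip: power_mult_distrib mult.assoc)
    then show ?thesis using Hit_corr_right[OF n 1] by blast
  qed
  then show ?thesis using * by blast
qed

text \<open>Normalising \<open>u\<^sub>i = 1\<close> makes the coordinates rational functions with powers of \<open>lin_unit i j\<close> as denominators.\<close>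

lemma LB_Hit_holomorphic:
  assumes corr: "correspondence (LB_rel n) (Hit_rel n) (Hit_corr n) (Z_eq n h) Q (Z_fibre n h 0) U"
    and n: "n \<ge> 1" and h: "\<And>m l x. h m (scale4 l x) = l * h m x"
  shows "holomorphic_map (LB_atlas n) (Z_fibre n h 0) (Hit_atlas n) U (\<lambda>p. Hit_corr n `` p)"
proof (rule correspondence.holomorphic[OF corr])
  fix r t assume rt: "(r, t) \<in> Hit_corr n" and "Z_eq n h r"
  obtain x s' i j \<xi> \<eta> where r: "r = (x, s', i, j, \<xi>, \<eta>)" by (cases r)
  have reps: "(x, s', i, j, \<xi>, \<eta>) \<in> LB_reps" using rt unfolding r Hit_corr_def by auto
  obtain k where k: "k < 4" "coord k x \<noteq> 0" using coord_nonzero[OF LB_reps_nonzero[OF reps]] by blast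
  define D where "D = {w. LB_param k i j w \<in> LB_reps}"
  define \<phi> where "\<phi> = (\<lambda>w. LB_rel n `` {LB_param k i j w})"
  define E where "E = (UNIV :: (complex^4) set)"
  define \<psi> where "\<psi> = (\<lambda>w::complex^4. Hit_rel n `` {(affine2 i (w$1), w$2, w$3, w$4)})"
  define w where "w = LB_chart k x s' \<xi> \<eta>"
  define L where "L = (\<lambda>a b (w::complex^6). lin_unit a b (affine4 k ((w $ 1, w $ 2), w $ 3)) (w $ 4))"
  define W where "W = {w. L i j w \<noteq> 0}"
  define u where "u = (\<lambda>w. affine2 i (L (\<not> i) j w / L i j w))"
  define c where "c = (\<lambda>w. (if j then - L False True w else L True False w) / (L i j w * L i j w))"
  define F where "F = (\<lambda>w. vec4 (L (\<not> i) j w / L i j w) (w $ 5 * sel j (perp (u w)))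
      (w $ 6 * sel j (perp (u w)) ^ (n - 1)) (c w * coord 0 (affine4 k ((w $ 1, w $ 2), w $ 3))))"
  have holo_L: "holo_at (L a b) w" for a b w unfolding L_def by (rule holo_at_affine4)
  have LB: "(D, \<phi>) \<in> LB_atlas n" unfolding D_def \<phi>_def LB_atlas_def using k(1) by blast
  have HI: "(E, \<psi>) \<in> Hit_atlas n" unfolding E_def \<psi>_def Hit_atlas_def by blast
  have w: "w \<in> D" unfolding D_def w_def using LB_chart_at(1)[OF reps k] by simp
  have "(r, LB_param k i j w) \<in> LB_rel n" unfolding r w_def by (rule LB_chart_at(2)[OF reps k])
  then have "(LB_param k i j w, t) \<in> Hit_corr n" using correspondence.left[OF corr rt] by blast
  then have \<phi>w: "\<phi> w = LB_rel n `` {r}"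
    unfolding \<phi>_def using correspondence.image_image_class[OF corr] correspondence.image_class[OF corr] rt
    by metis
  have LD: "L i j z \<noteq> 0" if "z \<in> D" for z
    using that LB_reps_lin_unit unfolding D_def L_def LB_param_def by simp
  have holo_u: "holo_at (\<lambda>w. sel a (u w)) w" if "w \<in> W" for a w
  proof -
    have "holo_at (\<lambda>w. L (\<not> i) j w / L i j w) w"
      using that unfolding W_def by (intro holo_at_divide holo_L) simp
    moreover have "sel a (u w) = (if a = i then 1 else L (\<not> i) j w / L i j w)" for w
      unfolding u_def affine2_def by (cases a; cases i) simp_all
    ultimately show ?thesis using holo_at_const[of 1 w] by (cases "a = i") simp_all
  qed
  have holo_perp: "holo_at (\<lambda>w. sel a (perp (u w))) w" if "w \<in> W" for a w
    unfolding sel_perp by (intro holo_at_if holo_at_uminus holo_u that)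
  have holo_c: "holo_at c w" if "w \<in> W" for w
    using that unfolding c_def W_def by (intro holo_at_divide holo_at_if holo_at_uminus holo_at_mult holo_L) simp
  have "open W" unfolding W_def by (rule open_holo_at_nonzero[OF holo_L])
  moreover have "w \<in> W" unfolding W_def using LD[OF w] by simp
  moreover have "holomorphic_vec_on F W"
    unfolding F_def
  proof (intro holomorphic_vec_onI holo_at_vec4)
    fix w assume w: "w \<in> W"
    show "holo_at (\<lambda>w. L (\<not> i) j w / L i j w) w"
      using w unfolding W_def by (intro holo_at_divide holo_L) simp
  qed (intro holo_at_mult holo_at_power holo_perp holo_c holo_at_affine4 holo_at_coord; assumption)+
  moreover have "F z \<in> E \<and> (\<exists>r t. (r, t) \<in> Hit_corr n \<and> \<phi> z = LB_rel n `` {r} \<and> \<psi> (F z) = Hit_rel n `` {t})"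
    if z: "z \<in> D \<inter> W" and \<phi>: "\<phi> z \<in> Z_fibre n h 0" for z
  proof -
    have reps: "LB_param k i j z \<in> LB_reps" using z unfolding D_def by blast
    have "fst (snd (LB_param k i j z)) = 0"
      using Z_fibre_classD(1)[of n h, OF n h reps] \<phi> unfolding \<phi>_def by blast
    then have z4: "z $ 4 = 0" unfolding LB_param_def by simp
    define x where "x = affine4 k ((z $ 1, z $ 2), z $ 3)"
    have reps': "(x, 0, i, j, z $ 5, z $ 6) \<in> LB_reps"
      using reps unfolding LB_param_def z4 x_def .
    have L: "L a b z = lin_unit a b x 0" for a b unfolding L_def x_def z4 ..
    have nz: "L i j z \<noteq> 0" using z unfolding W_def by blast
    have u: "u z = scale2 (1 / L i j z) (unit_col x 0 j)"
      using nz unfolding u_def unit_col_def L by (cases i) (simp_all add: affine2_def)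
    have "quad_coords x 0 (c z) (u z) (perp (u z))"
      using quad_coords_scale2[OF quad_coords_cone_unit_col[OF reps'], of "1 / L i j z" "1 / L i j z"] nz
      unfolding u perp_scale2 c_def L by (cases j) simp_all
    moreover have "coord 0 x = fst x" by (cases x) simp
    moreover have "sel i (u z) = 1" unfolding u_def by simp
    ultimately have "((x, 0, i, j, z $ 5, z $ 6), (u z, z $ 5 * sel j (perp (u z)),
        z $ 6 * sel j (perp (u z)) ^ (n - 1), c z * coord 0 x)) \<in> Hit_corr n"
      unfolding Hit_corr_iff using reps' by auto
    then have "(LB_param k i j z, (affine2 i (F z$1), F z$2, F z$3, F z$4)) \<in> Hit_corr n"
      unfolding LB_param_def F_def vec4_nth z4 u_def[symmetric] x_def[symmetric] by (simp add: u_def)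
    then show ?thesis unfolding E_def \<phi>_def \<psi>_def by blast
  qed
  ultimately show "\<exists>(D, \<phi>)\<in>LB_atlas n. \<exists>(E, \<psi>)\<in>Hit_atlas n. \<exists>w\<in>D. \<exists>W F.
      \<phi> w = LB_rel n `` {r} \<and> open W \<and> w \<in> W \<and> holomorphic_vec_on F W \<and>
      (\<forall>z\<in>D \<inter> W. \<phi> z \<in> Z_fibre n h 0 \<longrightarrow> F z \<in> E \<and>
        (\<exists>r t. (r, t) \<in> Hit_corr n \<and> \<phi> z = LB_rel n `` {r} \<and> \<psi> (F z) = Hit_rel n `` {t}))"
    apply (intro bexI[OF _ LB], unfold prod.case)
    apply (intro bexI[OF _ HI], unfold prod.case)
    apply (rule bexI[OF _ w])
    using \<phi>w by blast
qed

text \<open>Over \<open>u\<^sub>i = 1\<close> the coordinate of \<open>perp u\<close> with the opposite index is the sign \<open>e\<close>, so the trivialisation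
\<open>(i, \<not> i)\<close> can be used throughout the chart, and the map is polynomial.\<close>

lemma Hit_LB_holomorphic:
  assumes corr: "correspondence (LB_rel n) (Hit_rel n) (Hit_corr n) P Q X U" and n: "n \<ge> 1"
  shows "holomorphic_map (Hit_atlas n) U (LB_atlas n) X (\<lambda>q. (Hit_corr n)\<inverse> `` q)"
proof (rule correspondence.holomorphic[OF correspondence.flip[OF corr]])
  fix t r assume "(t, r) \<in> (Hit_corr n)\<inverse>" and "Q t"
  then have rt: "(r, t) \<in> Hit_corr n" by simp
  obtain u X' Y Z where t: "t = (u, X', Y, Z)" by (cases t)
  have "t \<in> Range (Hit_corr n)" using rt by blast
  then have u: "u \<noteq> (0, 0)" unfolding t Range_Hit_corr Hit_reps_def by simp
  obtain i where i: "sel i u \<noteq> 0" using u unfolding nonzero_sel by blast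
  define j where "j = (\<not> i)"
  define e where "e = (if i then 1 else - 1 :: complex)"
  have e2: "e ^ k * e ^ k = 1" for k
    unfolding e_def by (cases i) (simp_all flip: power_mult_distrib)
  define D where "D = (UNIV :: (complex^4) set)"
  define pt where "pt = (\<lambda>w::complex^4. (affine2 i (w$1), w$2, w$3, w$4))"
  define \<phi> where "\<phi> = (\<lambda>w. Hit_rel n `` {pt w})"
  define w where "w = vec4 (sel (\<not> i) u / sel i u) (X' / sel i u ^ n) (Y / sel i u ^ n) (Z / (sel i u)\<^sup>2)"
  define u' where "u' = (\<lambda>w::complex^4. affine2 i (w $ 1))"
  define x0 x1 x2 x3 where
    "x0 = (\<lambda>w::complex^4. w $ 4)"
    and "x1 = (\<lambda>w. - sel True (u' w) * sel False (u' w))"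
    and "x2 = (\<lambda>w. (sel True (u' w))\<^sup>2)"
    and "x3 = (\<lambda>w. - (sel False (u' w))\<^sup>2)"
  define x where "x = (\<lambda>w. (x0 w, x1 w, x2 w, x3 w))"
  have x: "x w = cone_point (u' w) (w $ 4)" for w
    by (simp add: x_def x0_def x1_def x2_def x3_def cone_point_def)
  have holo_sel: "holo_at (\<lambda>w. sel a (u' w)) w" for a w
    unfolding u'_def affine2_def sel_def by (cases a; cases i; simp add: holo)
  have holo_x: "holo_at x0 w" "holo_at x1 w" "holo_at x2 w" "holo_at x3 w" for w
    unfolding x0_def x1_def x2_def x3_def
    by (intro holo_at_coord holo_at_uminus holo_at_mult holo_at_power holo_sel)+
  define \<xi> \<eta> where "\<xi> = (\<lambda>w::complex^4. e * w $ 2)" and "\<eta> = (\<lambda>w::complex^4. e ^ (n - 1) * w $ 3)"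
  have holo_xi: "holo_at \<xi> w" "holo_at \<eta> w" for w
    unfolding \<xi>_def \<eta>_def by (intro holo_at_mult holo_at_const holo_at_coord)+
  have sel: "sel i (u' z) = 1" "sel j (perp (u' z)) = e" for z
    unfolding j_def sel_perp_Not unfolding u'_def e_def by simp_all
  have C: "((x z, 0, i, j, \<xi> z, \<eta> z), pt z) \<in> Hit_corr n" for z
  proof -
    have "((cone_point (u' z) (z $ 4), 0, i, j, z $ 2 / (sel i (u' z) ^ (n - 1) * sel j (perp (u' z))),
      z $ 3 / (sel i (u' z) * sel j (perp (u' z)) ^ (n - 1))), (u' z, z $ 2, z $ 3, z $ 4)) \<in> Hit_corr n"
      by (rule Hit_corr_cone_point; unfold sel) (simp_all add: e_def)
    moreover have "z $ 2 / e = \<xi> z" "z $ 3 / e ^ (n - 1) = \<eta> z"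
      unfolding \<xi>_def \<eta>_def using e2[of 1] e2[of "n - 1"] by (simp_all add: divide_eq_eq e_def mult_ac)
    moreover have "pt z = (u' z, z $ 2, z $ 3, z $ 4)" by (simp add: pt_def u'_def)
    ultimately show ?thesis unfolding x by (simp add: sel)
  qed
  have reps: "(x z, 0, i, j, \<xi> z, \<eta> z) \<in> LB_reps" for z
    using C[of z] unfolding pt_def Hit_corr_iff by blast
  have "\<exists>(E, \<psi>)\<in>LB_atlas n. \<exists>W F. open W \<and> w \<in> W \<and> holomorphic_vec_on F W \<and>
    (\<forall>z\<in>W. (x z, 0, i, j, \<xi> z, \<eta> z) \<in> LB_reps \<longrightarrow>
       F z \<in> E \<and> (\<exists>r. ((x z, 0, i, j, \<xi> z, \<eta> z), r) \<in> LB_rel n \<and> \<psi> (F z) = LB_rel n `` {r}))"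
    by (rule holomorphic_into_LB[OF holo_x holo_xi x_def LB_reps_nonzero[OF reps]])
  then obtain E \<psi> W F where LB: "(E, \<psi>) \<in> LB_atlas n" and W: "open W" "w \<in> W" "holomorphic_vec_on F W" and
    F: "\<And>z. z \<in> W \<Longrightarrow> F z \<in> E \<and> (\<exists>r. ((x z, 0, i, j, \<xi> z, \<eta> z), r) \<in> LB_rel n \<and> \<psi> (F z) = LB_rel n `` {r})"
    using reps by blast
  have HI: "(D, \<phi>) \<in> Hit_atlas n" unfolding D_def \<phi>_def Hit_atlas_def pt_def by blast
  have "(t, pt w) \<in> Hit_rel n"
    unfolding t pt_def w_def vec4_nth affine2_ratio[OF i] Hit_rel_iff
    using u i by (intro conjI exI[of _ "1 / sel i u"]) (simp_all add: power_divide)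
  then have "(r, pt w) \<in> Hit_corr n" using correspondence.right[OF corr rt] by blast
  then have \<phi>w: "\<phi> w = Hit_rel n `` {t}"
    unfolding \<phi>_def using correspondence.image_class[OF corr] rt by metis
  have "F z \<in> E \<and> (\<exists>t r. (t, r) \<in> (Hit_corr n)\<inverse> \<and> \<phi> z = Hit_rel n `` {t} \<and> \<psi> (F z) = LB_rel n `` {r})"
    if "z \<in> W" for z
  proof -
    obtain r where r: "((x z, 0, i, j, \<xi> z, \<eta> z), r) \<in> LB_rel n" "\<psi> (F z) = LB_rel n `` {r}" "F z \<in> E"
      using F[OF \<open>z \<in> W\<close>] by blast
    have "(r, pt z) \<in> Hit_corr n" using correspondence.left[OF corr C] r(1) by blast
    then show ?thesis using r(2,3) unfolding \<phi>_def by blast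
  qed
  moreover have "w \<in> D" unfolding D_def by simp
  ultimately show "\<exists>(D, \<phi>)\<in>Hit_atlas n. \<exists>(E, \<psi>)\<in>LB_atlas n. \<exists>w\<in>D. \<exists>W F.
      \<phi> w = Hit_rel n `` {t} \<and> open W \<and> w \<in> W \<and> holomorphic_vec_on F W \<and>
      (\<forall>z\<in>D \<inter> W. \<phi> z \<in> U \<longrightarrow> F z \<in> E \<and>
        (\<exists>t r. (t, r) \<in> (Hit_corr n)\<inverse> \<and> \<phi> z = Hit_rel n `` {t} \<and> \<psi> (F z) = LB_rel n `` {r}))"
    apply (intro bexI[OF _ HI], unfold prod.case)
    apply (intro bexI[OF _ LB], unfold prod.case)
    apply (rule bexI[where x = w])
    using \<phi>w W by blast+
qed

theorem zero_fibre_biholomorphic: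
  assumes n: "n \<ge> 1" and h: "\<And>m l x. h m (scale4 l x) = l * h m x"
    and P: "\<And>m u z. m \<in> {1..n} \<Longrightarrow> h m (cone_point u z) = z - quadratic2 (a m) (b m) (c m) u"
  shows "\<exists>f. biholomorphic_map (LB_atlas n) (Z_fibre n h 0) (Hit_atlas n) (hitchin_variety n a b c) f \<and>
    (\<forall>e\<in>{1, -1}. \<forall>p\<in>Z_fibre n h 0. f (LB_real e p) = Hit_real n e (f p))"
proof -
  interpret correspondence "LB_rel n" "Hit_rel n" "Hit_corr n" "Z_eq n h" "Hit_eq n a b c"
      "Z_fibre n h 0" "hitchin_variety n a b c"
    by (rule Hit_corr_correspondence[of n h, OF n h P])
  have "biholomorphic_map (LB_atlas n) (Z_fibre n h 0) (Hit_atlas n) (hitchin_variety n a b c)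
      (\<lambda>p. Hit_corr n `` p)"
    by (rule biholomorphic[OF LB_Hit_holomorphic[of n h, OF correspondence_axioms n h]
        Hit_LB_holomorphic[OF correspondence_axioms n]])
  moreover have "Hit_corr n `` LB_real e p = Hit_real n e (Hit_corr n `` p)"
    if e: "e \<in> {1, -1}" and p: "p \<in> Z_fibre n h 0" for e p
  proof -
    have "surj (LB_real_rep e)" using LB_real_rep_twice[OF e] by (metis surjI)
    moreover have "surj (Hit_real_rep n e)"
    proof (rule surjI)
      fix t :: hit_rep
      obtain u x y z where t: "t = (u, x, y, z)" by (cases t)
      show "Hit_real_rep n e (Hit_real_rep n e (Hit_real_rep n e (Hit_real_rep n e t))) = t"
        unfolding t Hit_real_rep_twice[OF n e] by (cases u) (simp flip: power_mult_distrib mult.assoc)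
    qed
    ultimately show ?thesis
      using equivariant[OF _ _ Hit_corr_real[OF n e] p]
      unfolding LB_real_def Hit_real_def LB_real_rep_def Hit_real_rep_def by blast
  qed
  ultimately show ?thesis by blast
qed

section \<open>Curves of bidegree (1,1)\<close>

lemma bideg11_scale2: "bideg11 a b c d (scale2 l u, scale2 m v) = l * m * bideg11 a b c d (u, v)"
  by (cases u; cases v) (simp add: algebra_simps)

lemma Q_rel_iff: "((u, v), (u', v')) \<in> Q_rel \<longleftrightarrow>
   (u, v) \<in> Q_reps \<and> (\<exists>l m. l \<noteq> 0 \<and> m \<noteq> 0 \<and> u' = scale2 l u \<and> v' = scale2 m v)"
  unfolding Q_rel_def by simp

lemma Q_rel_refl: "(u, v) \<in> Q_reps \<Longrightarrow> ((u, v), (u, v)) \<in> Q_rel"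
  unfolding Q_rel_iff by (intro conjI exI[of _ 1]) simp_all

lemma class_in_curve11:
  assumes "(u, v) \<in> Q_reps"
  shows "Q_rel `` {(u, v)} \<in> curve11 a b c d \<longleftrightarrow> bideg11 a b c d (u, v) = 0"
proof -
  have "Q_rel `` {(u, v)} \<in> Q_surf" unfolding Q_surf_def using assms by (rule quotientI)
  moreover have "bideg11 a b c d r = 0" if "((u, v), r) \<in> Q_rel" "bideg11 a b c d (u, v) = 0" for r
    using that by (cases r) (auto simp: Q_rel_iff bideg11_scale2)
  ultimately show ?thesis using Q_rel_refl[OF assms] unfolding curve11_def by blast
qed

lemma curve11_class:
  assumes "p \<in> curve11 a b c d"
  obtains u v where "(u, v) \<in> Q_reps" "p = Q_rel `` {(u, v)}" "bideg11 a b c d (u, v) = 0"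
proof -
  have "p \<in> Q_surf" using assms unfolding curve11_def by blast
  then obtain u v where uv: "(u, v) \<in> Q_reps" "p = Q_rel `` {(u, v)}"
    unfolding Q_surf_def quotient_def by auto
  with that show thesis using assms class_in_curve11[OF uv(1)] by blast
qed

lemma bideg11_deriv:
  "deriv (\<lambda>t. bideg11 a b c d ((t, u1), (v0, v1))) u0 = of_real a * v0 + b * v1"
  "deriv (\<lambda>t. bideg11 a b c d ((u0, t), (v0, v1))) u1 = c * v0 + of_real d * v1"
  "deriv (\<lambda>t. bideg11 a b c d ((u0, u1), (t, v1))) v0 = of_real a * u0 + c * u1"
  "deriv (\<lambda>t. bideg11 a b c d ((u0, u1), (v0, t))) v1 = b * u0 + of_real d * u1"
  by (rule DERIV_imp_deriv, auto intro!: derivative_eq_intros)+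

lemma kernel_2x2:
  fixes a b c d :: complex
  assumes "a * d = b * c"
  obtains v0 v1 where "(v0, v1) \<noteq> (0, 0)" "a * v0 + b * v1 = 0" "c * v0 + d * v1 = 0"
proof (cases "a = 0 \<and> b = 0")
  case True
  show ?thesis
  proof (cases "c = 0 \<and> d = 0")
    case True then show ?thesis using \<open>a = 0 \<and> b = 0\<close> that[of 1 0] by simp
  next
    case False then show ?thesis using \<open>a = 0 \<and> b = 0\<close> that[of d "- c"] by (auto simp: mult.commute)
  qed
next
  case False then show ?thesis using assms that[of b "- a"] by (auto simp: mult.commute)
qed

text \<open>The form is \<open>u\<^sup>T M v\<close> with partial derivatives \<open>M v\<close> and \<open>M\<^sup>T u\<close>: a singular point is a pair of kernel
vectors.\<close>

lemma smooth11_iff: "smooth11 a b c d \<longleftrightarrow> of_real a * of_real d \<noteq> b * c"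
proof
  assume smooth: "smooth11 a b c d"
  show "of_real a * of_real d \<noteq> b * c"
  proof
    assume det: "of_real a * of_real d = b * c"
    obtain v0 v1 where v: "(v0, v1) \<noteq> (0, 0)" "of_real a * v0 + b * v1 = 0" "c * v0 + of_real d * v1 = 0"
      using kernel_2x2[OF det] by blast
    obtain u0 u1 where u: "(u0, u1) \<noteq> (0, 0)" "of_real a * u0 + c * u1 = 0" "b * u0 + of_real d * u1 = 0"
      using kernel_2x2[of "of_real a" "of_real d" c b] det by (metis mult.commute)
    have "bideg11 a b c d ((u0, u1), (v0, v1)) = u0 * (of_real a * v0 + b * v1) + u1 * (c * v0 + of_real d * v1)"
      by (simp add: algebra_simps)
    then have "bideg11 a b c d ((u0, u1), (v0, v1)) = 0" unfolding v(2,3) by simp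
    then show False using smooth u v unfolding smooth11_def bideg11_deriv Q_reps_def by blast
  qed
next
  assume det: "of_real a * of_real d \<noteq> b * c"
  have "v0 = 0 \<and> v1 = 0" if "of_real a * v0 + b * v1 = 0" "c * v0 + of_real d * v1 = 0" for v0 v1
  proof -
    have "(of_real a * of_real d - b * c) * v0 =
        of_real d * (of_real a * v0 + b * v1) - b * (c * v0 + of_real d * v1)"
      "(of_real a * of_real d - b * c) * v1 =
        of_real a * (c * v0 + of_real d * v1) - c * (of_real a * v0 + b * v1)"
      by (simp_all add: algebra_simps)
    then show ?thesis using det unfolding that by simp
  qed
  then show "smooth11 a b c d" unfolding smooth11_def bideg11_deriv Q_reps_def by blast
qed

text \<open>If \<open>M\<close> is invertible, its curve is a graph over the first factor: each \<open>u\<close> has the unique zero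
\<open>v = (b u0 + d u1, - a u0 - c u1)\<close>. Inserting it into the second form gives a quadratic form in \<open>u\<close> that vanishes
identically; with \<open>J\<close> the standard alternating matrix this says that \<open>M' J M\<^sup>T\<close> is alternating, hence a multiple of
\<open>J\<close>. The same holds for \<open>M J M\<^sup>T = det M J\<close>, so \<open>M'\<close> is a multiple of \<open>M\<close>.\<close>

lemma curve11_subset_imp_proportional:
  assumes det: "of_real a * of_real d \<noteq> b * c" and sub: "curve11 a b c d \<subseteq> curve11 a' b' c' d'"
  obtains k where "of_real a' = k * of_real a" "b' = k * b" "c' = k * c" "of_real d' = k * of_real d"
proof -
  define A D A' D' where "A = complex_of_real a" and "D = complex_of_real d"
    and "A' = complex_of_real a'" and "D' = complex_of_real d'"
  have det': "A * D - b * c \<noteq> 0" using det unfolding A_def D_def by simp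
  have *: "(A' * u0 + c' * u1) * (b * u0 + D * u1) = (b' * u0 + D' * u1) * (A * u0 + c * u1)"
    if u: "(u0, u1) \<noteq> (0, 0)" for u0 u1
  proof -
    \<comment> \<open>The only point of the curve over \<open>u\<close>.\<close>
    define v0 v1 where "v0 = b * u0 + D * u1" and "v1 = - (A * u0 + c * u1)"
    have "(v0, v1) \<noteq> (0, 0)"
    proof
      assume "(v0, v1) = (0, 0)"
      moreover have "(A * D - b * c) * u0 = - D * v1 - c * v0" "(A * D - b * c) * u1 = A * v0 + b * v1"
        unfolding v0_def v1_def by (simp_all add: algebra_simps)
      ultimately show False using det' u by simp
    qed
    then have reps: "((u0, u1), (v0, v1)) \<in> Q_reps" using u unfolding Q_reps_def by blast
    have "bideg11 a b c d ((u0, u1), (v0, v1)) = 0"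
      unfolding v0_def v1_def A_def D_def by (simp add: algebra_simps)
    then have "bideg11 a' b' c' d' ((u0, u1), (v0, v1)) = 0"
      using sub class_in_curve11[OF reps] by blast
    then show ?thesis
      unfolding v0_def v1_def A_def D_def A'_def D'_def by (simp add: algebra_simps)
  qed
  have 1: "A' * b = b' * A" using *[of 1 0] by simp
  have 2: "c' * D = D' * c" using *[of 0 1] by simp
  have 3: "A' * D + c' * b = b' * c + D' * A" using *[of 1 1] 1 2 by (simp add: algebra_simps)
  define t where "t = A' * D - b' * c"
  have "A' * (A * D - b * c) = t * A" "b' * (A * D - b * c) = t * b"
      "c' * (A * D - b * c) = t * c" "D' * (A * D - b * c) = t * D"
    using 1 2 3 unfolding t_def by algebra+
  then show thesis
    using det' that[of "t / (A * D - b * c)"] unfolding A_def D_def A'_def D'_def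
    by (simp add: field_simps)
qed

text \<open>Completing the square: \<open>a\<close> times the form is \<open>\<bar>a u0 + c u1\<bar>\<^sup>2 + (a d - \<bar>c\<bar>\<^sup>2) \<bar>u1\<bar>\<^sup>2\<close>.\<close>

lemma hermitian_form_definite:
  assumes pos: "(cmod c)\<^sup>2 < a * d" and zero: "bideg11 a (cnj c) c d (u, cnj2 u) = 0"
  shows "u = (0, 0)"
proof -
  obtain u0 u1 where u: "u = (u0, u1)" by (cases u)
  have norm: "complex_of_real ((cmod z)\<^sup>2) = z * cnj z" for z by (rule complex_norm_square)
  have "of_real a * bideg11 a (cnj c) c d (u, cnj2 u) =
      (of_real a * u0 + c * u1) * cnj (of_real a * u0 + c * u1) + (of_real (a * d) - c * cnj c) * (u1 * cnj u1)"
    unfolding u by (simp add: algebra_simps)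
  also have "\<dots> = complex_of_real ((cmod (of_real a * u0 + c * u1))\<^sup>2 + (a * d - (cmod c)\<^sup>2) * (cmod u1)\<^sup>2)"
    unfolding of_real_add of_real_mult of_real_diff norm ..
  finally have "(cmod (of_real a * u0 + c * u1))\<^sup>2 + (a * d - (cmod c)\<^sup>2) * (cmod u1)\<^sup>2 = 0"
    unfolding zero by (metis mult_zero_right of_real_eq_0_iff)
  moreover have "0 \<le> (a * d - (cmod c)\<^sup>2) * (cmod u1)\<^sup>2" using pos by simp
  ultimately have "(a * d - (cmod c)\<^sup>2) * (cmod u1)\<^sup>2 = 0" "(cmod (of_real a * u0 + c * u1))\<^sup>2 = 0"
    using zero_le_power2[of "cmod (of_real a * u0 + c * u1)"] by linarith+
  then have "u1 = 0" "of_real a * u0 + c * u1 = 0" using pos by auto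
  moreover have "a \<noteq> 0" using pos by (auto simp: not_less)
  ultimately show ?thesis unfolding u by simp
qed

text \<open>A real point has the form \<open>(u, cnj u)\<close>, and there the equation is the hermitian form.\<close>

lemma definite_curve11_no_real_points:
  assumes pos: "(cmod c)\<^sup>2 < a * d" and p: "p \<in> curve11 a (cnj c) c d"
  shows "sigma p \<noteq> p"
proof
  assume "sigma p = p"
  obtain u v where uv: "(u, v) \<in> Q_reps" "p = Q_rel `` {(u, v)}" "bideg11 a (cnj c) c d (u, v) = 0"
    using curve11_class[OF p] by blast
  have "(u, v) \<in> p" using Q_rel_refl[OF uv(1)] uv(2) by blast
  then have "(cnj2 v, cnj2 u) \<in> p" using \<open>sigma p = p\<close> unfolding sigma_def by force
  then obtain m where "m \<noteq> 0" "cnj2 u = scale2 m v" unfolding uv(2) by (auto simp: Q_rel_iff)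
  then have "bideg11 a (cnj c) c d (u, cnj2 u) = 0"
    using bideg11_scale2[of a "cnj c" c d 1 u m v] uv(3) by simp
  then show False using hermitian_form_definite[OF pos] uv(1) unfolding Q_reps_def by blast
qed

section \<open>Hyperplane sections\<close>

lemma hplane_scale4: "hplane \<beta> \<gamma> (scale4 l x) = l * hplane \<beta> \<gamma> x"
  by (cases x) (simp add: algebra_simps)

text \<open>In the coordinates of \<open>Q\<close> a plane section is a LeBrun curve whose outer coefficients add up to \<open>1 / s\<close>. This sum
normalises the equation: it rules out a nontrivial constant factor between two of them.\<close>

lemma hplane_segre:
  assumes "s \<noteq> 0"
  shows "hplane \<beta> \<gamma> (segre (of_real s) (u, v)) =
    bideg11 ((1 / s - \<beta>) / 2) (- \<gamma>) (- cnj \<gamma>) ((1 / s + \<beta>) / 2) (u, v)"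
  using assms by (cases u; cases v) (simp add: field_simps)

lemma hplane_cone_point:
  "hplane \<beta> \<gamma> (cone_point u z) = z - quadratic2 \<gamma> (- \<beta> / 2) (- cnj \<gamma>) u"
  by (cases u) (simp add: cone_point_def algebra_simps)

text \<open>The right side is \<open>(1 / s\<^sup>2 - \<beta>\<^sup>2) / 4\<close>, and \<open>\<bar>s\<bar> \<le> 1\<close> bounds it from below by its value at \<open>s = 1\<close>, which the ball
condition controls.\<close>

lemma hplane_section_definite:
  fixes s \<beta> :: real
  assumes "s \<noteq> 0" "\<bar>s\<bar> \<le> 1" "\<beta>\<^sup>2 + 4 * (cmod \<gamma>)\<^sup>2 < 1"
  shows "(cmod (- cnj \<gamma>))\<^sup>2 < ((1 / s - \<beta>) / 2) * ((1 / s + \<beta>) / 2)"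
proof -
  have "s\<^sup>2 \<le> 1" using assms(2) by (simp add: abs_square_le_1)
  then have "1 \<le> (1 / s)\<^sup>2" using assms(1) by (simp add: power_divide)
  moreover have "((1 / s - \<beta>) / 2) * ((1 / s + \<beta>) / 2) = ((1 / s)\<^sup>2 - \<beta>\<^sup>2) / 4"
    by (simp add: power2_eq_square algebra_simps)
  ultimately show ?thesis using assms(3) by simp
qed

lemma curve11_in_plane_section:
  assumes "quad_ident 1 ` curve11 a b c d = plane_section \<beta> \<gamma> 1"
  shows "curve11 a b c d \<subseteq> curve11 ((1 - \<beta>) / 2) (- \<gamma>) (- cnj \<gamma>) ((1 + \<beta>) / 2)"
proof
  fix p assume p: "p \<in> curve11 a b c d"
  obtain u v where uv: "(u, v) \<in> Q_reps" "p = Q_rel `` {(u, v)}"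
    using curve11_class[OF p] by blast
  have "quad_coords (segre 1 (u, v)) 1 1 u v"
    using uv(1) unfolding Q_reps_def by (intro quad_coords_segre) auto
  then have "(segre 1 (u, v), 1) \<in> quad_reps"
    using quad_coords_imp_quad0_reps unfolding quad0_reps_def by blast
  then have "((segre 1 (u, v), 1), (segre 1 (u, v), 1)) \<in> quad_rel"
    unfolding quad_rel_def by (auto intro!: exI[of _ 1] simp del: segre.simps)
  moreover have "(u, v) \<in> p" using Q_rel_refl[OF uv(1)] uv(2) by blast
  ultimately have "(segre 1 (u, v), 1) \<in> quad_ident 1 p" unfolding quad_ident_def by blast
  moreover have "quad_ident 1 p \<in> plane_section \<beta> \<gamma> 1" using assms p by blast
  ultimately have "hplane \<beta> \<gamma> (segre 1 (u, v)) = 0" unfolding plane_section_def by blast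
  then show "p \<in> curve11 ((1 - \<beta>) / 2) (- \<gamma>) (- cnj \<gamma>) ((1 + \<beta>) / 2)"
    unfolding uv(2) class_in_curve11[OF uv(1)] using hplane_segre[of 1 \<beta> \<gamma> u v] by simp
qed

text \<open>The factor is real because it is determined by the outer coefficients, which are real and for the plane section
add up to \<open>1\<close>.\<close>

lemma plane_section_equation:
  assumes smooth: "smooth11 a b c d" and sec: "quad_ident 1 ` curve11 a b c d = plane_section \<beta> \<gamma> 1"
  shows "a + d \<noteq> 0"
    "bideg11 a b c d (u, v) = of_real (a + d) * hplane \<beta> \<gamma> (segre 1 (u, v))"
proof -
  obtain k where k: "of_real ((1 - \<beta>) / 2) = k * of_real a" "- \<gamma> = k * b" "- cnj \<gamma> = k * c"
      "of_real ((1 + \<beta>) / 2) = k * of_real d"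
    using curve11_subset_imp_proportional[OF _ curve11_in_plane_section[OF sec]] smooth
    unfolding smooth11_iff by blast
  have "k * of_real (a + d) = of_real ((1 - \<beta>) / 2) + of_real ((1 + \<beta>) / 2)"
    unfolding k(1,4) by (simp add: algebra_simps)
  also have "\<dots> = of_real ((1 - \<beta>) / 2 + (1 + \<beta>) / 2)" by (simp only: of_real_add)
  also have "(1 - \<beta>) / 2 + (1 + \<beta>) / 2 = 1" by (simp add: field_simps)
  finally have 1: "k * of_real (a + d) = 1" by simp
  then show "a + d \<noteq> 0" by (metis mult_zero_right of_real_0 zero_neq_one)
  have "hplane \<beta> \<gamma> (segre 1 (u, v)) = k * bideg11 a b c d (u, v)"
  proof -
    obtain u0 u1 v0 v1 where uv: "u = (u0, u1)" "v = (v0, v1)" by (cases u; cases v)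
    have "hplane \<beta> \<gamma> (segre 1 (u, v)) = bideg11 ((1 - \<beta>) / 2) (- \<gamma>) (- cnj \<gamma>) ((1 + \<beta>) / 2) (u, v)"
      using hplane_segre[of 1 \<beta> \<gamma> u v] by (simp only: of_real_1 div_by_1 one_neq_zero simp_thms)
    also have "\<dots> = k * bideg11 a b c d (u, v)"
      unfolding uv bideg11.simps k by (simp add: algebra_simps)
    finally show ?thesis .
  qed
  then show "bideg11 a b c d (u, v) = of_real (a + d) * hplane \<beta> \<gamma> (segre 1 (u, v))"
    using 1 by (metis mult.assoc mult.commute mult_1)
qed

theorem theorem4p3:
  fixes n :: nat and a d \<beta> :: "nat \<Rightarrow> real" and b c \<gamma> :: "nat \<Rightarrow> complex" and \<epsilon> :: real
    and h :: "nat \<Rightarrow> hom4 \<Rightarrow> complex"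
  assumes n: "n \<ge> 1"
    and eps: "\<epsilon> \<in> {1, -1}"
    and lebrun: "lebrun_data n a b c d"
    and h: "\<And>i. h i = hplane (\<beta> i) (\<gamma> i)"
    and ball: "\<And>i. i \<in> {1..n} \<Longrightarrow> (\<beta> i)\<^sup>2 + 4 * (cmod (\<gamma> i))\<^sup>2 < 1"
    and sections: "\<And>i. i \<in> {1..n} \<Longrightarrow>
      quad_ident 1 ` curve11 (a i) (b i) (c i) (d i) = plane_section (\<beta> i) (\<gamma> i) 1"
  shows
    "(\<exists>U f. zariski_open_in (PE_atlas n) (lebrun_model n a b c d) U \<and>
        biholomorphic_map (LB_atlas n) (Z_fibre n h 1) (PE_atlas n) U f \<and>
        (sign_normalised n a b c d \<longrightarrow>
          (\<forall>p\<in>Z_fibre n h 1. f (LB_real \<epsilon> p) = PE_real \<epsilon> (f p))))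
     \<and> (\<forall>s::real. s \<noteq> 0 \<and> \<bar>s\<bar> \<le> 1 \<longrightarrow>
        (\<exists>a' b' c' d' U f. lebrun_data n a' b' c' d' \<and>
          zariski_open_in (PE_atlas n) (lebrun_model n a' b' c' d') U \<and>
          biholomorphic_map (LB_atlas n) (Z_fibre n h (of_real s)) (PE_atlas n) U f \<and>
          (\<forall>p\<in>Z_fibre n h (of_real s). f (LB_real \<epsilon> p) = PE_real \<epsilon> (f p))))
     \<and> (\<exists>A B C f. hitchin_data n A B C \<and>
          biholomorphic_map (LB_atlas n) (Z_fibre n h 0) (Hit_atlas n) (hitchin_variety n A B C) f \<and>
          (\<forall>p\<in>Z_fibre n h 0. f (LB_real \<epsilon> p) = Hit_real n \<epsilon> (f p)))"
proof -
  have hom: "h m (scale4 l x) = l * h m x" for m l x unfolding h by (rule hplane_scale4)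
  have smooth: "smooth11 (a m) (b m) (c m) (d m)" if "m \<in> {1..n}" for m
    using lebrun that unfolding lebrun_data_def by blast
  define \<kappa> where "\<kappa> = (\<lambda>m. a m + d m)"
  have \<kappa>: "\<kappa> m \<noteq> 0" "bideg11 (a m) (b m) (c m) (d m) (u, v) = of_real (\<kappa> m) * h m (segre 1 (u, v))"
    if "m \<in> {1..n}" for m u v
    unfolding \<kappa>_def h using plane_section_equation[OF smooth[OF that] sections[OF that]] by auto
  \<comment> \<open>Distinct curves come from distinct planes; this makes the curves over other \<open>s\<close> and the quadratic
    polynomials over \<open>s = 0\<close> distinct.\<close>
  have planes_inj: "m = m'" if m: "m \<in> {1..n}" "m' \<in> {1..n}" and "\<beta> m = \<beta> m'" "\<gamma> m = \<gamma> m'" for m m'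
  proof -
    have "h m = h m'" unfolding h using that by simp
    then have "bideg11 (a m) (b m) (c m) (d m) r = 0 \<longleftrightarrow> bideg11 (a m') (b m') (c m') (d m') r = 0" for r
      by (cases r) (simp only: \<kappa>(2)[OF m(1)] \<kappa>(2)[OF m(2)] \<open>h m = h m'\<close> mult_eq_0_iff of_real_eq_0_iff
          \<kappa>(1)[OF m(1)] \<kappa>(1)[OF m(2)])
    then have "curve11 (a m) (b m) (c m) (d m) = curve11 (a m') (b m') (c m') (d m')"
      unfolding curve11_def by simp
    then show ?thesis using lebrun m unfolding lebrun_data_def inj_on_def by blast
  qed

  have part1: "\<exists>U f. zariski_open_in (PE_atlas n) (lebrun_model n a b c d) U \<and>
        biholomorphic_map (LB_atlas n) (Z_fibre n h 1) (PE_atlas n) U f \<and>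
        (sign_normalised n a b c d \<longrightarrow>
          (\<forall>p\<in>Z_fibre n h 1. f (LB_real \<epsilon> p) = PE_real \<epsilon> (f p)))"
  proof -
    define K where "K = (\<Prod>m=1..n. \<kappa> m)"
    define \<mu> where "\<mu> = csqrt (of_real K)"
    have "K \<noteq> 0" unfolding K_def using \<kappa>(1) by simp
    then have \<mu>: "\<mu> \<noteq> 0" unfolding \<mu>_def by simp
    have \<mu>2: "\<mu>\<^sup>2 = (\<Prod>m=1..n. complex_of_real (\<kappa> m))" unfolding \<mu>_def K_def by simp
    \<comment> \<open>At the real point \<open>u = (1, 0)\<close> every plane section has the positive value \<open>(1 - \<beta> m) / 2\<close>, so the sign of
      the product of the given equations is the sign of \<open>K\<close>.\<close>
    have real: "cnj \<mu> = \<mu>" if "sign_normalised n a b c d"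
    proof -
      have "0 < Re (\<Prod>m=1..n. bideg11 (a m) (b m) (c m) (d m) ((1, 0), cnj2 (1, 0)))"
        by (rule that[unfolded sign_normalised_def, rule_format]) simp
      also have "(\<Prod>m=1..n. bideg11 (a m) (b m) (c m) (d m) ((1, 0), cnj2 (1, 0))) =
          (\<Prod>m=1..n. complex_of_real (\<kappa> m * ((1 - \<beta> m) / 2)))"
      proof (rule prod.cong[OF refl])
        fix m assume "m \<in> {1..n}"
        show "bideg11 (a m) (b m) (c m) (d m) ((1, 0), cnj2 (1, 0)) = complex_of_real (\<kappa> m * ((1 - \<beta> m) / 2))"
          unfolding \<kappa>(2)[OF \<open>m \<in> {1..n}\<close>] h by (simp add: algebra_simps)
      qed
      also have "Re \<dots> = K * (\<Prod>m=1..n. (1 - \<beta> m) / 2)"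
        unfolding K_def by (simp only: of_real_prod[symmetric] Re_complex_of_real prod.distrib)
      finally have "0 < K * (\<Prod>m=1..n. (1 - \<beta> m) / 2)" .
      moreover have "0 < (\<Prod>m=1..n. (1 - \<beta> m) / 2)"
      proof (rule prod_pos)
        fix m assume "m \<in> {1..n}"
        then have "(\<beta> m)\<^sup>2 < 1" using ball[of m] zero_le_power2[of "cmod (\<gamma> m)"] by linarith
        then show "0 < (1 - \<beta> m) / 2" by (simp add: abs_square_less_1)
      qed
      ultimately have "0 < K" by (simp add: zero_less_mult_iff)
      then show ?thesis unfolding \<mu>_def by (simp add: csqrt_of_real_nonneg)
    qed
    have "\<exists>U f. zariski_open_in (PE_atlas n) (lebrun_model n a b c d) U \<and>
        biholomorphic_map (LB_atlas n) (Z_fibre n h 1) (PE_atlas n) U f \<and>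
        (cnj 1 = (1::complex) \<longrightarrow> cnj \<mu> = \<mu> \<longrightarrow>
          (\<forall>e\<in>{1, -1}. \<forall>p\<in>Z_fibre n h 1. f (LB_real e p) = PE_real e (f p)))"
      by (rule nonzero_fibre_biholomorphic[of 1 \<mu> n h a b c d "\<lambda>m. of_real (\<kappa> m)",
            OF one_neq_zero \<mu> n hom \<kappa>(2) \<mu>2])
    then show ?thesis using real eps complex_cnj_one by blast
  qed

  have part2: "\<exists>a' b' c' d' U f. lebrun_data n a' b' c' d' \<and>
          zariski_open_in (PE_atlas n) (lebrun_model n a' b' c' d') U \<and>
          biholomorphic_map (LB_atlas n) (Z_fibre n h (of_real s)) (PE_atlas n) U f \<and>
          (\<forall>p\<in>Z_fibre n h (of_real s). f (LB_real \<epsilon> p) = PE_real \<epsilon> (f p))"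
    if s: "s \<noteq> 0" "\<bar>s\<bar> \<le> 1" for s :: real
  proof -
    define a' b' c' d' where "a' = (\<lambda>m. (1 / s - \<beta> m) / 2)" and "b' = (\<lambda>m. - \<gamma> m)"
      and "c' = (\<lambda>m. - cnj (\<gamma> m))" and "d' = (\<lambda>m. (1 / s + \<beta> m) / 2)"
    have b': "b' m = cnj (c' m)" for m unfolding b'_def c'_def by simp
    have pos: "(cmod (c' m))\<^sup>2 < a' m * d' m" if "m \<in> {1..n}" for m
      using hplane_section_definite[OF s ball[OF that]] unfolding a'_def c'_def d'_def .
    have det: "of_real (a' m) * of_real (d' m) \<noteq> b' m * c' m" if "m \<in> {1..n}" for m
    proof
      assume "of_real (a' m) * of_real (d' m) = b' m * c' m"
      then have "complex_of_real (a' m * d' m) = of_real ((cmod (c' m))\<^sup>2)"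
        unfolding b' complex_norm_square by (simp add: mult.commute)
      then show False using pos[OF that] unfolding of_real_eq_iff by simp
    qed
    have "inj_on (\<lambda>m. curve11 (a' m) (b' m) (c' m) (d' m)) {1..n}"
    proof (rule inj_onI)
      fix m m' assume m: "m \<in> {1..n}" "m' \<in> {1..n}"
        and eq: "curve11 (a' m) (b' m) (c' m) (d' m) = curve11 (a' m') (b' m') (c' m') (d' m')"
      obtain k where k: "of_real (a' m') = k * of_real (a' m)" "b' m' = k * b' m"
          "c' m' = k * c' m" "of_real (d' m') = k * of_real (d' m)"
        by (rule curve11_subset_imp_proportional[OF det[OF m(1)] equalityD1[OF eq]])
      \<comment> \<open>Proportional equations agree, because the outer coefficients of both add up to \<open>1 / s\<close>.\<close>
      have sum: "a' l + d' l = 1 / s" for l unfolding a'_def d'_def by (simp add: field_simps)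
      have "complex_of_real (a' m' + d' m') = k * of_real (a' m + d' m)"
        using k(1,4) by (simp add: algebra_simps)
      then have "k = 1" unfolding sum using s(1) by simp
      then have "d' m' = d' m" "\<gamma> m' = \<gamma> m" using k(2,4) unfolding b'_def by simp_all
      then show "m = m'" using planes_inj[OF m] unfolding d'_def by simp
    qed
    moreover have "sigma p \<noteq> p" if m: "m \<in> {1..n}" and p: "p \<in> curve11 (a' m) (b' m) (c' m) (d' m)" for m p
      by (rule definite_curve11_no_real_points[OF pos[OF m] p[unfolded b']])
    ultimately have "lebrun_data n a' b' c' d'"
      unfolding lebrun_data_def smooth11_iff using det b' by blast
    moreover have "\<exists>U f. zariski_open_in (PE_atlas n) (lebrun_model n a' b' c' d') U \<and>
        biholomorphic_map (LB_atlas n) (Z_fibre n h (of_real s)) (PE_atlas n) U f \<and>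
        (cnj (of_real s) = complex_of_real s \<longrightarrow> cnj 1 = (1::complex) \<longrightarrow>
          (\<forall>e\<in>{1, -1}. \<forall>p\<in>Z_fibre n h (of_real s). f (LB_real e p) = PE_real e (f p)))"
    proof (rule nonzero_fibre_biholomorphic[of "of_real s" 1 n h a' b' c' d' "\<lambda>m. 1"])
      show "bideg11 (a' m) (b' m) (c' m) (d' m) (u, v) = 1 * h m (segre (complex_of_real s) (u, v))" for m u v
        unfolding h hplane_segre[OF s(1)] a'_def b'_def c'_def d'_def by simp
    qed (use s n hom in simp_all)
    ultimately show ?thesis using eps complex_cnj_one complex_cnj_complex_of_real[of s] by blast
  qed

  have part3: "\<exists>A B C f. hitchin_data n A B C \<and>
          biholomorphic_map (LB_atlas n) (Z_fibre n h 0) (Hit_atlas n) (hitchin_variety n A B C) f \<and>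
          (\<forall>p\<in>Z_fibre n h 0. f (LB_real \<epsilon> p) = Hit_real n \<epsilon> (f p))"
  proof -
    define B C where "B = (\<lambda>m. - \<beta> m / 2)" and "C = (\<lambda>m. - cnj (\<gamma> m))"
    have "inj_on (\<lambda>m. quadratic2 (\<gamma> m) (B m) (C m)) {1..n}"
    proof (rule inj_onI)
      fix m m' assume m: "m \<in> {1..n}" "m' \<in> {1..n}"
        and eq: "quadratic2 (\<gamma> m) (B m) (C m) = quadratic2 (\<gamma> m') (B m') (C m')"
      have \<gamma>: "\<gamma> m = \<gamma> m'" using fun_cong[OF eq, of "(1, 0)"] by simp
      have "complex_of_real (B m) = of_real (B m')"
        using fun_cong[OF eq, of "(1, 1)"] \<gamma> unfolding C_def by simp
      then show "m = m'" using planes_inj[OF m _ \<gamma>] unfolding B_def of_real_eq_iff by simp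
    qed
    then have "hitchin_data n \<gamma> B C" unfolding hitchin_data_def C_def by simp
    moreover have "\<exists>f. biholomorphic_map (LB_atlas n) (Z_fibre n h 0) (Hit_atlas n) (hitchin_variety n \<gamma> B C) f \<and>
        (\<forall>e\<in>{1, -1}. \<forall>p\<in>Z_fibre n h 0. f (LB_real e p) = Hit_real n e (f p))"
      by (rule zero_fibre_biholomorphic[of n h \<gamma> B C, OF n hom])
        (simp_all only: h hplane_cone_point B_def C_def)
    ultimately show ?thesis using eps by blast
  qed
  show ?thesis by (intro conjI allI impI part1 part2 part3) auto
qed

end
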